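(* Let $q$ be a prime power and let $\mathcal{H}$ be the Hermitian curve over $\mathbb{F}_{q^2}$. Consider the set of all subsets of $\mathbb{N}^3$ of the form $H(P,Q,R)$, where $(P,Q,R)$ runs over all triples of pairwise distinct $\mathbb{F}_{q^2}$-rational points of $\mathcal{H}$. If $q>3$, then the number of elements of this set (that is, the number of distinct Weierstrass semigroups of triples of distinct rational points on $\mathcal{H}$) is equal to the number of positive divisors of $q+1$. If $q=2$, this number is $1$, and if $q=3$, this number is $2$.
   Context: $\mathbb{N}$ denotes the set of nonnegative integers. The Hermitian curve $\mathcal{H}=\mathcal{H}_q$ over $\mathbb{F}_{q^2}$ is the smooth projective plane curve defined by $X^{q+1}-Y^qZ-YZ^q=0$; it has genus $g=q(q-1)/2$ and $q^3+1$ $\mathbb{F}_{q^2}$-rational points. For pairwise distinct rational points $P,Q,R$ of $\mathcal{H}$, the Weierstrass semigroup is $H(P,Q,R)=\{(a,b,c)\in\mathbb{N}^3 : aP+bQ+cR=(f)_\infty \text{ for some } f\in\mathbb{F}_{q^2}(\mathcal{H})\}$, where $(f)_\infty$ is the pole divisor of $f$. *)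

theory Defs
  imports
    "HOL-Algebra.Algebraic_Closure_Type"
    "HOL-Number_Theory.Prime_Powers"
begin

(* An element of 'a poly poly poly is read as a polynomial in X, Y, Z: the coefficient of
   X^i Y^j Z^k is coeff (coeff (coeff F i) j) k. *)

type_synonym 'a poly3 = "'a poly poly poly"

definition var_X :: "'a::field poly3" where "var_X = [:0, 1:]"
definition var_Y :: "'a::field poly3" where "var_Y = [:[:0, 1:]:]"
definition var_Z :: "'a::field poly3" where "var_Z = [:[:[:0, 1:]:]:]"

definition homogeneous :: "nat \<Rightarrow> 'a::field poly3 \<Rightarrow> bool" where
  "homogeneous d F \<longleftrightarrow>
     (\<forall>i j k. Polynomial.coeff (Polynomial.coeff (Polynomial.coeff F i) j) k \<noteq> 0
        \<longrightarrow> i + j + k = d)"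

fun eval3 :: "'a::field poly3 \<Rightarrow> 'a \<times> 'a \<times> 'a \<Rightarrow> 'a" where
  "eval3 F (x, y, z) = poly (poly (poly F [:[:x:]:]) [:y:]) z"

definition base_change :: "'a::field poly3 \<Rightarrow> 'a alg_closure poly3" where
  "base_change = map_poly (map_poly (map_poly to_ac))"

(* A point of the projective plane over the algebraic closure of 'a is the class of its
   homogeneous coordinate vectors. *)

type_synonym 'a ppoint = "('a alg_closure \<times> 'a alg_closure \<times> 'a alg_closure) set"

fun ppoint_of :: "'a::field alg_closure \<times> 'a alg_closure \<times> 'a alg_closure \<Rightarrow> 'a ppoint" where
  "ppoint_of (x, y, z) = {(c * x, c * y, c * z) | c. c \<noteq> 0}"

definition proj_plane :: "'a::field ppoint set" where
  "proj_plane = {ppoint_of v | v. v \<noteq> (0, 0, 0)}"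

definition vanishes_at :: "'a::field poly3 \<Rightarrow> 'a ppoint \<Rightarrow> bool" where
  "vanishes_at F P \<longleftrightarrow> (\<forall>v\<in>P. eval3 (base_change F) v = 0)"

(* The geometric points of the plane curve C = 0, and those having a coordinate vector
   over the base field. *)

definition curve_points :: "'a::field poly3 \<Rightarrow> 'a ppoint set" where
  "curve_points C = {P \<in> proj_plane. vanishes_at C P}"

definition rational_points :: "'a::field poly3 \<Rightarrow> 'a ppoint set" where
  "rational_points C = {P \<in> curve_points C. \<exists>x y z. (to_ac x, to_ac y, to_ac z) \<in> P}"

(* The function field, over the base field, of an irreducible plane curve C = 0: classes of
   fractions F/G of forms of equal degree whose denominator does not vanish identically on
   the curve; F/G and F'/G' are identified if they agree on the curve. *)

definition curve_fractions :: "'a::field poly3 \<Rightarrow> ('a poly3 \<times> 'a poly3) set" where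
  "curve_fractions C = {(F, G). (\<exists>d. homogeneous d F \<and> homogeneous d G) \<and> \<not> C dvd G}"

definition fraction_eq ::
    "'a::field poly3 \<Rightarrow> (('a poly3 \<times> 'a poly3) \<times> ('a poly3 \<times> 'a poly3)) set" where
  "fraction_eq C = {((F, G), (F', G')). (F, G) \<in> curve_fractions C \<and>
     (F', G') \<in> curve_fractions C \<and> C dvd F * G' - F' * G}"

lemma equiv_fraction_eq:
  assumes "prime_elem C"
  shows "equiv (curve_fractions C) (fraction_eq C)"
proof (rule equivI)
  show "fraction_eq C \<subseteq> curve_fractions C \<times> curve_fractions C"
    by (auto simp: fraction_eq_def)
  show "refl_on (curve_fractions C) (fraction_eq C)"
    by (auto simp: refl_on_def fraction_eq_def)
  show "sym (fraction_eq C)"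
  proof (rule symI, clarify)
    fix F G F' G' assume "((F, G), (F', G')) \<in> fraction_eq C"
    moreover have "F' * G - F * G' = - (F * G' - F' * G)"
      by simp
    then have "C dvd F' * G - F * G' \<longleftrightarrow> C dvd F * G' - F' * G"
      by (simp only: dvd_minus_iff)
    ultimately show "((F', G'), (F, G)) \<in> fraction_eq C"
      by (simp add: fraction_eq_def)
  qed
  show "trans (fraction_eq C)"
  proof (rule transI, clarify)
    fix F G F' G' F'' G''
    assume a: "((F, G), (F', G')) \<in> fraction_eq C" "((F', G'), (F'', G'')) \<in> fraction_eq C"
    have "G' * (F * G'' - F'' * G) = G'' * (F * G' - F' * G) + G * (F' * G'' - F'' * G')"
      by (simp add: algebra_simps)
    with a have "C dvd G' * (F * G'' - F'' * G)"
      by (auto simp: fraction_eq_def)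
    moreover from a have "\<not> C dvd G'"
      by (auto simp: fraction_eq_def curve_fractions_def)
    ultimately have "C dvd F * G'' - F'' * G"
      using assms prime_elem_dvd_mult_iff by blast
    with a show "((F, G), (F'', G'')) \<in> fraction_eq C"
      by (auto simp: fraction_eq_def)
  qed
qed

type_synonym 'a ratfun = "('a poly3 \<times> 'a poly3) set"

definition function_field :: "'a::field poly3 \<Rightarrow> 'a ratfun set" where
  "function_field C = curve_fractions C // fraction_eq C"

(* The inverse of a nonzero element of the function field. *)

definition ratfun_inverse :: "'a ratfun \<Rightarrow> 'a ratfun" where
  "ratfun_inverse f = (\<lambda>(F, G). (G, F)) ` f"

definition local_ring :: "'a::field poly3 \<Rightarrow> 'a ppoint \<Rightarrow> 'a ratfun set" where
  "local_ring C P = {f \<in> function_field C. \<exists>(F, G)\<in>f. \<not> vanishes_at G P}"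

(* The n-th power of the homogeneous ideal generated by the forms over the base field that
   vanish at P; for n = 0 this is the whole polynomial ring. *)

definition point_ideal_power :: "'a::field ppoint \<Rightarrow> nat \<Rightarrow> 'a poly3 set" where
  "point_ideal_power P n =
     Modules.module.span (*) {\<Prod>i<n. F i | F. \<forall>i<n. \<exists>d. homogeneous d (F i) \<and> vanishes_at (F i) P}"

lemma module_times: "Modules.module ((*) :: 'r::comm_ring_1 \<Rightarrow> 'r \<Rightarrow> 'r)"
  by unfold_locales (simp_all add: algebra_simps)

(* The n-th power of the maximal ideal of the local ring at P. Sums and products of
   fractions can be brought to a common denominator not vanishing at P, so only the numerator
   has to be constrained. *)

definition maximal_ideal_power :: "'a::field poly3 \<Rightarrow> 'a ppoint \<Rightarrow> nat \<Rightarrow> 'a ratfun set" where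
  "maximal_ideal_power C P n =
     {f \<in> function_field C. \<exists>(F, G)\<in>f. F \<in> point_ideal_power P n \<and> \<not> vanishes_at G P}"

(* If the curve is smooth at P, the local ring is a discrete valuation ring, with valuation
   v(g) = max {n. g lies in the n-th power of the maximal ideal} on its nonzero elements.
   If f is not in the local ring, then its inverse is, and f has a pole of order v(1/f). *)

definition pole_order :: "'a::field poly3 \<Rightarrow> 'a ppoint \<Rightarrow> 'a ratfun \<Rightarrow> nat" where
  "pole_order C P f =
     (if f \<in> local_ring C P then 0
      else Max {n. ratfun_inverse f \<in> maximal_ideal_power C P n})"

(* Divisors are functions on the geometric points, zero outside the curve. The base field is
   meant to be perfect, so that pole orders do not change when passing to the algebraic
   closure. *)

definition pole_divisor :: "'a::field poly3 \<Rightarrow> 'a ratfun \<Rightarrow> 'a ppoint \<Rightarrow> nat" where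
  "pole_divisor C f = (\<lambda>T. if T \<in> curve_points C then pole_order C T f else 0)"

definition point_divisor :: "'a ppoint \<Rightarrow> 'a ppoint \<Rightarrow> nat" where
  "point_divisor P = (\<lambda>T. if T = P then 1 else 0)"

definition weierstrass_semigroup ::
    "'a::field poly3 \<Rightarrow> 'a ppoint \<Rightarrow> 'a ppoint \<Rightarrow> 'a ppoint \<Rightarrow> (nat \<times> nat \<times> nat) set" where
  "weierstrass_semigroup C P Q R =
     {(a, b, c). \<exists>f\<in>function_field C.
        (\<lambda>T. a * point_divisor P T + b * point_divisor Q T + c * point_divisor R T)
          = pole_divisor C f}"

definition hermitian_form :: "nat \<Rightarrow> 'a::field poly3" where
  "hermitian_form q = var_X ^ (q + 1) - var_Y ^ q * var_Z - var_Y * var_Z ^ q"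

definition hermitian_semigroups ::
    "'a::field itself \<Rightarrow> nat \<Rightarrow> (nat \<times> nat \<times> nat) set set" where
  "hermitian_semigroups _ q =
     {weierstrass_semigroup (hermitian_form q :: 'a poly3) P Q R | P Q R.
        P \<in> rational_points (hermitian_form q) \<and>
        Q \<in> rational_points (hermitian_form q) \<and>
        R \<in> rational_points (hermitian_form q) \<and>
        P \<noteq> Q \<and> P \<noteq> R \<and> Q \<noteq> R}"

end

theory Submission
  imports Defs "HOL-Computational_Algebra.Formal_Power_Series" "HOL-Number_Theory.Residues"
begin

text \<open>
  Let \<open>\<rho> = - (h(P,Q) h(Q,R) h(R,P))\<^bsup>q-1\<^esup>\<close>, where \<open>h\<close> is the Hermitian form of the curve evaluated on
  coordinate vectors. This is an invariant of the triple up to inversion, a \<open>(q+1)\<close>-st root of unity, and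
  it is \<open>1\<close> exactly for collinear points.

  The canonical class is \<open>q - 2\<close> times the class of a line, and the tangent at a rational point meets the
  curve only there, with multiplicity \<open>q + 1\<close>. By Riemann--Roch, \<open>aP + bQ + cR\<close> is therefore a pole
  divisor unless for one of the points, say \<open>P\<close> with \<open>a > 0\<close>, there is a plane form of degree \<open>q - 2\<close>
  with order exactly \<open>a - 1\<close> at \<open>P\<close> and orders at least \<open>b\<close>, \<open>c\<close> at \<open>Q\<close>, \<open>R\<close>. Splitting off tangents
  leaves forms of some degree \<open>m\<close> with all prescribed orders at most \<open>m\<close>; such a form is determined modulo
  the three tangents by its restrictions to them, and the only obstruction to gluing binary forms on the
  three tangents arises when these are \<open>m\<close>-th powers. It vanishes precisely if \<open>\<rho>\<^bsup>m\<^esup> = 1\<close>. Hence the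
  semigroup depends only on the set of \<open>m\<close> in \<open>{1..q-2}\<close> with \<open>\<rho>\<^bsup>m\<^esup> = 1\<close>, and it determines this set:
  \<open>(m + (q+1)(q-2-m), m, m)\<close> lies in it if and only if \<open>\<rho>\<^bsup>m\<^esup> = 1\<close>. Every divisor of \<open>q + 1\<close> is the
  order of some \<open>\<rho>\<close>.

  Orders are computed in explicit power series expansions over the algebraic closure. Riemann--Roch is only
  needed along chains of divisors supported at the three points, where it follows from counting dimensions
  and from the gap \<open>2g - 1\<close> at a rational point.
\<close>

section \<open>Evaluation of forms and orders of power series\<close>

text \<open>Noether's theorem carries functions to forms: a function whose poles are bounded by n
  tangents at each of the three points is F/L, where L is the product of these tangents and F has
  degree 3n. Pole orders thus become orders of plane forms.

  The root of unity arises at the vertices of the triangle of tangents. For noncollinear points and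
  orders at least m at all three, a form of degree m restricts to each tangent as a multiple of the
  m-th power of the line joining the point of contact to the opposite vertex. Comparing the
  multiples at the vertices and going once around the triangle produces the factor rho^m.

  The change of field needs care. Forms over the algebraic closure come back to the field with q^2
  elements by applying linear functionals to coefficients; one form that is extremal at up to three
  points exists because q^2 > 3. At a nonrational point it is only settled whether there is a pole;
  exact pole orders are computed at rational points.

  A divisor of q + 1 is visible only if it is at most q - 2. For q > 3 this hides q + 1 alone; for q
  = 2 and q = 3 it hides other divisors as well.\<close>

locale ring_homo =
  fixes h :: "'a::comm_ring_1 \<Rightarrow> 'r::comm_ring_1"
  assumes hom_add: "h (a + b) = h a + h b"
    and hom_mult: "h (a * b) = h a * h b"
    and hom_1: "h 1 = 1"
begin

lemma hom_0: "h 0 = 0"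
  using hom_add[of 0 0] by simp

lemma hom_minus: "h (- a) = - h a"
  using hom_add[of a "- a"] by (simp add: hom_0 minus_unique)

lemma hom_diff: "h (a - b) = h a - h b"
  using hom_add[of a "- b"] by (simp add: hom_minus)

lemma hom_power: "h (a ^ n) = h a ^ n"
  by (induction n) (simp_all add: hom_1 hom_mult)

lemma hom_sum: "h (sum f A) = (\<Sum>i\<in>A. h (f i))"
  by (induction A rule: infinite_finite_induct) (simp_all add: hom_0 hom_add)

lemma hom_prod: "h (prod f A) = (\<Prod>i\<in>A. h (f i))"
  by (induction A rule: infinite_finite_induct) (simp_all add: hom_1 hom_mult)

end

definition evp :: "('a::comm_ring_1 \<Rightarrow> 'r::comm_ring_1) \<Rightarrow> 'a poly \<Rightarrow> 'r \<Rightarrow> 'r" where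
  "evp h p x = poly (map_poly h p) x"

context ring_homo
begin

lemma evp_0: "evp h 0 x = 0"
  by (simp add: evp_def)

lemma evp_pCons: "evp h (pCons a p) x = h a + x * evp h p x"
  by (simp add: evp_def map_poly_pCons hom_0)

lemma evp_add: "evp h (p + p') x = evp h p x + evp h p' x"
proof (induction p arbitrary: p')
  case (pCons a p)
  show ?case
    by (cases p') (simp_all add: evp_pCons evp_0 hom_add pCons.IH distrib_left)
qed (simp add: evp_0)

lemma evp_smult: "evp h (smult a p) x = h a * evp h p x"
  by (induction p) (simp_all add: evp_0 evp_pCons hom_mult algebra_simps)

lemma evp_mult: "evp h (p * p') x = evp h p x * evp h p' x"
  by (induction p) (simp_all add: evp_0 evp_pCons evp_add evp_smult hom_0 algebra_simps)

lemma ring_homo_evp: "ring_homo (\<lambda>p. evp h p x)"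
  by unfold_locales (simp_all add: evp_add evp_mult one_pCons evp_pCons evp_0 hom_1)

end

text \<open>The target ring is left open because one evaluation serves three purposes: values at
  points (identity), expansions in power series (\<open>fps_const\<close>), and values of forms over
  the base field in its closure (\<open>to_ac\<close>).\<close>

definition ev3 :: "('a::comm_ring_1 \<Rightarrow> 'r::comm_ring_1) \<Rightarrow> 'a poly3 \<Rightarrow> 'r \<times> 'r \<times> 'r \<Rightarrow> 'r" where
  "ev3 h F v = (case v of (x, y, z) \<Rightarrow> evp (\<lambda>c. evp (\<lambda>e. evp h e z) c y) F x)"

definition con :: "'a::comm_ring_1 \<Rightarrow> 'a poly3" where
  "con c = [:[:[:c:]:]:]"

lemma ring_homo_con: "ring_homo con"
  by unfold_locales (simp_all add: con_def one_pCons)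

lemmas con_simps = ring_homo.hom_add[OF ring_homo_con] ring_homo.hom_mult[OF ring_homo_con]
  ring_homo.hom_1[OF ring_homo_con] ring_homo.hom_0[OF ring_homo_con]
  ring_homo.hom_minus[OF ring_homo_con] ring_homo.hom_diff[OF ring_homo_con]
  ring_homo.hom_power[OF ring_homo_con]

context ring_homo
begin

lemma ring_homo_ev3: "ring_homo (\<lambda>F. ev3 h F v)"
proof -
  obtain x y z where v: "v = (x, y, z)"
    by (cases v)
  show ?thesis
    unfolding ev3_def v prod.case
    by (intro ring_homo.ring_homo_evp ring_homo_axioms)
qed

lemmas ev3_add = ring_homo.hom_add[OF ring_homo_ev3]
  and ev3_mult = ring_homo.hom_mult[OF ring_homo_ev3]
  and ev3_1 = ring_homo.hom_1[OF ring_homo_ev3]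
  and ev3_0 = ring_homo.hom_0[OF ring_homo_ev3]
  and ev3_minus = ring_homo.hom_minus[OF ring_homo_ev3]
  and ev3_diff = ring_homo.hom_diff[OF ring_homo_ev3]
  and ev3_power = ring_homo.hom_power[OF ring_homo_ev3]
  and ev3_sum = ring_homo.hom_sum[OF ring_homo_ev3]
  and ev3_prod = ring_homo.hom_prod[OF ring_homo_ev3]

lemma ev3_con: "ev3 h (con c) v = h c"
proof -
  obtain x y z where v: "v = (x, y, z)"
    by (cases v)
  interpret e: ring_homo "\<lambda>e. evp h e z"
    by (rule ring_homo_evp)
  interpret f: ring_homo "\<lambda>c. evp (\<lambda>e. evp h e z) c y"
    by (rule e.ring_homo_evp)
  show ?thesis
    by (simp add: ev3_def v con_def evp_pCons e.evp_pCons f.evp_pCons evp_0 e.evp_0 f.evp_0)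
qed

end

lemma ev3_vars:
  fixes h :: "'a::field \<Rightarrow> 'r::comm_ring_1"
  assumes "ring_homo h"
  shows "ev3 h var_X (x, y, z) = x" "ev3 h var_Y (x, y, z) = y" "ev3 h var_Z (x, y, z) = z"
proof -
  interpret ring_homo h by fact
  interpret e: ring_homo "\<lambda>e. evp h e z"
    by (rule ring_homo_evp)
  interpret f: ring_homo "\<lambda>c. evp (\<lambda>e. evp h e z) c y"
    by (rule e.ring_homo_evp)
  show "ev3 h var_X (x, y, z) = x" "ev3 h var_Y (x, y, z) = y" "ev3 h var_Z (x, y, z) = z"
    by (simp_all add: ev3_def var_X_def var_Y_def var_Z_def evp_pCons e.evp_pCons f.evp_pCons
        evp_0 e.evp_0 f.evp_0 hom_0 hom_1 one_pCons)
qed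

lemmas ev3_simps = ring_homo.ev3_add ring_homo.ev3_mult ring_homo.ev3_1 ring_homo.ev3_0
  ring_homo.ev3_minus ring_homo.ev3_diff ring_homo.ev3_power ring_homo.ev3_sum
  ring_homo.ev3_prod ring_homo.ev3_con ev3_vars

section \<open>Forms: closure properties and induction on the degree\<close>

lemma homogeneous_con: "homogeneous 0 (con (c::'a::field))"
  by (auto simp: homogeneous_def con_def coeff_pCons split: nat.splits)

lemma homogeneous_0: "homogeneous d (0::'a::field poly3)"
  by (simp add: homogeneous_def)

lemma homogeneous_add: "homogeneous d F \<Longrightarrow> homogeneous d G \<Longrightarrow> homogeneous d (F + G)"
  unfolding homogeneous_def by (metis add.right_neutral add_0 coeff_add)

lemma homogeneous_con_mult: "homogeneous d F \<Longrightarrow> homogeneous d (con c * F)"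
  by (auto simp: homogeneous_def con_def)

lemma homogeneous_minus: "homogeneous d F \<Longrightarrow> homogeneous d (- F)"
  by (simp add: homogeneous_def)

lemma homogeneous_diff: "homogeneous d F \<Longrightarrow> homogeneous d G \<Longrightarrow> homogeneous d (F - G)"
  using homogeneous_add[of d F "- G"] homogeneous_minus by auto

lemma homogeneous_sum: "(\<And>i. i \<in> A \<Longrightarrow> homogeneous d (F i)) \<Longrightarrow> homogeneous d (sum F A)"
  by (induction A rule: infinite_finite_induct) (simp_all add: homogeneous_0 homogeneous_add)

lemma var_X_mult: "var_X * F = pCons 0 (F::'a::field poly3)"
  by (simp add: var_X_def)

lemma var_Y_mult: "var_Y * F = smult [:0, 1:] (F::'a::field poly3)"
  by (simp add: var_Y_def)

lemma var_Z_mult: "var_Z * F = smult [:[:0, 1:]:] (F::'a::field poly3)"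
  by (simp add: var_Z_def)

lemma homogeneous_var_mult:
  assumes "homogeneous d F"
  shows "homogeneous (Suc d) (var_X * F)" "homogeneous (Suc d) (var_Y * F)"
    "homogeneous (Suc d) (var_Z * F)"
  using assms unfolding homogeneous_def var_X_mult var_Y_mult var_Z_mult
  by (auto simp: coeff_pCons split: nat.splits)

lemma homogeneous_Suc_decompose:
  fixes F :: "'a::field poly3"
  assumes "homogeneous (Suc d) F"
  obtains F1 F2 F3 where "homogeneous d F1" "homogeneous d F2" "homogeneous d F3"
    "F = var_X * F1 + var_Y * F2 + var_Z * F3"
proof -
  obtain f F1 where F: "F = pCons f F1" by (cases F)
  obtain g F2 where f: "f = pCons g F2" by (cases f)
  obtain e F3 where g: "g = pCons e F3" by (cases g)
  note [simp] = F f g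
  have H: "coeff (coeff (coeff F i) j) k \<noteq> 0 \<Longrightarrow> i + j + k = Suc d" for i j k
    using assms by (auto simp: homogeneous_def)
  have e: "e = 0"
    using H[of 0 0 0] by auto
  show ?thesis
  proof
    show "homogeneous d F1"
      using H[of "Suc i" for i] by (auto simp: homogeneous_def)
    show "homogeneous d [:F2:]"
      using H[of 0 "Suc j" for j] by (auto simp: homogeneous_def coeff_pCons split: nat.splits)
    show "homogeneous d [:[:F3:]:]"
      using H[of 0 0 "Suc k" for k] by (auto simp: homogeneous_def coeff_pCons split: nat.splits)
    show "F = var_X * F1 + var_Y * [:F2:] + var_Z * [:[:F3:]:]"
      unfolding var_X_mult var_Y_mult var_Z_mult by (simp add: e)
  qed
qed

lemma homogeneous_0_con:
  assumes "homogeneous 0 (F::'a::field poly3)"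
  obtains c where "F = con c"
proof
  have H: "coeff (coeff (coeff F i) j) k \<noteq> 0 \<Longrightarrow> i = 0 \<and> j = 0 \<and> k = 0" for i j k
    using assms by (force simp: homogeneous_def)
  show "F = con (coeff (coeff (coeff F 0) 0) 0)"
    by (intro poly_eqI) (use H in \<open>auto simp: con_def coeff_pCons split: nat.splits\<close>)
qed

text \<open>Every monomial of positive degree contains a variable. The splitting is not unique, but
  it suffices for properties that are preserved by sums and by multiplication with
  variables.\<close>

lemma homogeneous_induct [consumes 1, case_names con step]:
  fixes F :: "'a::field poly3"
  assumes "homogeneous d F"
    and "\<And>c. P 0 (con c)"
    and "\<And>d F1 F2 F3. homogeneous d F1 \<Longrightarrow> homogeneous d F2 \<Longrightarrow> homogeneous d F3 \<Longrightarrow>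
      P d F1 \<Longrightarrow> P d F2 \<Longrightarrow> P d F3 \<Longrightarrow> P (Suc d) (var_X * F1 + var_Y * F2 + var_Z * F3)"
  shows "P d F"
  using assms(1)
proof (induction d arbitrary: F)
  case 0
  then show ?case by (metis homogeneous_0_con assms(2))
next
  case (Suc d)
  then show ?case by (metis homogeneous_Suc_decompose assms(3))
qed

lemma homogeneous_mult:
  assumes "homogeneous d F" "homogeneous e G"
  shows "homogeneous (d + e) (F * G)"
  using assms(1)
proof (induction rule: homogeneous_induct)
  case (con c)
  then show ?case using homogeneous_con_mult[OF assms(2)] by simp
next
  case (step d F1 F2 F3)
  then show ?case
    by (auto simp: distrib_right mult.assoc intro!: homogeneous_add homogeneous_var_mult)
qed

lemma homogeneous_vars: "homogeneous 1 var_X" "homogeneous 1 var_Y" "homogeneous 1 var_Z"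
  using homogeneous_var_mult[OF homogeneous_con[of 1]] by (simp_all add: con_simps)

lemma homogeneous_1: "homogeneous 0 1"
  using homogeneous_con[of 1] by (simp add: con_simps)

lemma homogeneous_power: "homogeneous d F \<Longrightarrow> homogeneous (n * d) (F ^ n)"
  by (induction n) (simp_all add: homogeneous_1 homogeneous_mult)

lemma homogeneous_power1: "homogeneous 1 F \<Longrightarrow> homogeneous n (F ^ n)"
  using homogeneous_power[of 1 F n] by simp

lemma homogeneous_prod:
  "finite A \<Longrightarrow> (\<And>i. i \<in> A \<Longrightarrow> homogeneous (d i) (F i)) \<Longrightarrow> homogeneous (sum d A) (prod F A)"
  by (induction A rule: finite_induct) (simp_all add: homogeneous_1 homogeneous_mult)

lemma ev3_scale:
  assumes "ring_homo h" "homogeneous d F"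
  shows "ev3 h F (c * x, c * y, c * z) = c ^ d * ev3 h F (x, y, z)"
  using assms(2)
proof (induction rule: homogeneous_induct)
  case (con c)
  then show ?case by (simp add: ev3_simps[OF assms(1)])
next
  case (step d F1 F2 F3)
  then show ?case by (simp add: ev3_simps[OF assms(1)] algebra_simps)
qed

lemma eval3_eq_ev3: "eval3 F v = ev3 (\<lambda>x. x) F (v :: 'a::field \<times> 'a \<times> 'a)"
proof -
  obtain x y z where v: "v = (x, y, z)"
    by (cases v)
  interpret ring_homo "\<lambda>x::'a. x" by unfold_locales auto
  interpret e: ring_homo "\<lambda>e::'a poly. poly e z" by unfold_locales auto
  interpret f: ring_homo "\<lambda>c::'a poly poly. poly (poly c [:y:]) z" by unfold_locales auto
  have "evp (\<lambda>x::'a. x) p z = poly p z" for p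
    by (induction p) (simp_all add: evp_pCons evp_0)
  moreover have "evp (\<lambda>e. poly e z) p y = poly (poly p [:y:]) z" for p
    by (induction p) (simp_all add: e.evp_pCons e.evp_0)
  moreover have "evp (\<lambda>c. poly (poly c [:y:]) z) F x = poly (poly (poly F [:[:x:]:]) [:y:]) z"
    by (induction F) (simp_all add: f.evp_pCons f.evp_0)
  ultimately show ?thesis by (simp add: ev3_def v)
qed

lemma ev3_map_poly:
  assumes "h 0 = 0" "g 0 = 0"
  shows "ev3 h (map_poly (map_poly (map_poly g)) F) v = ev3 (\<lambda>x. h (g x)) F v"
proof -
  have m: "map_poly h' (map_poly g' p) = map_poly (\<lambda>x. h' (g' x)) p"
    if "h' 0 = 0" "g' 0 = 0" for h' :: "'x::zero \<Rightarrow> 'y::zero" and g' :: "'z::zero \<Rightarrow> 'x" and p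
    by (intro poly_eqI) (simp add: coeff_map_poly that)
  show ?thesis
    by (cases v) (simp add: ev3_def evp_def m assms map_poly_0)
qed

section \<open>Orders of power series\<close>

definition vge :: "'a::zero fps \<Rightarrow> nat \<Rightarrow> bool" where
  "vge f n \<longleftrightarrow> (\<forall>i<n. fps_nth f i = 0)"

lemma vge_iff: "vge f n \<longleftrightarrow> (\<exists>g. f = fps_X ^ n * (g :: 'a::comm_ring_1 fps))"
proof
  assume f: "vge f n"
  have "f = fps_X ^ n * fps_shift n f"
    by (rule fps_ext) (use f in \<open>auto simp: fps_X_power_mult_nth vge_def\<close>)
  then show "\<exists>g. f = fps_X ^ n * g" ..
qed (auto simp: vge_def fps_X_power_mult_nth)

lemma vge_0 [simp]: "vge f 0"
  by (simp add: vge_def)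

lemma vge_zero [simp]: "vge 0 n"
  by (simp add: vge_def)

lemma vge_Suc: "vge f (Suc n) \<longleftrightarrow> vge f n \<and> fps_nth f n = 0"
  by (auto simp: vge_def less_Suc_eq)

lemma vge_mono: "vge f n \<Longrightarrow> m \<le> n \<Longrightarrow> vge f m"
  by (simp add: vge_def)

lemma vge_nth: "vge f n \<Longrightarrow> i < n \<Longrightarrow> fps_nth f i = 0"
  by (simp add: vge_def)

lemma vge_add: "vge f n \<Longrightarrow> vge g n \<Longrightarrow> vge (f + g) n"
  for f g :: "'a::comm_ring_1 fps"
  by (simp add: vge_def)

lemma vge_mult:
  fixes f g :: "'a::comm_ring_1 fps"
  assumes "vge f m" "vge g n"
  shows "vge (f * g) (m + n)"
proof -
  obtain f' g' where "f = fps_X ^ m * f'" "g = fps_X ^ n * g'"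
    using assms by (auto simp: vge_iff)
  then have "f * g = fps_X ^ (m + n) * (f' * g')"
    by (simp add: power_add algebra_simps)
  then show ?thesis
    unfolding vge_iff ..
qed

lemma vge_mult_left: "vge f m \<Longrightarrow> vge (f * g) m"
  for f g :: "'a::comm_ring_1 fps"
  using vge_mult[of f m g 0] by simp

lemma vge_mult_right: "vge g m \<Longrightarrow> vge (f * g) m"
  for f g :: "'a::comm_ring_1 fps"
  using vge_mult[of f 0 g m] by simp

lemma vge_power: "vge f m \<Longrightarrow> vge (f ^ n) (n * m)"
  for f :: "'a::comm_ring_1 fps"
  by (induction n) (simp_all add: vge_mult)

lemma vge_nth_mult:
  fixes f g :: "'a::comm_ring_1 fps"
  assumes "vge f m" "vge g n"
  shows "fps_nth (f * g) (m + n) = fps_nth f m * fps_nth g n"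
proof -
  obtain f' g' where f: "f = fps_X ^ m * f'" and g: "g = fps_X ^ n * g'"
    using assms by (auto simp: vge_iff)
  have "f * g = fps_X ^ (m + n) * (f' * g')"
    by (simp add: f g power_add algebra_simps)
  then have "fps_nth (f * g) (m + n) = fps_nth f' 0 * fps_nth g' 0"
    by (simp add: fps_X_power_mult_nth)
  then show ?thesis
    by (simp add: f g fps_X_power_mult_nth)
qed

lemma vge_nth_power:
  fixes f :: "'a::comm_ring_1 fps"
  assumes "vge f m"
  shows "fps_nth (f ^ n) (n * m) = fps_nth f m ^ n"
  by (induction n) (simp_all add: vge_nth_mult assms vge_power)

lemma vge_cancel:
  fixes f g :: "'a::idom fps"
  assumes "vge f m" "fps_nth f m \<noteq> 0" "vge (f * g) (m + n)"
  shows "vge g n"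
  using assms(3)
proof (induction n)
  case (Suc n)
  then have "vge g n"
    using vge_Suc[of "f * g" "m + n"] by simp
  with Suc.prems vge_nth_mult[OF assms(1) this] assms(2) show ?case
    by (simp add: vge_Suc)
qed simp

lemma vge_subdegree:
  assumes "f \<noteq> (0::'a::comm_ring_1 fps)"
  shows "vge f n \<longleftrightarrow> n \<le> subdegree f"
proof
  assume "vge f n"
  then show "n \<le> subdegree f"
    using nth_subdegree_nonzero[OF assms] vge_nth[of f n "subdegree f"] by force
next
  assume "n \<le> subdegree f"
  then show "vge f n"
    by (auto simp: vge_def intro: nth_less_subdegree_zero)
qed

text \<open>The zero series satisfies \<open>vge\<close> for every bound and \<open>vex\<close> for
  none. This is the order convention needed for divisors, in contrast to
  \<open>subdegree 0 = 0\<close>.\<close>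

definition vex :: "'a::zero fps \<Rightarrow> nat \<Rightarrow> bool" where
  "vex f n \<longleftrightarrow> vge f n \<and> fps_nth f n \<noteq> 0"

lemma vex_mult: "vex f m \<Longrightarrow> vex g n \<Longrightarrow> vex (f * g) (m + n)"
  for f g :: "'a::idom fps"
  by (simp add: vex_def vge_mult vge_nth_mult)

lemma vex_power: "vex f m \<Longrightarrow> vex (f ^ n) (n * m)"
  for f :: "'a::idom fps"
  by (simp add: vex_def vge_power vge_nth_power)

lemma vex_vge: "vex f n \<Longrightarrow> vge f m \<longleftrightarrow> m \<le> n"
  by (meson not_less vex_def vge_def vge_mono)

lemma vex_exists: "f \<noteq> 0 \<Longrightarrow> \<exists>n. vex f n"
  for f :: "'a::comm_ring_1 fps"
  by (metis nth_subdegree_nonzero order_refl vex_def vge_subdegree)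

lemma vex_nonzero: "vex f n \<Longrightarrow> f \<noteq> 0"
  by (auto simp: vex_def)

lemma vex_cancel:
  fixes f g :: "'a::idom fps"
  assumes "vex f m" "vex (f * g) (m + n)"
  shows "vex g n"
  using assms vge_cancel[of f m g n] vge_nth_mult[of f m g n] by (auto simp: vex_def)

section \<open>Forms modulo the Hermitian form\<close>

text \<open>Gaussian elimination: one equation is solved for a pivot unknown \<open>i0\<close>, and
  the remaining system still has more unknowns than equations. It takes the place of dimension
  arguments in \<open>norm_exists\<close> and \<open>duality_chain\<close>.\<close>

lemma underdetermined_system:
  fixes a :: "'i \<Rightarrow> 'j \<Rightarrow> 'k::field"
  assumes "finite J" "finite I" "card J < card I"
  shows "\<exists>c. (\<exists>i\<in>I. c i \<noteq> 0) \<and> (\<forall>j\<in>J. (\<Sum>i\<in>I. a i j * c i) = 0)"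
  using assms
proof (induction J arbitrary: I a rule: finite_induct)
  case empty
  then have "I \<noteq> {}" by auto
  then show ?case by (intro exI[of _ "\<lambda>_. 1"]) auto
next
  case (insert j J)
  show ?case
  proof (cases "\<forall>i\<in>I. a i j = 0")
    case True
    have "card J < card I" using insert by simp
    with insert.IH[of I a] insert.prems obtain c where
      "\<exists>i\<in>I. c i \<noteq> 0" "\<forall>j\<in>J. (\<Sum>i\<in>I. a i j * c i) = 0" by blast
    with True show ?thesis by (intro exI[of _ c]) auto
  next
    case False
    then obtain i0 where i0: "i0 \<in> I" "a i0 j \<noteq> 0" by auto
    define I' where "I' = I - {i0}"
    have I': "finite I'" "card J < card I'"
      using insert i0 by (simp_all add: I'_def)
    define a' where "a' i j' = a i j' - a i j * a i0 j' / a i0 j" for i j'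
    obtain c where c: "\<exists>i\<in>I'. c i \<noteq> 0" "\<forall>j\<in>J. (\<Sum>i\<in>I'. a' i j * c i) = 0"
      using insert.IH[OF I', of a'] by blast
    define c' where "c' i = (if i = i0 then - (\<Sum>i\<in>I'. a i j * c i) / a i0 j else c i)" for i
    have sum: "(\<Sum>i\<in>I. a i j' * c' i)
        = (\<Sum>i\<in>I'. a i j' * c i) - a i0 j' / a i0 j * (\<Sum>i\<in>I'. a i j * c i)" for j'
    proof -
      have "(\<Sum>i\<in>I. a i j' * c' i) = a i0 j' * c' i0 + (\<Sum>i\<in>I'. a i j' * c' i)"
        unfolding I'_def using insert.prems i0 by (simp add: sum.remove)
      also have "(\<Sum>i\<in>I'. a i j' * c' i) = (\<Sum>i\<in>I'. a i j' * c i)"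
        by (rule sum.cong) (auto simp: c'_def I'_def)
      finally show ?thesis by (simp add: c'_def)
    qed
    show ?thesis
    proof (intro exI[of _ c'] conjI ballI)
      show "\<exists>i\<in>I. c' i \<noteq> 0"
        using c(1) by (auto simp: c'_def I'_def)
      fix j' assume j': "j' \<in> insert j J"
      show "(\<Sum>i\<in>I. a i j' * c' i) = 0"
      proof (cases "j' = j")
        case True
        then show ?thesis using i0 by (simp add: sum)
      next
        case False
        with j' have "(\<Sum>i\<in>I'. a' i j' * c i) = 0" using c(2) by auto
        moreover have "(\<Sum>i\<in>I'. a' i j' * c i)
            = (\<Sum>i\<in>I'. a i j' * c i) - a i0 j' / a i0 j * (\<Sum>i\<in>I'. a i j * c i)"
          by (simp add: a'_def algebra_simps sum_subtractf sum_distrib_left)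
        ultimately show ?thesis by (simp add: sum)
      qed
    qed
  qed
qed

text \<open>Since q > 1, the series X + X^q has linear coefficient 1 and hence an inverse under
  composition; composing this inverse with \<open>s\<close> gives the root.\<close>

lemma artin_schreier_fps:
  fixes s :: "'k::field fps"
  assumes "2 \<le> q" "fps_nth s 0 = 0"
  shows "\<exists>e. fps_nth e 0 = 0 \<and> e + e ^ q = s"
proof -
  define a :: "'k fps" where "a = fps_X + fps_X ^ q"
  have a: "fps_nth a 0 = 0" "fps_nth a 1 \<noteq> 0"
    using assms(1) by (auto simp: a_def)
  have b: "fps_nth (fps_inv a) 0 = 0"
    by (simp add: fps_inv_def)
  define e where "e = fps_inv a oo s"
  have e: "fps_nth e 0 = 0"
    by (simp add: e_def b)
  have "a oo e = (a oo fps_inv a) oo s"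
    unfolding e_def by (rule fps_compose_assoc[OF assms(2) b])
  also have "\<dots> = s"
    using fps_inv_right[OF a] by (simp add: fps_X_fps_compose_startby0 assms(2))
  finally have "a oo e = s" .
  moreover have "a oo e = e + e ^ q"
    using fps_compose_power[OF e, of fps_X q]
    by (simp add: a_def fps_compose_add_distrib e)
  ultimately show ?thesis using e by auto
qed

lemma ring_homo_fps_const: "ring_homo (fps_const :: 'k::field \<Rightarrow> 'k fps)"
  by unfold_locales simp_all

lemma ring_homo_id: "ring_homo (\<lambda>x. x)"
  by unfold_locales simp_all

lemma homogeneous_monomial: "homogeneous (i + j + k) (var_X ^ i * var_Z ^ j * var_Y ^ k)"
  by (intro homogeneous_mult homogeneous_power1 homogeneous_vars)

locale hermitian =
  fixes q r :: nat and K :: "'k::alg_closed_field itself"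
  assumes prime_char: "prime CHAR('k)"
    and q_def: "q = CHAR('k) ^ r"
    and r_pos: "r > 0"
begin

abbreviation C :: "'k poly3" where "C \<equiv> hermitian_form q"

lemma q_ge_2: "2 \<le> q"
proof -
  have "2 \<le> CHAR('k)"
    using prime_char by (rule prime_ge_2_nat)
  moreover have "CHAR('k) ^ 1 \<le> CHAR('k) ^ r"
    using r_pos \<open>2 \<le> CHAR('k)\<close> by (intro power_increasing) auto
  ultimately show ?thesis by (simp add: q_def)
qed

lemma frob_add: "(x + y) ^ q = x ^ q + (y::'k) ^ q"
  by (rule freshmans_dream'[OF prime_char q_def])

lemma frob_fps: "(x + y) ^ q = x ^ q + (y::'k fps) ^ q"
  by (rule freshmans_dream') (simp_all add: prime_char q_def)

lemma frob_poly3: "(x + y) ^ q = x ^ q + (y::'k poly3) ^ q"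
  by (rule freshmans_dream') (simp_all add: prime_char q_def)

lemma frob_0: "(0::'k) ^ q = 0"
  using q_ge_2 by simp

lemma frob_minus: "(- x) ^ q = - ((x::'k) ^ q)"
  using frob_add[of x "- x"] frob_0 by (simp add: minus_unique)

lemma frob_diff: "(x - y) ^ q = x ^ q - (y::'k) ^ q"
  using frob_add[of x "- y"] frob_minus by simp

lemma ev3_C: "ring_homo h \<Longrightarrow> ev3 h C (x, y, z) = x ^ (q + 1) - y ^ q * z - y * z ^ q"
  by (simp add: hermitian_form_def ev3_simps)

definition as_root :: "'k fps \<Rightarrow> 'k fps" where
  "as_root s = (SOME e. fps_nth e 0 = 0 \<and> e + e ^ q = s)"

lemma as_root:
  assumes "fps_nth s 0 = 0"
  shows "fps_nth (as_root s) 0 = 0" "as_root s + as_root s ^ q = s"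
  using someI_ex[OF artin_schreier_fps[OF q_ge_2 assms]] by (auto simp: as_root_def)

text \<open>The factor 1 + e^(q-1) of e + e^q is a unit, because \<open>e\<close> has no constant
  term.\<close>

lemma vge_add_power:
  fixes e :: "'k fps"
  assumes "fps_nth e 0 = 0"
  shows "vge (e + e ^ q) n \<longleftrightarrow> vge e n"
proof -
  have "q = Suc (q - 1)" using q_ge_2 by simp
  then have "e ^ q = e * e ^ (q - 1)" by (metis power_Suc)
  then have e: "e + e ^ q = (1 + e ^ (q - 1)) * e" by (simp add: algebra_simps)
  have "fps_nth (1 + e ^ (q - 1)) 0 \<noteq> 0"
    using q_ge_2 assms by (simp add: fps_power_zeroth power_0_left)
  then show ?thesis
    using vge_cancel[of "1 + e ^ (q - 1)" 0 e n] vge_mult_right[of e n "1 + e ^ (q - 1)"]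
    by (auto simp: e)
qed

lemma nth_add_power:
  fixes e :: "'k fps"
  assumes "fps_nth e 0 = 0" "vge e n"
  shows "fps_nth (e + e ^ q) n = fps_nth e n"
proof (cases "n = 0")
  case False
  have "vge (e ^ q) (q * n)"
    using assms(2) by (rule vge_power)
  then have "fps_nth (e ^ q) n = 0"
    using q_ge_2 False by (intro vge_nth) auto
  then show ?thesis by simp
qed (use assms q_ge_2 in \<open>simp add: fps_power_zeroth power_0_left\<close>)

lemma vge_as_root: "fps_nth s 0 = 0 \<Longrightarrow> vge (as_root s) n \<longleftrightarrow> vge s n"
  using vge_add_power[OF as_root(1)] as_root(2) by metis

lemma as_root_nth: "fps_nth s 0 = 0 \<Longrightarrow> vge s n \<Longrightarrow> fps_nth (as_root s) n = fps_nth s n"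
  using nth_add_power[OF as_root(1)] as_root(2) vge_as_root by metis

text \<open>\<open>par T\<close> expands the coordinates at the point \<open>T = (x, y, 1)\<close>, or \<open>T = (0, 1, 0)\<close>,
  in powers of a local parameter.\<close>

definition par :: "'k \<times> 'k \<times> 'k \<Rightarrow> 'k fps \<times> 'k fps \<times> 'k fps" where
  "par T = (case T of (x, y, z) \<Rightarrow>
     if z = 0 then (fps_X, 1, as_root (fps_X ^ (q + 1)))
     else (fps_const x + fps_X,
       fps_const y + as_root (fps_const (x ^ q) * fps_X + fps_const x * fps_X ^ q + fps_X ^ (q + 1)), 1))"

definition phi :: "'k \<times> 'k \<times> 'k \<Rightarrow> 'k poly3 \<Rightarrow> 'k fps" where
  "phi T F = ev3 fps_const F (par T)"

lemma ring_homo_phi: "ring_homo (phi T)"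
  unfolding phi_def[abs_def] by (rule ring_homo.ring_homo_ev3[OF ring_homo_fps_const])

lemmas phi_simps = ring_homo.hom_add[OF ring_homo_phi] ring_homo.hom_mult[OF ring_homo_phi]
  ring_homo.hom_1[OF ring_homo_phi] ring_homo.hom_0[OF ring_homo_phi]
  ring_homo.hom_minus[OF ring_homo_phi] ring_homo.hom_diff[OF ring_homo_phi]
  ring_homo.hom_power[OF ring_homo_phi] ring_homo.hom_sum[OF ring_homo_phi]
  ring_homo.hom_prod[OF ring_homo_phi]

lemma phi_con: "phi T (con c) = fps_const c"
  by (simp add: phi_def ev3_simps[OF ring_homo_fps_const])

section \<open>The expansion at infinity and a normal form modulo the curve\<close>

abbreviation inf :: "'k \<times> 'k \<times> 'k" where "inf \<equiv> (0, 1, 0)"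

text \<open>In the chart Y = 1 the curve reads Z + Z^q = X^(q+1). With X as parameter, Z is
  therefore an Artin-Schreier root, and it vanishes to order q + 1.\<close>

definition zeta :: "'k fps" where "zeta = as_root (fps_X ^ (q + 1))"

lemma zeta: "zeta + zeta ^ q = fps_X ^ (q + 1)" "vge zeta (q + 1)" "fps_nth zeta (q + 1) = 1"
proof -
  let ?s = "fps_X ^ (q + 1) :: 'k fps"
  have nth: "fps_nth ?s i = (if i = q + 1 then 1 else 0)" for i
    by (simp only: fps_X_power_nth)
  have 0: "fps_nth ?s 0 = 0" and ge: "vge ?s (q + 1)"
    unfolding vge_def nth by simp_all
  show "zeta + zeta ^ q = ?s" "vge zeta (q + 1)" "fps_nth zeta (q + 1) = 1"
    using as_root(2)[OF 0] vge_as_root[OF 0] as_root_nth[OF 0 ge] ge nth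
    by (simp_all only: zeta_def simp_thms if_True)
qed

lemma phi_inf_vars: "phi inf var_X = fps_X" "phi inf var_Y = 1" "phi inf var_Z = zeta"
  by (simp_all add: phi_def par_def zeta_def ev3_simps[OF ring_homo_fps_const])

lemma phi_inf_C: "phi inf C = 0"
proof -
  have "phi inf C = fps_X ^ (q + 1) - (zeta + zeta ^ q)"
    by (simp add: phi_def par_def ev3_C[OF ring_homo_fps_const] zeta_def)
  then show ?thesis by (simp only: zeta(1)) simp
qed

text \<open>Exponents of X and Z in the monomials of degree \<open>n\<close> with X-exponent at most
  q. The equation of the curve rewrites X^(q+1), so these monomials span the forms modulo
  \<open>C\<close>; by \<open>red_eq_0\<close> they are independent.\<close>

definition idx :: "nat \<Rightarrow> (nat \<times> nat) set" where
  "idx n = {(i, j). i \<le> q \<and> i + j \<le> n}"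

definition mon :: "nat \<Rightarrow> nat \<times> nat \<Rightarrow> 'k poly3" where
  "mon n ij = var_X ^ fst ij * var_Z ^ snd ij * var_Y ^ (n - fst ij - snd ij)"

definition red :: "nat \<Rightarrow> (nat \<times> nat \<Rightarrow> 'k) \<Rightarrow> 'k poly3" where
  "red n c = (\<Sum>ij\<in>idx n. con (c ij) * mon n ij)"

lemma finite_idx: "finite (idx n)"
  by (rule finite_subset[of _ "{..q} \<times> {..n}"]) (auto simp: idx_def)

lemma homogeneous_mon: "ij \<in> idx n \<Longrightarrow> homogeneous n (mon n ij)"
  using homogeneous_monomial[of "fst ij" "snd ij" "n - fst ij - snd ij", where 'a = 'k]
  by (auto simp: mon_def idx_def)

lemma homogeneous_red: "homogeneous n (red n c)"
  unfolding red_def by (intro homogeneous_sum homogeneous_con_mult homogeneous_mon)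

definition reducible_to :: "nat \<Rightarrow> 'k poly3 \<Rightarrow> bool" where
  "reducible_to n F \<longleftrightarrow> (\<exists>c E. F = red n c + C * E)"

lemma reducible_to_0: "reducible_to n 0"
  unfolding reducible_to_def by (rule exI[of _ "\<lambda>_. 0"], rule exI[of _ 0]) (simp add: red_def con_simps)

lemma reducible_to_add:
  assumes "reducible_to n F" "reducible_to n G"
  shows "reducible_to n (F + G)"
proof -
  obtain c E c' E' where "F = red n c + C * E" "G = red n c' + C * E'"
    using assms by (auto simp: reducible_to_def)
  then have "F + G = red n (\<lambda>ij. c ij + c' ij) + C * (E + E')"
    by (simp add: red_def con_simps sum.distrib algebra_simps)
  then show ?thesis unfolding reducible_to_def by blast
qed

lemma reducible_to_con_mult:
  assumes "reducible_to n F"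
  shows "reducible_to n (con a * F)"
proof -
  obtain c E where "F = red n c + C * E"
    using assms by (auto simp: reducible_to_def)
  then have "con a * F = red n (\<lambda>ij. a * c ij) + C * (con a * E)"
    by (simp add: red_def con_simps sum_distrib_left algebra_simps)
  then show ?thesis unfolding reducible_to_def by blast
qed

lemma reducible_to_C: "reducible_to n (C * E)"
  unfolding reducible_to_def by (rule exI[of _ "\<lambda>_. 0"], rule exI[of _ E]) (simp add: red_def con_simps)

lemma reducible_to_sum: "(\<And>i. i \<in> A \<Longrightarrow> reducible_to n (F i)) \<Longrightarrow> reducible_to n (sum F A)"
  by (induction A rule: infinite_finite_induct) (simp_all add: reducible_to_0 reducible_to_add)

lemma reducible_to_monomial:
  assumes "i \<le> q" "i + j + k = n"
  shows "reducible_to n (var_X ^ i * var_Z ^ j * var_Y ^ k)"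
proof -
  have "red n (\<lambda>ij. if ij = (i, j) then 1 else 0) = (\<Sum>ij\<in>idx n. if ij = (i, j) then mon n ij else 0)"
    unfolding red_def by (rule sum.cong) (simp_all add: con_simps)
  also have "\<dots> = mon n (i, j)"
    using assms finite_idx by (simp add: idx_def)
  also have "\<dots> = var_X ^ i * var_Z ^ j * var_Y ^ k"
    using assms by (auto simp: mon_def)
  finally have "var_X ^ i * var_Z ^ j * var_Y ^ k
      = red n (\<lambda>ij. if ij = (i, j) then 1 else 0) + C * 0" by simp
  then show ?thesis unfolding reducible_to_def by blast
qed

lemma reducible_to_var_mult_mon:
  assumes "ij \<in> idx n"
  shows "reducible_to (Suc n) (var_X * mon n ij)" "reducible_to (Suc n) (var_Y * mon n ij)"
    "reducible_to (Suc n) (var_Z * mon n ij)"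
proof -
  obtain i j where ij: "ij = (i, j)" "i \<le> q" "i + j \<le> n"
    using assms by (auto simp: idx_def)
  let ?k = "n - i - j"
  have Y: "var_Y * mon n ij = var_X ^ i * var_Z ^ j * var_Y ^ Suc ?k"
    and Z: "var_Z * mon n ij = var_X ^ i * var_Z ^ Suc j * var_Y ^ ?k"
    by (simp_all add: mon_def ij algebra_simps)
  show "reducible_to (Suc n) (var_Y * mon n ij)" "reducible_to (Suc n) (var_Z * mon n ij)"
    unfolding Y Z by (intro reducible_to_monomial; use ij in auto)+
  show "reducible_to (Suc n) (var_X * mon n ij)"
  proof (cases "i < q")
    case True
    have "var_X * mon n ij = var_X ^ Suc i * var_Z ^ j * var_Y ^ ?k"
      by (simp add: mon_def ij mult.assoc)
    then show ?thesis
      using reducible_to_monomial[of "Suc i" j ?k "Suc n"] True ij by (simp del: power_Suc)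
  next
    case False
    then have i: "i = q" using ij by simp
    \<comment> \<open>The only product that leaves the normal form: X^(q+1) is traded for Y^q Z + Y
      Z^q.\<close>
    have "var_X * mon n ij = C * (var_Z ^ j * var_Y ^ ?k)
        + (var_X ^ 0 * var_Z ^ Suc j * var_Y ^ (q + ?k) + var_X ^ 0 * var_Z ^ (q + j) * var_Y ^ Suc ?k)"
      by (simp add: mon_def ij i hermitian_form_def algebra_simps power_add)
    then show ?thesis
      using reducible_to_monomial[of 0 "Suc j" "q + ?k" "Suc n"]
        reducible_to_monomial[of 0 "q + j" "Suc ?k" "Suc n"] ij i
      by (simp only:) (intro reducible_to_add reducible_to_C; auto)
  qed
qed

lemma reducible_to_var_mult:
  assumes "reducible_to n F"
  shows "reducible_to (Suc n) (var_X * F)" "reducible_to (Suc n) (var_Y * F)"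
    "reducible_to (Suc n) (var_Z * F)"
proof -
  obtain c E where F: "F = red n c + C * E"
    using assms by (auto simp: reducible_to_def)
  have V: "V * F = (\<Sum>ij\<in>idx n. con (c ij) * (V * mon n ij)) + C * (V * E)" for V
    by (simp add: F red_def sum_distrib_left algebra_simps)
  show "reducible_to (Suc n) (var_X * F)" "reducible_to (Suc n) (var_Y * F)"
    "reducible_to (Suc n) (var_Z * F)"
    unfolding V
    by (intro reducible_to_add reducible_to_sum reducible_to_C reducible_to_con_mult
        reducible_to_var_mult_mon; assumption)+
qed

lemma homogeneous_reducible_to:
  assumes "homogeneous n F"
  shows "reducible_to n F"
  using assms
proof (induction rule: homogeneous_induct)
  case (con c)
  show ?case
    using reducible_to_con_mult[OF reducible_to_monomial[of 0 0 0 0], of c] by simp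
next
  case (step d F1 F2 F3)
  then show ?case by (intro reducible_to_add reducible_to_var_mult)
qed

lemma phi_inf_mon:
  "phi inf (con a * mon n (i, j)) = fps_const a * (fps_X ^ i * zeta ^ j)"
  by (simp add: mon_def phi_simps phi_con phi_inf_vars)

text \<open>The order at infinity of the monomial with these exponents. As the X-exponent is at most
  q, the exponents are the digits of this number in base q + 1, so different monomials have
  different orders.\<close>

definition pos :: "nat \<times> nat \<Rightarrow> nat" where
  "pos ij = fst ij + snd ij * (q + 1)"

lemma pos_inj:
  assumes "ij \<in> idx n" "kl \<in> idx n" "pos ij = pos kl"
  shows "ij = kl"
proof -
  have *: "pos (a, b) mod (q + 1) = a" "pos (a, b) div (q + 1) = b" if "a \<le> q" for a b
    unfolding pos_def fst_conv snd_conv using that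
    by (simp_all only: mod_mult_self1 div_mult_self1) simp_all
  show ?thesis
    using assms * by (cases ij, cases kl) (metis (no_types, lifting) case_prodD idx_def mem_Collect_eq)
qed

lemma vex_monomial: "vex (fps_X ^ i * zeta ^ j) (pos (i, j))"
proof -
  have "vex (fps_X :: 'k fps) 1"
    by (simp add: vex_def vge_def)
  from vex_power[OF this, of i] have "vex (fps_X ^ i :: 'k fps) i" by simp
  moreover have "vex zeta (q + 1)"
    using zeta by (simp add: vex_def)
  from vex_power[OF this, of j] have "vex (zeta ^ j) (j * (q + 1))" .
  ultimately show ?thesis
    using vex_mult by (simp add: pos_def)
qed

lemma nth_monomial: "fps_nth (fps_X ^ i * zeta ^ j) (pos (i, j)) = 1"
proof -
  have "fps_nth (zeta ^ j) (j * (q + 1)) = 1"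
    using vge_nth_power[OF zeta(2), of j] zeta(3) by simp
  then show ?thesis
    by (simp add: fps_X_power_mult_nth pos_def)
qed

text \<open>The term of smallest order cannot cancel, since the orders are distinct. Hence finitely
  many coefficients of the expansion, those at the orders \<open>pos\<close>, already detect a
  reduced form.\<close>

lemma red_eq_0:
  assumes "\<And>ij. ij \<in> idx n \<Longrightarrow> fps_nth (phi inf (red n c)) (pos ij) = 0" "kl \<in> idx n"
  shows "c kl = 0"
proof (rule ccontr)
  assume "c kl \<noteq> 0"
  define S where "S = {ij \<in> idx n. c ij \<noteq> 0}"
  have "kl \<in> S"
    using assms(2) \<open>c kl \<noteq> 0\<close> by (simp add: S_def)
  then have S: "finite S" "S \<noteq> {}"
    using finite_idx by (simp add: S_def, blast)
  obtain m where m: "m \<in> S" "\<And>ij. ij \<in> S \<Longrightarrow> pos m \<le> pos ij"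
    using arg_min_if_finite[OF S, of pos] by (metis not_le)
  have "fps_nth (phi inf (con (c ij) * mon n ij)) (pos m) = (if ij = m then c m else 0)"
    if ij: "ij \<in> idx n" for ij
  proof (cases "ij = m")
    case True
    then show ?thesis
      by (cases m) (simp add: phi_inf_mon nth_monomial)
  next
    case False
    show ?thesis
    proof (cases "c ij = 0")
      case True
      then show ?thesis using False by (simp add: con_simps phi_simps)
    next
      case c: False
      obtain i j where ij': "ij = (i, j)" by (cases ij)
      have "pos m \<le> pos ij"
        using m(2)[of ij] c ij by (simp add: S_def)
      moreover have "pos m \<noteq> pos ij"
        using m(1) ij False pos_inj[of m n ij] by (simp add: S_def) blast
      ultimately have "fps_nth (fps_X ^ i * zeta ^ j) (pos m) = 0"
        using vex_monomial[of i j] by (simp add: vex_def vge_def ij')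
      then show ?thesis using False by (simp add: ij' phi_inf_mon)
    qed
  qed
  then have "fps_nth (phi inf (red n c)) (pos m) = (\<Sum>ij\<in>idx n. if ij = m then c m else 0)"
    by (simp add: red_def phi_simps fps_sum_nth)
  also have "\<dots> = c m"
    using m finite_idx by (simp add: S_def)
  finally show False
    using assms(1)[of m] m by (auto simp: S_def)
qed

lemma phi_inf_dvd: "C dvd F \<Longrightarrow> phi inf F = 0"
  by (auto simp: phi_simps phi_inf_C elim!: dvdE)

lemma dvd_if_nth_pos:
  assumes "homogeneous n F" "\<And>ij. ij \<in> idx n \<Longrightarrow> fps_nth (phi inf F) (pos ij) = 0"
  shows "C dvd F"
proof -
  obtain c E where F: "F = red n c + C * E"
    using homogeneous_reducible_to[OF assms(1)] by (auto simp: reducible_to_def)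
  then have "phi inf F = phi inf (red n c)"
    by (simp add: phi_simps phi_inf_C)
  then have "c ij = 0" if "ij \<in> idx n" for ij
    using red_eq_0[of n c] assms(2) that by simp
  then have "red n c = 0"
    by (simp add: red_def con_simps)
  with F show ?thesis by simp
qed

lemma dvd_iff_phi_inf: "homogeneous n F \<Longrightarrow> C dvd F \<longleftrightarrow> phi inf F = 0"
  using dvd_if_nth_pos phi_inf_dvd by fastforce

text \<open>Forms modulo \<open>C\<close> embed into the integral domain of power series through the
  expansion at infinity.\<close>

lemma C_dvd_mult:
  assumes "homogeneous m F" "homogeneous n G" "C dvd F * G"
  shows "C dvd F \<or> C dvd G"
proof -
  have "phi inf F * phi inf G = 0"
    using phi_inf_dvd[OF assms(3)] by (simp add: phi_simps)
  then show ?thesis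
    using assms dvd_iff_phi_inf by auto
qed

lemma red_dvd_0: "C dvd red n c \<Longrightarrow> ij \<in> idx n \<Longrightarrow> c ij = 0"
  using red_eq_0[of n c ij] phi_inf_dvd[of "red n c"] by simp

text \<open>Doubled to avoid a division, this is the Hilbert function n(q+1) + 1 - g with g =
  q(q-1)/2.\<close>

lemma card_idx:
  assumes "q \<le> n"
  shows "2 * card (idx n) + (q + 1) * q = (q + 1) * (2 * n + 2)"
proof -
  have "idx n = (SIGMA i:{..q}. {..n - i})"
    using assms by (auto simp: idx_def)
  then have "card (idx n) = (\<Sum>i\<le>q. Suc (n - i))"
    by simp
  moreover have "2 * (\<Sum>i\<le>p. Suc (n - i)) + (p + 1) * p = (p + 1) * (2 * n + 2)" if "p \<le> n" for p
    using that
  proof (induction p)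
    case (Suc p)
    then have "2 * (\<Sum>i\<le>p. Suc (n - i)) + (p + 1) * p = (p + 1) * (2 * n + 2)" by simp
    moreover have "n - Suc p + Suc p = n" using Suc.prems by simp
    ultimately show ?case by (simp add: algebra_simps)
  qed simp
  ultimately show ?thesis using assms by simp
qed

text \<open>The binary form \<open>Z\<^sup>n p(Y/Z)\<close>.\<close>

definition hom :: "nat \<Rightarrow> 'k poly \<Rightarrow> 'k poly3" where
  "hom n p = (\<Sum>k\<le>n. con (coeff p k) * (var_Y ^ k * var_Z ^ (n - k)))"

lemma homogeneous_YZ: "k \<le> n \<Longrightarrow> homogeneous n (var_Y ^ k * var_Z ^ (n - k))"
  using homogeneous_mult[OF homogeneous_power1[OF homogeneous_vars(2)]
      homogeneous_power1[OF homogeneous_vars(3)], of k "n - k"]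
  by simp

lemma homogeneous_hom: "homogeneous n (hom n p)"
  unfolding hom_def by (intro homogeneous_sum homogeneous_con_mult homogeneous_YZ) auto

text \<open>A nonzero multiple of \<open>G\<close> in \<open>k[Y, Z]\<close> exists because modulo \<open>C\<close> the multiples of \<open>G\<close>
  have bounded codimension in each degree.\<close>

lemma norm_exists:
  assumes G: "homogeneous d G" "\<not> C dvd G"
  obtains G' e p where "homogeneous e G'" "p \<noteq> 0" "degree p \<le> d + e" "C dvd G * G' - hom (d + e) p"
proof -
  \<comment> \<open>By \<open>card_idx\<close>, which needs q <= e, the multiples of
    \<open>G\<close> have codimension d(q+1) in degree n = d + e. The choice of \<open>e\<close>
    gives n + 1 = d(q+1) + q + 1 binary monomials, more than that codimension.\<close>
  define e where "e = d * q + q"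
  define n where "n = d + e"
  \<comment> \<open>Unknowns: \<open>Inl\<close> stands for the coefficients of the cofactor of
    \<open>G\<close>, \<open>Inr\<close> for those of \<open>p\<close>. The equations in
    \<open>J\<close> make the expansion of the difference vanish at the orders of the reduced
    monomials.\<close>
  define I where "I = idx e <+> {..n}"
  define J where "J = pos ` idx n"
  define B where "B i = (case i of Inl ij \<Rightarrow> G * mon e ij | Inr k \<Rightarrow> - (var_Y ^ k * var_Z ^ (n - k)))" for i
  have "card J \<le> card (idx n)"
    unfolding J_def by (rule card_image_le[OF finite_idx])
  moreover have "card (idx n) < card (idx e) + Suc n"
    using card_idx[of n] card_idx[of e] by (simp add: n_def e_def algebra_simps)
  ultimately have "card J < card I"
    by (simp add: I_def card_Plus finite_idx)
  moreover have "finite J" "finite I"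
    by (simp_all add: J_def I_def finite_idx)
  ultimately obtain c where c: "\<exists>i\<in>I. c i \<noteq> 0"
      "\<forall>j\<in>J. (\<Sum>i\<in>I. fps_nth (phi inf (B i)) j * c i) = 0"
    using underdetermined_system[of J I "\<lambda>i j. fps_nth (phi inf (B i)) j"] by blast
  define p where "p = (\<Sum>k\<le>n. monom (c (Inr k)) k)"
  have p: "coeff p k = (if k \<le> n then c (Inr k) else 0)" for k
    by (simp add: p_def coeff_sum)
  define c' where "c' ij = c (Inl ij)" for ij
  have sumB: "(\<Sum>i\<in>I. con (c i) * B i) = G * red e c' - hom n p"
  proof -
    have "(\<Sum>i\<in>I. con (c i) * B i)
        = (\<Sum>ij\<in>idx e. con (c (Inl ij)) * B (Inl ij)) + (\<Sum>k\<le>n. con (c (Inr k)) * B (Inr k))"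
      unfolding I_def by (simp add: sum.Plus finite_idx)
    moreover have "(\<Sum>ij\<in>idx e. con (c (Inl ij)) * B (Inl ij)) = G * red e c'"
      by (simp add: B_def red_def c'_def sum_distrib_left algebra_simps)
    moreover have "(\<Sum>k\<le>n. con (c (Inr k)) * B (Inr k)) = - hom n p"
      by (simp add: hom_def B_def p sum_negf)
    ultimately show ?thesis by simp
  qed
  have hG: "homogeneous n (G * red e c')"
    unfolding n_def by (intro homogeneous_mult G homogeneous_red)
  then have h: "homogeneous n (G * red e c' - hom n p)"
    by (intro homogeneous_diff homogeneous_hom)
  have dvd: "C dvd G * red e c' - hom n p"
  proof (rule dvd_if_nth_pos[OF h])
    fix ij assume "ij \<in> idx n"
    then have "pos ij \<in> J" by (simp add: J_def)
    then show "fps_nth (phi inf (G * red e c' - hom n p)) (pos ij) = 0"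
      using c(2) unfolding sumB[symmetric]
      by (simp add: phi_simps phi_con fps_sum_nth mult.commute)
  qed
  have "p \<noteq> 0"
  proof
    assume p0: "p = 0"
    then have "hom n p = 0" by (simp add: hom_def con_simps)
    with dvd have "C dvd G * red e c'" by simp
    then have "C dvd red e c'"
      using C_dvd_mult[OF G(1) homogeneous_red] G(2) by blast
    then have "c' ij = 0" if "ij \<in> idx e" for ij
      using red_dvd_0 that by blast
    moreover have "c (Inr k) = 0" if "k \<le> n" for k
      using p[of k] that p0 by simp
    ultimately show False
      using c(1) by (auto simp: I_def c'_def)
  qed
  moreover have "degree p \<le> d + e"
    by (rule degree_le) (simp add: p n_def)
  ultimately show thesis
    using that[of e "red e c'" p] homogeneous_red dvd by (simp add: n_def)
qed

end

section \<open>Local parameters\<close>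

lemma ring_homo_ev3_compose:
  assumes "ring_homo h" "ring_homo g"
  shows "g (ev3 h F (x, y, z)) = ev3 (\<lambda>c. g (h c)) F (g x, g y, g z)"
proof -
  interpret h: ring_homo h by fact
  interpret g: ring_homo g by fact
  interpret gh: ring_homo "\<lambda>c. g (h c)"
    by unfold_locales (simp_all add: h.hom_add g.hom_add h.hom_mult g.hom_mult h.hom_1 g.hom_1)
  have *: "g (evp k p w) = evp (\<lambda>c. g (k c)) p (g w)"
    if "ring_homo k" for k :: "'x::comm_ring_1 \<Rightarrow> 'b" and p w
  proof -
    interpret k: ring_homo k by fact
    interpret gk: ring_homo "\<lambda>c. g (k c)"
      by unfold_locales (simp_all add: k.hom_add g.hom_add k.hom_mult g.hom_mult k.hom_1 g.hom_1)
    show ?thesis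
      by (induction p) (simp_all add: k.evp_0 gk.evp_0 g.hom_0 k.evp_pCons gk.evp_pCons g.hom_add g.hom_mult)
  qed
  have e: "ring_homo (\<lambda>e. evp h e z)" by (rule h.ring_homo_evp)
  have f: "ring_homo (\<lambda>c. evp (\<lambda>e. evp h e z) c y)"
    by (rule ring_homo.ring_homo_evp[OF e])
  show ?thesis
    by (simp add: ev3_def *[OF f] *[OF e] *[OF h.ring_homo_axioms])
qed

definition basis3 :: "'a::field poly3 \<Rightarrow> 'a poly3 \<Rightarrow> 'a poly3 \<Rightarrow> bool" where
  "basis3 u v w \<longleftrightarrow> homogeneous 1 u \<and> homogeneous 1 v \<and> homogeneous 1 w \<and>
     (\<forall>V\<in>{var_X, var_Y, var_Z}. \<exists>a b c. V = con a * u + con b * v + con c * w)"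

lemma basis3_decompose:
  fixes F :: "'a::field poly3"
  assumes "basis3 u v w" "homogeneous (Suc d) F"
  obtains F1 F2 F3 where "homogeneous d F1" "homogeneous d F2" "homogeneous d F3"
    "F = u * F1 + v * F2 + w * F3"
proof -
  obtain A1 A2 A3 where A: "homogeneous d A1" "homogeneous d A2" "homogeneous d A3"
      "F = var_X * A1 + var_Y * A2 + var_Z * A3"
    using homogeneous_Suc_decompose[OF assms(2)] by blast
  obtain a1 b1 c1 a2 b2 c2 a3 b3 c3 where V:
      "var_X = con a1 * u + con b1 * v + con c1 * w"
      "var_Y = con a2 * u + con b2 * v + con c2 * w"
      "var_Z = con a3 * u + con b3 * v + con c3 * w"
    using assms(1) unfolding basis3_def by (metis insertCI)
  show thesis
  proof
    show "homogeneous d (con a1 * A1 + con a2 * A2 + con a3 * A3)"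
      "homogeneous d (con b1 * A1 + con b2 * A2 + con b3 * A3)"
      "homogeneous d (con c1 * A1 + con c2 * A2 + con c3 * A3)"
      by (intro homogeneous_add homogeneous_con_mult A)+
    show "F = u * (con a1 * A1 + con a2 * A2 + con a3 * A3)
        + v * (con b1 * A1 + con b2 * A2 + con b3 * A3)
        + w * (con c1 * A1 + con c2 * A2 + con c3 * A3)"
      unfolding A(4) V by (simp add: algebra_simps)
  qed
qed

lemma basis3_mod_two:
  fixes F :: "'a::field poly3"
  assumes "basis3 u v w" "homogeneous (Suc d) F"
  obtains A B c where "homogeneous d A" "homogeneous d B" "F = u * A + v * B + con c * w ^ Suc d"
  using assms(2)
proof (induction d arbitrary: F thesis)
  case 0
  obtain F1 F2 F3 where F: "homogeneous 0 F1" "homogeneous 0 F2" "homogeneous 0 F3"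
      "F = u * F1 + v * F2 + w * F3"
    using basis3_decompose[OF assms(1) 0(2)] by blast
  then show ?case using 0(1)[of F1 F2] homogeneous_0_con[OF F(3)] by (metis mult.commute power_Suc0_right)
next
  case (Suc d)
  obtain F1 F2 F3 where F: "homogeneous (Suc d) F1" "homogeneous (Suc d) F2" "homogeneous (Suc d) F3"
      "F = u * F1 + v * F2 + w * F3"
    using basis3_decompose[OF assms(1) Suc(3)] by blast
  obtain A B c where A: "homogeneous d A" "homogeneous d B" "F3 = u * A + v * B + con c * w ^ Suc d"
    using Suc.IH[OF _ F(3)] by blast
  have w: "homogeneous 1 w" using assms(1) by (simp add: basis3_def)
  show ?case
  proof (rule Suc.prems(1))
    show "homogeneous (Suc d) (F1 + w * A)" "homogeneous (Suc d) (F2 + w * B)"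
      using homogeneous_mult[OF w A(1)] homogeneous_mult[OF w A(2)] F by (auto intro: homogeneous_add)
    show "F = u * (F1 + w * A) + v * (F2 + w * B) + con c * w ^ Suc (Suc d)"
      unfolding F(4) A(3) by (simp add: algebra_simps)
  qed
qed

lemma dvd_diff_chain:
  fixes C :: "'r::comm_ring_1"
  assumes "C dvd A - L * B" "C dvd B - M * D"
  shows "C dvd A - L * (M * D)"
proof -
  have "A - L * (M * D) = (A - L * B) + L * (B - M * D)" by (simp add: algebra_simps)
  then show ?thesis using dvd_add[OF assms(1) dvd_mult[OF assms(2)]] by metis
qed

context hermitian
begin

definition pts :: "('k \<times> 'k \<times> 'k) set" where
  "pts = {T. T = inf \<or> (\<exists>x y. T = (x, y, 1) \<and> x ^ (q + 1) = y ^ q + y)}"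

definition evk :: "'k poly3 \<Rightarrow> 'k \<times> 'k \<times> 'k \<Rightarrow> 'k" where
  "evk F T = ev3 (\<lambda>x. x) F T"

lemma evk_simps:
  "evk (F + G) T = evk F T + evk G T" "evk (F * G) T = evk F T * evk G T"
  "evk 1 T = 1" "evk 0 T = 0" "evk (- F) T = - evk F T" "evk (F - G) T = evk F T - evk G T"
  "evk (F ^ n) T = evk F T ^ n" "evk (con c) T = c"
  "evk var_X (x, y, z) = x" "evk var_Y (x, y, z) = y" "evk var_Z (x, y, z) = z"
  by (simp_all add: evk_def ev3_simps[OF ring_homo_id])

text \<open>The increment of Y when X moves from x to x + t on the curve: cancelling x^(q+1) = y^q +
  y from (x+t)^(q+1) = (y+eta)^q + (y+eta) leaves an equation that no longer contains y.\<close>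

definition eta :: "'k \<Rightarrow> 'k fps" where
  "eta x = as_root (fps_const (x ^ q) * fps_X + fps_const x * fps_X ^ q + fps_X ^ (q + 1))"

lemma phi_affine_vars: "phi (x, y, 1) var_X = fps_const x + fps_X"
  "phi (x, y, 1) var_Y = fps_const y + eta x" "phi (x, y, 1) var_Z = 1"
  by (simp_all add: phi_def par_def eta_def ev3_simps[OF ring_homo_fps_const])

lemma eta_poly_nth_0:
  "fps_nth (fps_const (x ^ q) * fps_X + fps_const x * fps_X ^ q + fps_X ^ (q + 1)) 0 = (0::'k)"
  using q_ge_2 by (simp add: fps_X_power_nth)

lemma eta: "fps_nth (eta x) 0 = 0"
  "eta x + eta x ^ q = fps_const (x ^ q) * fps_X + fps_const x * fps_X ^ q + fps_X ^ (q + 1)"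
  using as_root[OF eta_poly_nth_0[of x]] by (simp_all only: eta_def)

lemma eta_power_expand:
  "(fps_const x + fps_X) ^ (q + 1) = fps_const (x ^ (q + 1)) + (eta x + eta x ^ q)"
  unfolding eta(2) by (simp add: frob_fps algebra_simps fps_const_power flip: fps_const_mult)

lemma vge_eta: "vge (eta x) n \<longleftrightarrow> vge ((fps_const x + fps_X) ^ (q + 1) - fps_const (x ^ (q + 1))) n"
  unfolding eta_power_expand add_diff_cancel_left' by (rule vge_add_power[OF eta(1), symmetric])

lemma eta_nonzero: "eta x \<noteq> 0"
proof
  assume "eta x = 0"
  then have "fps_nth (eta x + eta x ^ q) (q + 1) = 0"
    using q_ge_2 by (simp add: power_0_left)
  then show False unfolding eta(2) using q_ge_2 by (simp add: fps_X_power_nth del: power_Suc)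
qed

lemma phi_pts_C: 
  assumes "T \<in> pts"
  shows "phi T C = 0"
proof (cases "T = inf")
  case True
  then show ?thesis using phi_inf_C by simp
next
  case False
  then obtain x y where T: "T = (x, y, 1)" "x ^ (q + 1) = y ^ q + y"
    using assms by (auto simp: pts_def)
  have "phi T C = (fps_const x + fps_X) ^ (q + 1) - (fps_const y + eta x) ^ q - (fps_const y + eta x)"
    unfolding T phi_def par_def by (simp add: ev3_C[OF ring_homo_fps_const] eta_def)
  also have "\<dots> = 0"
    unfolding eta_power_expand T(2) frob_fps by (simp add: fps_const_power flip: fps_const_add)
  finally show ?thesis .
qed

lemma phi_dvd: "T \<in> pts \<Longrightarrow> C dvd F \<Longrightarrow> phi T F = 0"
  by (auto simp: phi_simps phi_pts_C elim!: dvdE)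

lemma phi_dvd_diff: "T \<in> pts \<Longrightarrow> C dvd F - G \<Longrightarrow> phi T F = phi T G"
  using phi_dvd[of T "F - G"] by (simp add: phi_simps)

lemma phi_nth_0:
  assumes "T \<in> pts"
  shows "fps_nth (phi T F) 0 = evk F T"
proof -
  interpret g: ring_homo "\<lambda>f::'k fps. fps_nth f 0"
    by unfold_locales auto
  obtain x y z where p: "par T = (x, y, z)" by (cases "par T")
  have "fps_nth (phi T F) 0 = ev3 (\<lambda>c. c) F (fps_nth x 0, fps_nth y 0, fps_nth z 0)"
    unfolding phi_def p ring_homo_ev3_compose[OF ring_homo_fps_const g.ring_homo_axioms] by simp
  moreover have "(fps_nth x 0, fps_nth y 0, fps_nth z 0) = T"
    using assms p as_root(1)[of "fps_X ^ (q + 1)"] eta(1)[unfolded eta_def]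
    by (auto simp: par_def pts_def)
  ultimately show ?thesis by (simp add: evk_def)
qed

lemma basis_affine: "basis3 (var_X - con x * var_Z) (var_Y - con y * var_Z) (var_Z :: 'k poly3)"
proof -
  have "homogeneous 1 (var_X - con x * var_Z)" "homogeneous 1 (var_Y - con y * var_Z)"
    by (intro homogeneous_diff homogeneous_con_mult homogeneous_vars)+
  moreover have "var_X = con 1 * (var_X - con x * var_Z) + con 0 * (var_Y - con y * var_Z) + con x * var_Z"
    "var_Y = con 0 * (var_X - con x * var_Z) + con 1 * (var_Y - con y * var_Z) + con y * var_Z"
    "var_Z = con 0 * (var_X - con x * var_Z) + con 0 * (var_Y - con y * var_Z) + con 1 * var_Z"
    by (simp_all add: con_simps)
  ultimately show ?thesis
    unfolding basis3_def using homogeneous_vars by blast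
qed

lemma basis_inf: "basis3 var_X var_Z (var_Y :: 'k poly3)"
proof -
  have "var_X = con 1 * var_X + con 0 * var_Z + con 0 * (var_Y :: 'k poly3)"
    "var_Y = con 0 * var_X + con 0 * var_Z + con 1 * (var_Y :: 'k poly3)"
    "var_Z = con 0 * var_X + con 1 * var_Z + con 0 * (var_Y :: 'k poly3)"
    by (simp_all add: con_simps)
  then show ?thesis
    unfolding basis3_def using homogeneous_vars by blast
qed

text \<open>In coordinates centred at a point of the curve the constant term drops out. The equation
  then splits into a multiple of Y' by a form that is nonzero at the point, and a multiple of
  X'.\<close>

lemma C_affine:
  fixes x y :: 'k
  assumes "x ^ (q + 1) = y ^ q + y"
  defines "X' \<equiv> var_X - con x * var_Z" and "Y' \<equiv> var_Y - con y * var_Z"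
  shows "(Y' ^ (q - 1) * var_Z + var_Z ^ q) * Y'
    - X' * (X' ^ q + con x * (X' ^ (q - 1) * var_Z) + con (x ^ q) * var_Z ^ q) = - C"
proof -
  have q1: "q = Suc (q - 1)" using q_ge_2 by simp
  have e: "a * a ^ (q - 1) = a ^ q" for a :: "'k poly3"
    by (subst (2) q1) simp
  have X: "var_X = X' + con x * var_Z" and Y: "var_Y = Y' + con y * var_Z"
    by (simp_all add: X'_def Y'_def)
  have "C = (X' ^ q + con (x ^ q) * var_Z ^ q) * (X' + con x * var_Z)
      - (Y' ^ q + con (y ^ q) * var_Z ^ q) * var_Z - (Y' + con y * var_Z) * var_Z ^ q"
    unfolding hermitian_form_def
    by (subst X, subst (1 2) Y) (simp add: frob_poly3 power_mult_distrib con_simps power_add mult.commute)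
  also have "\<dots> = X' * (X' ^ q + con x * (X' ^ (q - 1) * var_Z) + con (x ^ q) * var_Z ^ q)
      - (Y' ^ (q - 1) * var_Z + var_Z ^ q) * Y'
      + (con (x ^ (q + 1)) - con (y ^ q) - con y) * (var_Z * var_Z ^ q)"
    unfolding e[of X', symmetric] e[of Y', symmetric] by (simp add: con_simps algebra_simps)
  also have "con (x ^ (q + 1)) - con (y ^ q) - con y = 0"
    unfolding assms(1) by (simp add: con_simps)
  finally show ?thesis by (simp add: algebra_simps)
qed

text \<open>The maximal ideal at \<open>T\<close> is generated by \<open>xi\<close> up to multiplication by \<open>U\<close>.\<close>

definition local_data :: "'k \<times> 'k \<times> 'k \<Rightarrow> 'k poly3 \<Rightarrow> 'k poly3 \<Rightarrow> bool" where
  "local_data T xi U \<longleftrightarrow> homogeneous 1 xi \<and> homogeneous q U \<and> evk U T \<noteq> 0 \<and> evk xi T = 0 \<and>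
     vex (phi T xi) 1 \<and>
     (\<forall>d F. homogeneous (Suc d) F \<longrightarrow> evk F T = 0 \<longrightarrow>
        (\<exists>F'. homogeneous (d + q) F' \<and> C dvd U * F - xi * F'))"

text \<open>A form vanishing at the common zero of \<open>xi\<close> and \<open>et\<close> lies in
  the ideal they generate, by \<open>basis3_mod_two\<close>; after multiplication by
  \<open>U\<close>, the generator \<open>et\<close> is exchanged for \<open>xi\<close> modulo
  \<open>C\<close>.\<close>

lemma local_dataI:
  assumes B: "basis3 xi et om" and "homogeneous q U" "homogeneous q V"
    and "evk xi T = 0" "evk et T = 0" "evk om T \<noteq> 0" "evk U T \<noteq> 0" "vex (phi T xi) 1"
    and dvd: "C dvd U * et - xi * V"
  shows "local_data T xi U"
  unfolding local_data_def
proof (intro conjI allI impI)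
  fix d F assume F: "homogeneous (Suc d) F" "evk F T = 0"
  obtain A B' c where A: "homogeneous d A" "homogeneous d B'" "F = xi * A + et * B' + con c * om ^ Suc d"
    using basis3_mod_two[OF B F(1)] by blast
  have "c * evk om T ^ Suc d = 0"
    using F(2) assms(4,5) unfolding A(3) by (simp add: evk_simps)
  then have c: "c = 0" using assms(6) by simp
  have "U * F - xi * (A * U + B' * V) = B' * (U * et - xi * V)"
    unfolding A(3) c by (simp add: con_simps algebra_simps)
  then have "C dvd U * F - xi * (A * U + B' * V)"
    using dvd by simp
  moreover have "homogeneous (d + q) (A * U + B' * V)"
    by (intro homogeneous_add homogeneous_mult A assms)
  ultimately show "\<exists>F'. homogeneous (d + q) F' \<and> C dvd U * F - xi * F'" by blast
qed (use assms in \<open>auto simp: basis3_def\<close>)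

lemma local_data_affine:
  fixes x y :: 'k
  assumes "x ^ (q + 1) = y ^ q + y"
  defines "X' \<equiv> var_X - con x * var_Z" and "Y' \<equiv> var_Y - con y * var_Z"
  shows "local_data (x, y, 1) X' (Y' ^ (q - 1) * var_Z + var_Z ^ q)"
proof (rule local_dataI)
  show "basis3 X' Y' var_Z"
    unfolding X'_def Y'_def by (rule basis_affine)
  then have h: "homogeneous 1 X'" "homogeneous 1 Y'" "homogeneous 1 (var_Z :: 'k poly3)"
    by (simp_all add: basis3_def)
  have q1: "q = q - 1 + 1" using q_ge_2 by simp
  have "homogeneous (q - 1 + 1) (Y' ^ (q - 1) * var_Z)" "homogeneous (q - 1 + 1) (X' ^ (q - 1) * var_Z)"
    by (intro homogeneous_mult homogeneous_power1 h)+
  then have h': "homogeneous q (Y' ^ (q - 1) * var_Z)" "homogeneous q (X' ^ (q - 1) * var_Z)"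
    using q1 by simp_all
  then show "homogeneous q (Y' ^ (q - 1) * var_Z + var_Z ^ q)"
    by (intro homogeneous_add homogeneous_power1 h)
  show "homogeneous q (X' ^ q + con x * (X' ^ (q - 1) * var_Z) + con (x ^ q) * var_Z ^ q)"
    by (intro homogeneous_add homogeneous_con_mult homogeneous_power1 h h')
  show "C dvd (Y' ^ (q - 1) * var_Z + var_Z ^ q) * Y'
      - X' * (X' ^ q + con x * (X' ^ (q - 1) * var_Z) + con (x ^ q) * var_Z ^ q)"
    unfolding X'_def Y'_def C_affine[OF assms(1)] by simp
  show "evk X' (x, y, 1) = 0" "evk Y' (x, y, 1) = 0" "evk var_Z (x, y, 1) \<noteq> 0"
    by (simp_all add: X'_def Y'_def evk_simps)
  then show "evk (Y' ^ (q - 1) * var_Z + var_Z ^ q) (x, y, 1) \<noteq> 0"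
    using q_ge_2 by (simp add: evk_simps power_0_left)
  show "vex (phi (x, y, 1) X') 1"
    by (simp add: X'_def phi_simps phi_affine_vars phi_con vex_def vge_def)
qed

lemma local_data_inf: "local_data inf var_X (var_Y ^ q + var_Y * var_Z ^ (q - 1))"
proof (rule local_dataI)
  show "basis3 var_X var_Z (var_Y :: 'k poly3)" by (rule basis_inf)
  have q1: "q = 1 + (q - 1)" using q_ge_2 by simp
  have "homogeneous (1 + (q - 1)) (var_Y * var_Z ^ (q - 1) :: 'k poly3)"
    by (intro homogeneous_mult homogeneous_power1 homogeneous_vars)
  then show "homogeneous q (var_Y ^ q + var_Y * var_Z ^ (q - 1) :: 'k poly3)"
    using q1 by (intro homogeneous_add homogeneous_power1 homogeneous_vars) simp
  show "homogeneous q (var_X ^ q :: 'k poly3)"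
    by (intro homogeneous_power1 homogeneous_vars)
  show "vex (phi inf var_X) 1"
    by (simp add: phi_inf_vars vex_def vge_def)
  have "var_Z ^ (q - 1) * var_Z = (var_Z ^ q :: 'k poly3)"
    using q_ge_2 by (metis One_nat_def Suc_pred less_le_trans power_Suc2 zero_less_numeral)
  then have "(var_Y ^ q + var_Y * var_Z ^ (q - 1)) * var_Z - var_X * var_X ^ q = - C"
    by (simp add: hermitian_form_def distrib_right mult.assoc)
  then show "C dvd (var_Y ^ q + var_Y * var_Z ^ (q - 1)) * var_Z - var_X * var_X ^ q"
    by simp
qed (use q_ge_2 in \<open>simp_all add: evk_simps power_0_left\<close>)

lemma local_data_exists: "T \<in> pts \<Longrightarrow> \<exists>xi U. local_data T xi U"
  using local_data_affine local_data_inf unfolding pts_def by blast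

text \<open>Each division by \<open>xi\<close> lowers the order by one as long as the quotient
  vanishes at \<open>T\<close>. It costs one factor \<open>U\<close> of degree q and gains one
  factor of degree 1, whence the relation between the degrees.\<close>

lemma local_power:
  assumes T: "T \<in> pts" and L: "local_data T xi U" and F: "homogeneous d F" "vge (phi T F) n"
  shows "\<exists>F' e. e + n = d + n * q \<and> homogeneous e F' \<and> C dvd U ^ n * F - xi ^ n * F'"
  using F(2)
proof (induction n)
  case 0
  show ?case using F(1) by (intro exI[of _ F] exI[of _ d]) simp
next
  case (Suc n)
  then obtain F' e where F': "e + n = d + n * q" "homogeneous e F'" "C dvd U ^ n * F - xi ^ n * F'"
    using vge_Suc by blast
  have xi: "vex (phi T xi) 1" using L by (simp add: local_data_def)
  have xin: "vex (phi T xi ^ n) n"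
    using vex_power[OF xi, of n] by simp
  have "phi T U ^ n * phi T F = phi T xi ^ n * phi T F'"
    using phi_dvd_diff[OF T F'(3)] by (simp add: phi_simps)
  with vge_mult_right[OF Suc.prems, of "phi T U ^ n"]
  have "vge (phi T xi ^ n * phi T F') (n + 1)" by simp
  then have "vge (phi T F') 1"
    using vge_cancel[of "phi T xi ^ n" n "phi T F'" 1] xin by (simp add: vex_def)
  then have 0: "evk F' T = 0"
    using phi_nth_0[OF T] by (simp add: vge_def)
  show ?case
  proof (cases e)
    \<comment> \<open>A constant vanishing at \<open>T\<close> is zero, so the next quotient is 0
      and may be given any degree.\<close>
    case 0
    then obtain c where "F' = con c" using F'(2) homogeneous_0_con by auto
    with 0 have "F' = 0" using \<open>evk F' T = 0\<close> by (simp add: evk_simps con_simps)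
    then have "C dvd U ^ Suc n * F - xi ^ Suc n * 0"
      using F'(3) by (simp add: mult.assoc)
    moreover have "d + Suc n * q - Suc n + Suc n = d + Suc n * q"
    proof -
      have "Suc n * 1 \<le> Suc n * q" using q_ge_2 by (intro mult_le_mono) auto
      then show ?thesis by simp
    qed
    ultimately show ?thesis using homogeneous_0 by blast
  next
    case (Suc e')
    then obtain F'' where F'': "homogeneous (e' + q) F''" "C dvd U * F' - xi * F''"
      using L F'(2) 0 unfolding local_data_def by blast
    have "U ^ Suc n * F - xi ^ Suc n * F''
        = U * (U ^ n * F - xi ^ n * F') + xi ^ n * (U * F' - xi * F'')"
      by (simp add: algebra_simps)
    then have "C dvd U ^ Suc n * F - xi ^ Suc n * F''"
      using F'(3) F''(2) by simp
    moreover have "e' + q + Suc n = d + Suc n * q"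
      using F'(1) Suc by simp
    ultimately show ?thesis using F''(1) by blast
  qed
qed

text \<open>Nonconstant series are transcendental over an algebraically closed field:
  \<open>p\<close> splits into linear factors, and no factor w - c vanishes.\<close>

lemma evp_eq_0:
  fixes p :: "'k poly" and w :: "'k fps"
  assumes "\<And>c. w \<noteq> fps_const c" "evp fps_const p w = 0"
  shows "p = 0"
  using assms(2)
proof (induction "degree p" arbitrary: p)
  case 0
  then obtain a where "p = [:a:]" using degree_eq_zeroE by metis
  with 0 show ?case
    by (simp add: ring_homo.evp_pCons[OF ring_homo_fps_const] ring_homo.evp_0[OF ring_homo_fps_const])
next
  case (Suc n)
  then obtain c where "poly p c = 0"
    using alg_closed_imp_poly_has_root[of p] by auto
  then obtain p' where p: "p = [:- c, 1:] * p'"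
    by (auto simp: poly_eq_0_iff_dvd elim!: dvdE)
  have "p' \<noteq> 0" using p Suc by auto
  then have d: "n = degree p'"
    using Suc(2) unfolding p by (subst (asm) degree_mult_eq) auto
  have "(w - fps_const c) * evp fps_const p' w = 0"
    using Suc(3) unfolding p
    by (simp add: ring_homo.evp_mult[OF ring_homo_fps_const] ring_homo.evp_pCons[OF ring_homo_fps_const]
        ring_homo.evp_0[OF ring_homo_fps_const] flip: fps_const_neg del: mult_pCons_left)
  then have "evp fps_const p' w = 0"
    using assms(1)[of c] by simp
  then show ?case using Suc(1)[OF d] p by simp
qed

lemma evp_sum:
  fixes p :: "'k poly"
  assumes "degree p \<le> n"
  shows "evp fps_const p w = (\<Sum>k\<le>n. fps_const (coeff p k) * w ^ k)"
proof -
  let ?P = "map_poly fps_const p"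
  have "poly ?P w = (\<Sum>k\<le>degree ?P. coeff ?P k * w ^ k)"
    by (rule poly_altdef)
  also have "\<dots> = (\<Sum>k\<le>n. coeff ?P k * w ^ k)"
    using assms by (intro sum.mono_neutral_left) (auto simp: coeff_eq_0 degree_map_poly)
  finally show ?thesis by (simp add: evp_def coeff_map_poly)
qed

lemma phi_affine_hom:
  assumes "degree p \<le> n"
  shows "phi (x, y, 1) (hom n p) = evp fps_const p (fps_const y + eta x)"
  by (simp add: hom_def phi_simps phi_con phi_affine_vars evp_sum[OF assms])

lemma hom_phi_affine_eq_0:
  assumes "degree p \<le> n" "phi (x, y, 1) (hom n p) = 0"
  shows "p = 0"
proof (rule evp_eq_0)
  show "evp fps_const p (fps_const y + eta x) = 0"
    using assms by (simp add: phi_affine_hom)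
  fix c
  show "fps_const y + eta x \<noteq> fps_const c"
  proof
    assume "fps_const y + eta x = fps_const c"
    then have e: "eta x = fps_const (c - y)"
      by (metis add_diff_cancel_left' fps_const_sub)
    then have "c - y = 0" using eta(1)[of x] by simp
    with e eta_nonzero show False by simp
  qed
qed

lemma hom_dvd_eq_0:
  assumes "degree p \<le> n" "C dvd hom n p"
  shows "p = 0"
proof -
  have "(0, 0, 1) \<in> pts" using q_ge_2 by (simp add: pts_def)
  then show ?thesis using assms hom_phi_affine_eq_0 phi_dvd by blast
qed

text \<open>The comparison of monomial orders works at infinity only. At an affine point, a form not
  divisible by \<open>C\<close> has a multiple which modulo \<open>C\<close> is a nonzero binary
  form in Y and Z, and the expansion of Y/Z is not constant there.\<close>

lemma phi_eq_0_iff: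
  assumes T: "T \<in> pts" and F: "homogeneous d F"
  shows "phi T F = 0 \<longleftrightarrow> C dvd F"
proof
  assume 0: "phi T F = 0"
  show "C dvd F"
  proof (cases "T = inf")
    case True
    then show ?thesis using 0 dvd_iff_phi_inf[OF F] by simp
  next
    case False
    then obtain x y where xy: "T = (x, y, 1)" using T by (auto simp: pts_def)
    show ?thesis
    proof (rule ccontr)
      assume "\<not> C dvd F"
      then obtain G' e p where G: "p \<noteq> 0" "degree p \<le> d + e" "C dvd F * G' - hom (d + e) p"
        using norm_exists[OF F] by blast
      have "phi T (hom (d + e) p) = 0"
        using phi_dvd_diff[OF T G(3)] 0 by (simp add: phi_simps)
      then show False
        using hom_phi_affine_eq_0 G xy by blast
    qed
  qed
qed (use T phi_dvd in blast)

end

section \<open>The theorem of Noether\<close>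

lemma evp_nth_0:
  fixes p :: "'a::field poly"
  shows "fps_nth (evp fps_const p (fps_const x + fps_X)) 0 = poly p x"
  by (induction p)
    (simp_all add: ring_homo.evp_0[OF ring_homo_fps_const] ring_homo.evp_pCons[OF ring_homo_fps_const])

text \<open>Linear factors are removed one at a time, from both polynomials at once. Stating
  multiplicities by expansions at x + t fits the orders on the curve.\<close>

lemma poly_dvd_if_order_le:
  fixes p h :: "'a::alg_closed_field poly"
  assumes "p \<noteq> 0"
    and "\<And>x n. vge (evp fps_const p (fps_const x + fps_X)) n \<Longrightarrow> vge (evp fps_const h (fps_const x + fps_X)) n"
  shows "p dvd h"
  using assms
proof (induction "degree p" arbitrary: p h)
  case 0
  then have "is_unit p" by (simp add: is_unit_iff_degree)
  then show ?case by (rule unit_imp_dvd)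
next
  case (Suc m)
  obtain a where a: "poly p a = 0"
    using alg_closed_imp_poly_has_root[of p] Suc(2) by auto
  then obtain p' where p: "p = [:- a, 1:] * p'"
    by (auto simp: poly_eq_0_iff_dvd elim!: dvdE)
  have "vge (evp fps_const h (fps_const a + fps_X)) 1"
    using Suc(4)[of a 1] evp_nth_0[of p a] a by (simp add: vge_def)
  then have "poly h a = 0"
    using evp_nth_0[of h a] by (simp add: vge_def)
  then obtain h' where h: "h = [:- a, 1:] * h'"
    by (auto simp: poly_eq_0_iff_dvd elim!: dvdE)
  have p': "p' \<noteq> 0" using p Suc by auto
  have d: "m = degree p'"
    using Suc(2) p' unfolding p by (subst (asm) degree_mult_eq) auto
  have "p' dvd h'"
  proof (rule Suc(1)[OF d p'])
    fix x n
    let ?w = "fps_const x + fps_X :: 'a fps"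
    assume vge: "vge (evp fps_const p' ?w) n"
    let ?L = "evp fps_const [:- a, 1:] ?w"
    have L: "?L = fps_const (x - a) + fps_X"
      by (simp add: ring_homo.evp_0[OF ring_homo_fps_const] ring_homo.evp_pCons[OF ring_homo_fps_const]
          flip: fps_const_sub fps_const_neg)
    have "fps_nth ?L 1 \<noteq> 0" unfolding L by simp
    then have "?L \<noteq> 0" by fastforce
    then obtain k where k: "vex ?L k" using vex_exists by blast
    have "vge (evp fps_const p ?w) (k + n)"
      using vge_mult[OF _ vge, of ?L k] k unfolding p
      by (simp add: vex_def ring_homo.evp_mult[OF ring_homo_fps_const] del: mult_pCons_left)
    then have "vge (?L * evp fps_const h' ?w) (k + n)"
      using Suc(4) unfolding h by (simp add: ring_homo.evp_mult[OF ring_homo_fps_const] del: mult_pCons_left)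
    then show "vge (evp fps_const h' ?w) n"
      using k vge_cancel by (auto simp: vex_def)
  qed
  then show ?case unfolding p h by (rule mult_dvd_mono[OF dvd_refl])
qed

context hermitian
begin

lemma mult_power_q: "a * a ^ (q - 1) = (a :: 'r::monoid_mult) ^ q"
  using q_ge_2 by (cases q) simp_all

section \<open>Restriction of forms to a line, and to the intersection of a line with the
  curve\<close>

definition bform :: "nat \<Rightarrow> 'k poly3 \<Rightarrow> 'k poly3 \<Rightarrow> (nat \<Rightarrow> 'k) \<Rightarrow> 'k poly3" where
  "bform d h s c = (\<Sum>j\<le>d. con (c j) * (h ^ j * s ^ (d - j)))"

lemma bform_add: "bform d h s c + bform d h s c' = bform d h s (\<lambda>j. c j + c' j)"
  by (simp add: bform_def con_simps sum.distrib algebra_simps)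

lemma bform_mult_left: "h * bform d h s c = bform (Suc d) h s (\<lambda>j. case j of 0 \<Rightarrow> 0 | Suc j \<Rightarrow> c j)"
  unfolding bform_def sum.atMost_Suc_shift
  by (simp add: con_simps sum_distrib_left algebra_simps)

lemma bform_mult_right: "s * bform d h s c = bform (Suc d) h s (\<lambda>j. if j \<le> d then c j else 0)"
  unfolding bform_def sum.atMost_Suc sum_distrib_left
  by (simp add: con_simps Suc_diff_le mult.left_commute)

text \<open>On the line \<open>u\<close> = 0 a form becomes a binary form in the other two
  coordinates. The extra clause for \<open>d\<close> = 0 repairs the truncated degree
  \<open>d - 1\<close> of the cofactor.\<close>

lemma bform_expansion:
  assumes "basis3 u h s" "homogeneous d F"
  shows "\<exists>G c. (d = 0 \<longrightarrow> G = 0) \<and> homogeneous (d - 1) G \<and> F = u * G + bform d h s c"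
  using assms(2)
proof (induction d arbitrary: F)
  case 0
  then obtain c where "F = con c" by (rule homogeneous_0_con)
  then show ?case
    by (intro exI[of _ 0] exI[of _ "\<lambda>_. c"]) (simp add: bform_def homogeneous_0)
next
  case (Suc d)
  have hs: "homogeneous 1 h" "homogeneous 1 s" using assms(1) by (simp_all add: basis3_def)
  obtain F1 F2 F3 where F: "homogeneous d F1" "homogeneous d F2" "homogeneous d F3"
      "F = u * F1 + h * F2 + s * F3"
    using basis3_decompose[OF assms(1) Suc.prems] by blast
  obtain G2 c2 where 2: "d = 0 \<longrightarrow> G2 = 0" "homogeneous (d - 1) G2" "F2 = u * G2 + bform d h s c2"
    using Suc.IH[OF F(2)] by blast
  obtain G3 c3 where 3: "d = 0 \<longrightarrow> G3 = 0" "homogeneous (d - 1) G3" "F3 = u * G3 + bform d h s c3"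
    using Suc.IH[OF F(3)] by blast
  have G: "homogeneous d (h * G2)" "homogeneous d (s * G3)"
    using homogeneous_mult[OF hs(1) 2(2)] homogeneous_mult[OF hs(2) 3(2)] 2(1) 3(1)
    by (cases d; simp add: homogeneous_0)+
  have "F = u * (F1 + h * G2 + s * G3) + (h * bform d h s c2 + s * bform d h s c3)"
    unfolding F(4) 2(3) 3(3) by (simp add: algebra_simps)
  moreover have "homogeneous d (F1 + h * G2 + s * G3)"
    by (intro homogeneous_add F G)
  ultimately show ?case
    unfolding bform_mult_left bform_mult_right bform_add by auto
qed

text \<open>\<open>order_dom F G\<close>: the divisor cut out by \<open>F\<close> is at least the one cut out by \<open>G\<close>.\<close>

definition order_dom :: "'k poly3 \<Rightarrow> 'k poly3 \<Rightarrow> bool" where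
  "order_dom F G \<longleftrightarrow> (\<forall>T\<in>pts. \<forall>n. vge (phi T G) n \<longrightarrow> vge (phi T F) n)"

lemma order_domD: "order_dom F G \<Longrightarrow> T \<in> pts \<Longrightarrow> vge (phi T G) n \<Longrightarrow> vge (phi T F) n"
  by (auto simp: order_dom_def)

text \<open>Intended for lines on which the curve has the equation X^(q+1) = e om^(q+1): modulo the
  line and \<open>C\<close>, the powers of X up to q then suffice.\<close>

definition red_mod :: "'k poly3 \<Rightarrow> 'k poly3 \<Rightarrow> nat \<Rightarrow> 'k poly3 \<Rightarrow> bool" where
  "red_mod lam om d F \<longleftrightarrow> (\<exists>c G E. (d = 0 \<longrightarrow> G = 0) \<and> homogeneous (d - 1) G \<and>
     F = lam * G + (\<Sum>i | i \<le> q \<and> i \<le> d. con (c i) * (var_X ^ i * om ^ (d - i))) + C * E)"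

lemma red_mod_lam: "homogeneous d G \<Longrightarrow> red_mod lam om (Suc d) (lam * G)"
  unfolding red_mod_def
  by (rule exI[of _ "\<lambda>_. 0"], rule exI[of _ G], rule exI[of _ 0]) (simp add: con_simps)

lemma red_mod_C: "red_mod lam om d (C * E)"
  unfolding red_mod_def
  by (rule exI[of _ "\<lambda>_. 0"], rule exI[of _ 0], rule exI[of _ E]) (simp add: con_simps homogeneous_0)

lemma red_mod_0: "red_mod lam om d 0"
  using red_mod_C[of lam om d 0] by simp

lemma red_mod_add:
  assumes "red_mod lam om d F" "red_mod lam om d F'"
  shows "red_mod lam om d (F + F')"
proof -
  obtain c G E c' G' E' where
    1: "d = 0 \<longrightarrow> G = 0" "homogeneous (d - 1) G" "d = 0 \<longrightarrow> G' = 0" "homogeneous (d - 1) G'"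
    and F: "F = lam * G + (\<Sum>i | i \<le> q \<and> i \<le> d. con (c i) * (var_X ^ i * om ^ (d - i))) + C * E"
    and F': "F' = lam * G' + (\<Sum>i | i \<le> q \<and> i \<le> d. con (c' i) * (var_X ^ i * om ^ (d - i))) + C * E'"
    using assms unfolding red_mod_def by blast
  show ?thesis
    unfolding red_mod_def
  proof (rule exI[of _ "\<lambda>i. c i + c' i"], rule exI[of _ "G + G'"], rule exI[of _ "E + E'"], intro conjI)
    show "F + F' = lam * (G + G') + (\<Sum>i | i \<le> q \<and> i \<le> d. con (c i + c' i) * (var_X ^ i * om ^ (d - i))) + C * (E + E')"
      unfolding F F' by (simp add: con_simps sum.distrib distrib_right distrib_left)
  qed (use 1 in \<open>auto intro: homogeneous_add\<close>)
qed

lemma red_mod_con_mult: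
  assumes "red_mod lam om d F"
  shows "red_mod lam om d (con a * F)"
proof -
  obtain c G E where
    1: "d = 0 \<longrightarrow> G = 0" "homogeneous (d - 1) G"
    and F: "F = lam * G + (\<Sum>i | i \<le> q \<and> i \<le> d. con (c i) * (var_X ^ i * om ^ (d - i))) + C * E"
    using assms unfolding red_mod_def by blast
  show ?thesis
    unfolding red_mod_def
  proof (rule exI[of _ "\<lambda>i. a * c i"], rule exI[of _ "con a * G"], rule exI[of _ "con a * E"], intro conjI)
    show "con a * F = lam * (con a * G) + (\<Sum>i | i \<le> q \<and> i \<le> d. con (a * c i) * (var_X ^ i * om ^ (d - i))) + C * (con a * E)"
      unfolding F by (simp add: con_simps sum_distrib_left distrib_left mult.assoc mult.left_commute)
  qed (use 1 in \<open>auto intro: homogeneous_con_mult\<close>)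
qed

lemma red_mod_sum: "(\<And>i. i \<in> A \<Longrightarrow> red_mod lam om d (F i)) \<Longrightarrow> red_mod lam om d (sum F A)"
  by (induction A rule: infinite_finite_induct) (simp_all add: red_mod_0 red_mod_add)

lemma red_mod_monomial:
  assumes "i \<le> q" "i \<le> d"
  shows "red_mod lam om d (var_X ^ i * om ^ (d - i))"
proof -
  have "(\<Sum>k | k \<le> q \<and> k \<le> d. con (if k = i then 1 else 0) * (var_X ^ k * om ^ (d - k)))
      = (\<Sum>k | k \<le> q \<and> k \<le> d. if k = i then var_X ^ k * om ^ (d - k) else 0)"
    by (rule sum.cong) (simp_all add: con_simps)
  also have "\<dots> = var_X ^ i * om ^ (d - i)"
    using assms by simp
  finally show ?thesis
    unfolding red_mod_def
    by (intro exI[of _ "\<lambda>k. if k = i then 1 else 0"] exI[of _ 0]) (simp add: homogeneous_0)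
qed

lemma homogeneous_red_mod:
  assumes B: "basis3 lam var_X om" and W: "homogeneous q W"
    and X: "var_X ^ (q + 1) = C + lam * W + con e * om ^ (q + 1)"
    and F: "homogeneous d F"
  shows "red_mod lam om d F"
  using F
proof (induction d arbitrary: F)
  case 0
  then obtain c where "F = con c" by (rule homogeneous_0_con)
  then show ?case
    using red_mod_con_mult[OF red_mod_monomial[of 0 0 lam om], of c] by simp
next
  case (Suc d)
  have om: "homogeneous 1 om" using B by (simp add: basis3_def)
  have Xmon: "red_mod lam om (Suc d) (var_X * (var_X ^ i * om ^ (d - i)))" if i: "i \<le> q" "i \<le> d" for i
  proof (cases "i = q")
    case True
    have "var_X * (var_X ^ i * om ^ (d - i)) = var_X ^ (q + 1) * om ^ (d - q)"
      by (simp add: True mult.assoc)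
    also have "\<dots> = lam * (W * om ^ (d - q)) + con e * (var_X ^ 0 * om ^ (Suc d - 0)) + C * om ^ (d - q)"
    proof -
      have "om ^ (q + 1) * om ^ (d - q) = om ^ Suc d"
        using i True by (simp flip: power_add)
      then show ?thesis
        unfolding X by (simp add: distrib_right mult.assoc add.commute del: power_Suc)
    qed
    moreover have "homogeneous d (W * om ^ (d - q))"
      using homogeneous_mult[OF W homogeneous_power1[OF om, of "d - q"]] i True by simp
    ultimately show ?thesis
      by (simp only:) (intro red_mod_add red_mod_lam red_mod_C red_mod_con_mult red_mod_monomial; simp)
  next
    case False
    have eq: "var_X * (var_X ^ i * om ^ (d - i)) = var_X ^ Suc i * om ^ (Suc d - Suc i)"
      by (simp add: mult.assoc)
    show ?thesis
      unfolding eq by (rule red_mod_monomial) (use False i in auto)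
  qed
  have omon: "red_mod lam om (Suc d) (om * (var_X ^ i * om ^ (d - i)))" if i: "i \<le> q" "i \<le> d" for i
  proof -
    have eq: "om * (var_X ^ i * om ^ (d - i)) = var_X ^ i * om ^ (Suc d - i)"
      using i by (simp add: Suc_diff_le mult.left_commute)
    show ?thesis
      unfolding eq by (rule red_mod_monomial) (use i in auto)
  qed
  have step: "red_mod lam om (Suc d) (V * H)"
    if H: "red_mod lam om d H" and V: "homogeneous 1 V"
      and mon: "\<And>i. i \<le> q \<Longrightarrow> i \<le> d \<Longrightarrow> red_mod lam om (Suc d) (V * (var_X ^ i * om ^ (d - i)))" for V H
  proof -
    obtain c G E where
      G: "d = 0 \<longrightarrow> G = 0" "homogeneous (d - 1) G"
      and H: "H = lam * G + (\<Sum>i | i \<le> q \<and> i \<le> d. con (c i) * (var_X ^ i * om ^ (d - i))) + C * E"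
      using H unfolding red_mod_def by blast
    have "V * H = lam * (V * G) + (\<Sum>i | i \<le> q \<and> i \<le> d. con (c i) * (V * (var_X ^ i * om ^ (d - i)))) + C * (V * E)"
      unfolding H by (simp add: distrib_left sum_distrib_left mult.left_commute)
    moreover have "homogeneous d (V * G)"
      using homogeneous_mult[OF V G(2)] G(1) by (cases d) (simp_all add: homogeneous_0)
    ultimately show ?thesis
      by (simp only:) (intro red_mod_add red_mod_lam red_mod_C red_mod_sum red_mod_con_mult mon; simp)
  qed
  obtain F1 F2 F3 where F: "homogeneous d F1" "homogeneous d F2" "homogeneous d F3"
      "F = lam * F1 + var_X * F2 + om * F3"
    using basis3_decompose[OF B Suc.prems] by blast
  have "red_mod lam om (Suc d) (var_X * F2)"
    by (rule step[OF Suc.IH[OF F(2)] homogeneous_vars(1) Xmon])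
  moreover have "red_mod lam om (Suc d) (om * F3)"
    by (rule step[OF Suc.IH[OF F(3)] om omon])
  ultimately show ?case
    unfolding F(4) using red_mod_lam[OF F(1)] by (intro red_mod_add)
qed

text \<open>The line Z = 0 is the tangent at infinity and meets the curve only there, with
  multiplicity q + 1. The remainder expands as a polynomial of degree at most q in the parameter, so
  order q + 1 forces it to vanish.\<close>

lemma divide_Z:
  assumes F: "homogeneous (Suc d) F" and dom: "order_dom F var_Z"
  shows "\<exists>F'. homogeneous d F' \<and> C dvd F - var_Z * F'"
proof -
  have q1: "q = 1 + (q - 1)" using q_ge_2 by simp
  define W :: "'k poly3" where "W = var_Y ^ q + var_Y * var_Z ^ (q - 1)"
  have "homogeneous (1 + (q - 1)) (var_Y * var_Z ^ (q - 1) :: 'k poly3)"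
    by (intro homogeneous_mult homogeneous_power1 homogeneous_vars)
  then have W: "homogeneous q W"
    using q1 unfolding W_def by (intro homogeneous_add homogeneous_power1 homogeneous_vars) simp
  have "var_Z * var_Z ^ (q - 1) = (var_Z ^ q :: 'k poly3)"
    by (rule mult_power_q)
  then have X: "var_X ^ (q + 1) = C + var_Z * W + con 0 * var_Y ^ (q + 1)"
    by (simp add: hermitian_form_def W_def con_simps distrib_left mult.commute mult.left_commute)
  have B: "basis3 var_Z var_X (var_Y :: 'k poly3)"
    using basis_inf unfolding basis3_def by (metis add.commute add.left_commute)
  obtain c G E where G: "homogeneous d G"
    and FG: "F = var_Z * G + (\<Sum>i | i \<le> q \<and> i \<le> Suc d. con (c i) * (var_X ^ i * var_Y ^ (Suc d - i))) + C * E"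
    using homogeneous_red_mod[OF B W X F] unfolding red_mod_def by auto
  have inf: "inf \<in> pts" by (simp add: pts_def)
  have "vge (phi inf var_Z) (q + 1)"
    using zeta by (simp add: phi_inf_vars)
  from order_domD[OF dom inf this] have vF: "vge (phi inf F) (q + 1)" .
  have "phi inf F = zeta * phi inf G + (\<Sum>i | i \<le> q \<and> i \<le> Suc d. fps_const (c i) * fps_X ^ i)"
    unfolding FG by (simp add: phi_simps phi_con phi_inf_vars phi_inf_C)
  moreover have "vge (zeta * phi inf G) (q + 1)"
    using zeta(2) by (rule vge_mult_left)
  ultimately have "vge (\<Sum>i | i \<le> q \<and> i \<le> Suc d. fps_const (c i) * fps_X ^ i) (q + 1)"
    using vF by (simp add: vge_def)
  then have *: "fps_nth (\<Sum>i | i \<le> q \<and> i \<le> Suc d. fps_const (c i) * fps_X ^ i) k = 0" if "k \<le> q" for k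
    using that by (simp add: vge_def)
  have "c k = 0" if k: "k \<le> q" "k \<le> Suc d" for k
    using *[OF k(1)] k by (simp add: fps_sum_nth fps_X_power_nth if_distrib[of "\<lambda>x. _ * x"] cong: if_cong)
  then have "F - var_Z * G = C * E"
    unfolding FG by (simp add: con_simps)
  then show ?thesis using G by auto
qed

text \<open>On the line Y = yZ the curve is X^(q+1) = y^q + y. The remainder \<open>h\<close> is a
  polynomial in X of degree at most q, and domination of orders makes it divisible by X^(q+1) - (y^q
  + y), multiplicities included; so it is zero.\<close>

lemma divide_affine_line:
  assumes F: "homogeneous (Suc d) F" and dom: "order_dom F (var_Y - con y * var_Z)"
  shows "\<exists>F'. homogeneous d F' \<and> C dvd F - (var_Y - con y * var_Z) * F'"
proof -
  let ?L = "var_Y - con y * var_Z :: 'k poly3"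
  define e where "e = y ^ q + y"
  have q1: "q = (q - 1) + 1" using q_ge_2 by simp
  have hL: "homogeneous 1 ?L"
    by (intro homogeneous_diff homogeneous_con_mult homogeneous_vars)
  define W :: "'k poly3" where "W = ?L ^ (q - 1) * var_Z + var_Z ^ q"
  have "homogeneous ((q - 1) + 1) (?L ^ (q - 1) * var_Z)"
    by (intro homogeneous_mult homogeneous_power1 homogeneous_vars hL)
  then have W: "homogeneous q W"
    using q1 unfolding W_def by (intro homogeneous_add homogeneous_power1 homogeneous_vars) simp
  have L: "?L * ?L ^ (q - 1) = ?L ^ q"
    by (rule mult_power_q)
  have Y: "var_Y = ?L + con y * var_Z" by simp
  have "var_X ^ (q + 1) = C + (?L + con y * var_Z) ^ q * var_Z + (?L + con y * var_Z) * var_Z ^ q"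
    by (simp add: hermitian_form_def)
  also have "\<dots> = C + ?L * W + con e * var_Z ^ (q + 1)"
    unfolding frob_poly3 L[symmetric] W_def e_def
    by (simp add: power_mult_distrib con_simps algebra_simps)
  finally have X: "var_X ^ (q + 1) = C + ?L * W + con e * var_Z ^ (q + 1)" .
  have "var_X = con 0 * ?L + con 1 * var_X + con 0 * var_Z"
    "var_Y = con 1 * ?L + con 0 * var_X + con y * var_Z"
    "var_Z = con 0 * ?L + con 0 * var_X + con 1 * (var_Z :: 'k poly3)"
    by (simp_all add: con_simps)
  then have B: "basis3 ?L var_X var_Z"
    unfolding basis3_def using hL homogeneous_vars by blast
  obtain c G E where G: "homogeneous d G"
    and FG: "F = ?L * G + (\<Sum>i | i \<le> q \<and> i \<le> Suc d. con (c i) * (var_X ^ i * var_Z ^ (Suc d - i))) + C * E"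
    using homogeneous_red_mod[OF B W X F] unfolding red_mod_def by auto
  define h where "h = (\<Sum>i | i \<le> q \<and> i \<le> Suc d. monom (c i) i)"
  define p :: "'k poly" where "p = monom 1 (q + 1) - [:e:]"
  have evh: "evp fps_const h w = (\<Sum>i | i \<le> q \<and> i \<le> Suc d. fps_const (c i) * w ^ i)" for w
    unfolding h_def ring_homo.hom_sum[OF ring_homo.ring_homo_evp[OF ring_homo_fps_const]]
    by (simp add: evp_def map_poly_monom poly_monom)
  have evp: "evp fps_const p w = w ^ (q + 1) - fps_const e" for w
    unfolding p_def ring_homo.hom_diff[OF ring_homo.ring_homo_evp[OF ring_homo_fps_const]]
    by (simp add: evp_def map_poly_monom poly_monom map_poly_pCons)
  have degp: "degree p = q + 1"
    unfolding p_def diff_conv_add_uminus by (subst degree_add_eq_left) (simp_all add: degree_monom_eq)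
  have "p dvd h"
  proof (rule poly_dvd_if_order_le)
    show "p \<noteq> 0" using degp by auto
    fix x n assume vge: "vge (evp fps_const p (fps_const x + fps_X)) n"
    show "vge (evp fps_const h (fps_const x + fps_X)) n"
    proof (cases "x ^ (q + 1) = e")
      case True
      then have T: "(x, y, 1) \<in> pts" by (simp add: pts_def e_def)
      have L: "phi (x, y, 1) ?L = eta x"
        by (simp add: phi_simps phi_con phi_affine_vars)
      \<comment> \<open>The order of the line at (x, y, 1) is that of \<open>eta x\<close>, which by
        \<open>vge_eta\<close> is the multiplicity of x as a root of \<open>p\<close>.\<close>
      have eta: "vge (eta x) n"
        using vge unfolding evp vge_eta True .
      have "phi (x, y, 1) F = eta x * phi (x, y, 1) G + evp fps_const h (fps_const x + fps_X)"
        unfolding FG evh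
        by (simp add: phi_simps phi_con phi_affine_vars phi_pts_C[OF T])
      moreover have "vge (phi (x, y, 1) F) n"
        using order_domD[OF dom T] eta L by simp
      moreover have "vge (eta x * phi (x, y, 1) G) n"
        using eta by (rule vge_mult_left)
      ultimately show ?thesis
        by (simp add: vge_def)
    next
      case False
      then have "poly p x \<noteq> 0"
        by (simp add: p_def poly_monom)
      then have "n = 0"
        using vge evp_nth_0[of p x] vge_nth by (metis gr0I)
      then show ?thesis by simp
    qed
  qed
  moreover have "degree h \<le> q"
    unfolding h_def by (intro degree_sum_le) (auto intro: degree_monom_le order_trans)
  ultimately have h: "h = 0"
    using degp by (metis Suc_eq_plus1 dvd_imp_degree_le not_less_eq_eq)
  have "c k = 0" if "k \<le> q" "k \<le> Suc d" for k
  proof -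
    have "coeff h k = c k"
      using that by (simp add: h_def coeff_sum)
    then show ?thesis by (simp add: h)
  qed
  then have "F - ?L * G = C * E"
    unfolding FG by (simp add: con_simps)
  then show ?thesis using G by auto
qed

lemma order_dom_cancel:
  assumes hL: "homogeneous m L" and L: "\<not> C dvd L" and dom: "order_dom F (L * N)" and dvd: "C dvd F - L * F'"
  shows "order_dom F' N"
  unfolding order_dom_def
proof (intro ballI allI impI)
  fix T n assume T: "T \<in> pts" and n: "vge (phi T N) n"
  obtain k where k: "vex (phi T L) k"
    using vex_exists phi_eq_0_iff[OF T hL] L by blast
  have "vge (phi T (L * N)) (k + n)"
    using k n by (simp add: phi_simps vge_mult vex_def)
  then have "vge (phi T L * phi T F') (k + n)"
    using order_domD[OF dom T] phi_dvd_diff[OF T dvd] by (simp add: phi_simps)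
  then show "vge (phi T F') n"
    using k vge_cancel by (auto simp: vex_def)
qed

lemma hom_Suc_Z: "degree p \<le> n \<Longrightarrow> hom (Suc n) p = var_Z * hom n p"
  unfolding hom_def
  by (simp add: coeff_eq_0 con_simps sum_distrib_left Suc_diff_le algebra_simps)

lemma hom_Suc_line:
  assumes "degree p \<le> n"
  shows "hom (Suc n) ([:- y, 1:] * p) = (var_Y - con y * var_Z) * hom n p"
proof -
  have "hom (Suc n) ([:- y, 1:] * p) = hom (Suc n) (pCons 0 p) - con y * hom (Suc n) p"
    by (simp add: hom_def con_simps algebra_simps sum_subtractf sum_distrib_left)
  moreover have "hom (Suc n) (pCons 0 p) = var_Y * hom n p"
    unfolding hom_def sum.atMost_Suc_shift
    by (simp add: con_simps sum_distrib_left algebra_simps)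
  ultimately show ?thesis
    by (simp add: hom_Suc_Z[OF assms] algebra_simps)
qed

text \<open>A binary form is a product of lines: one factor Z for each degree missing in
  \<open>p\<close> and one factor Y - yZ for each root. These are divided out one by one.\<close>

lemma divide_hom:
  assumes "p \<noteq> 0" "degree p \<le> n" "homogeneous (n + e) F" "order_dom F (hom n p)"
  shows "\<exists>F'. homogeneous e F' \<and> C dvd F - hom n p * F'"
  using assms
proof (induction n arbitrary: p F)
  case 0
  then obtain a where p: "p = [:a:]" "a \<noteq> 0" using degree_eq_zeroE by (metis le_zero_eq pCons_0_0)
  have "hom 0 p * (con (1 / a) * F) = con (a * (1 / a)) * F"
    by (simp add: hom_def p mult.assoc flip: con_simps(2))
  also have "\<dots> = F" using p by (simp add: con_simps)
  finally have "hom 0 p * (con (1 / a) * F) = F" .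
  then have "C dvd F - hom 0 p * (con (1 / a) * F)" by (metis diff_self dvd_0_right)
  moreover have "homogeneous e (con (1 / a) * F)"
    using 0(3) homogeneous_con_mult by auto
  ultimately show ?case by blast
next
  case (Suc n)
  have *: ?case if N: "hom (Suc n) p = L * hom n p'" "p' \<noteq> 0" "degree p' \<le> n"
    and L: "homogeneous 1 L"
    and div: "order_dom F L \<Longrightarrow> \<exists>F'. homogeneous (n + e) F' \<and> C dvd F - L * F'" for L p'
  proof -
    have ndvd: "\<not> C dvd L"
      using hom_dvd_eq_0[OF Suc.prems(2)] Suc.prems(1) N(1) by auto
    have "order_dom F L"
      using Suc.prems(4) unfolding N(1) order_dom_def by (simp add: phi_simps vge_mult_left)
    then obtain F1 where F1: "homogeneous (n + e) F1" "C dvd F - L * F1"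
      using div by blast
    have "order_dom F1 (hom n p')"
      using order_dom_cancel[OF L ndvd _ F1(2)] Suc.prems(4) N(1) by simp
    then obtain F2 where F2: "homogeneous e F2" "C dvd F1 - hom n p' * F2"
      using Suc.IH[OF N(2,3) F1(1)] by blast
    then show ?thesis
      using dvd_diff_chain[OF F1(2) F2(2)] N(1) by (auto simp: mult.assoc)
  qed
  show ?case
  proof (cases "degree p \<le> n")
    case True
    show ?thesis
      using Suc.prems divide_Z by (intro *[OF hom_Suc_Z[OF True] _ True homogeneous_vars(3)]) auto
  next
    case False
    then have d: "degree p = Suc n" using Suc.prems by simp
    then obtain y where "poly p y = 0"
      using alg_closed_imp_poly_has_root[of p] by auto
    then obtain p' where p: "p = [:- y, 1:] * p'"
      by (auto simp: poly_eq_0_iff_dvd elim!: dvdE)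
    have p': "p' \<noteq> 0" using p Suc.prems by auto
    then have d': "degree p' \<le> n"
      using d unfolding p by (subst (asm) degree_mult_eq) auto
    have h: "homogeneous 1 (var_Y - con y * var_Z)"
      by (intro homogeneous_diff homogeneous_con_mult homogeneous_vars)
    show ?thesis
      using Suc.prems divide_affine_line
      by (intro *[OF _ p' d' h]) (simp_all only: p hom_Suc_line[OF d'] add_Suc)
  qed
qed

text \<open>By \<open>norm_exists\<close>, \<open>G\<close> times a cofactor \<open>G'\<close> is a
  binary form in Y and Z modulo \<open>C\<close>, and division by such forms is known. Multiplying
  \<open>F\<close> by \<open>G'\<close> as well, the factor \<open>G'\<close> cancels at the end
  because \<open>C\<close> is prime for forms.\<close>

lemma noether:
  assumes F: "homogeneous (d + e) F" and G: "homogeneous d G" "\<not> C dvd G" and dom: "order_dom F G"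
  shows "\<exists>F'. homogeneous e F' \<and> C dvd F - G * F'"
proof -
  obtain G' d' p where N: "homogeneous d' G'" "p \<noteq> 0" "degree p \<le> d + d'" "C dvd G * G' - hom (d + d') p"
    using norm_exists[OF G] by blast
  let ?N = "hom (d + d') p"
  have "\<not> C dvd G'"
  proof
    assume "C dvd G'"
    then have "C dvd ?N" using dvd_diff[OF _ N(4), of "G * G'"] by simp
    then show False using hom_dvd_eq_0[OF N(3)] N(2) by simp
  qed
  have "order_dom (F * G') ?N"
    unfolding order_dom_def
  proof (intro ballI allI impI)
    fix T n assume T: "T \<in> pts" and n: "vge (phi T ?N) n"
    obtain k where k: "vex (phi T G') k"
      using vex_exists phi_eq_0_iff[OF T N(1)] \<open>\<not> C dvd G'\<close> by blast
    have N': "vge (phi T G' * phi T G) n"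
      using n phi_dvd_diff[OF T N(4)] by (simp add: phi_simps mult.commute)
    show "vge (phi T (F * G')) n"
    \<comment> \<open>If n <= k, the factor \<open>G'\<close> alone provides the order; otherwise
      its k zeros are removed from those of the binary form and the rest is supplied by domination
      over \<open>G\<close>.\<close>
    proof (cases "n \<le> k")
      case True
      then have "vge (phi T G') n" using k vge_mono by (auto simp: vex_def)
      then show ?thesis by (simp add: phi_simps vge_mult_right)
    next
      case False
      then have "vge (phi T G) (n - k)"
        using N' k vge_cancel[of "phi T G'" k "phi T G" "n - k"] by (simp add: vex_def)
      then have "vge (phi T F) (n - k)"
        using order_domD[OF dom T] by blast
      then have "vge (phi T F * phi T G') (n - k + k)"
        using k vge_mult by (auto simp: vex_def)
      then show ?thesis using False by (simp add: phi_simps)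
    qed
  qed
  moreover have "homogeneous ((d + d') + e) (F * G')"
    using homogeneous_mult[OF F N(1)] by (simp add: ac_simps)
  ultimately obtain F' where F': "homogeneous e F'" "C dvd F * G' - ?N * F'"
    using divide_hom[OF N(2,3)] by blast
  have "(F - G * F') * G' = (F * G' - ?N * F') - F' * (G * G' - ?N)"
    by (simp add: algebra_simps)
  then have "C dvd (F - G * F') * G'"
    using F'(2) N(4) by simp
  moreover have "homogeneous (d + e) (F - G * F')"
    by (intro homogeneous_diff homogeneous_mult F G F')
  ultimately have "C dvd F - G * F'"
    using C_dvd_mult[OF _ N(1)] \<open>\<not> C dvd G'\<close> by blast
  then show ?thesis using F'(1) by blast
qed

end

section \<open>Rational points and duality\<close>

text \<open>Chains of effective divisors are encoded as lists of points: the prefixes of a list are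
  the members of the chain, and their multiplicities are counts.\<close>

lemma count_list_exists:
  assumes "finite P"
  shows "\<exists>xs. set xs \<subseteq> P \<and> (\<forall>x\<in>P. count_list xs x = g x)"
  using assms
proof (induction P rule: finite_induct)
  case empty
  show ?case by (intro exI[of _ "[]"]) simp
next
  case (insert a P)
  then obtain xs where xs: "set xs \<subseteq> P" "\<forall>x\<in>P. count_list xs x = g x" by blast
  have r: "count_list (replicate n a) x = (if x = a then n else 0)" for n x
    by (induction n) auto
  have "count_list xs a = 0"
    using xs insert by (metis count_notin subsetD)
  then show ?case
    using xs insert.hyps
    by (intro exI[of _ "replicate (g a) a @ xs"]) (auto simp: r)
qed

context hermitian
begin

text \<open>The points over the field with \<open>q\<^sup>2\<close> elements.\<close>

definition rpts :: "('k \<times> 'k \<times> 'k) set" where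
  "rpts = {(x, y, z). (x, y, z) \<in> pts \<and> (x ^ q) ^ q = x \<and> (y ^ q) ^ q = y}"

text \<open>On the diagonal this is the equation of the curve. The second argument enters through
  its q-th powers, so for rational points exchanging the arguments is the q-th power map, see
  \<open>herm_conj\<close>.\<close>

definition herm :: "'k \<times> 'k \<times> 'k \<Rightarrow> 'k \<times> 'k \<times> 'k \<Rightarrow> 'k" where
  "herm p p' = (case p of (x, y, z) \<Rightarrow> case p' of (x', y', z') \<Rightarrow>
     x * x' ^ q - y * z' ^ q - z * y' ^ q)"

text \<open>The coefficients are the partial derivatives of \<open>C\<close> at the point, taken in
  characteristic dividing q.\<close>

definition tng :: "'k \<times> 'k \<times> 'k \<Rightarrow> 'k poly3" where
  "tng p = (case p of (x, y, z) \<Rightarrow>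
     con (x ^ q) * var_X - con (z ^ q) * var_Y - con (y ^ q) * var_Z)"

lemma rpts_pts: "p \<in> rpts \<Longrightarrow> p \<in> pts"
  by (auto simp: rpts_def)

lemma rpts_cases:
  assumes "p \<in> rpts"
  obtains "p = inf" | x y where "p = (x, y, 1)" "x ^ (q + 1) = y ^ q + y" "(x ^ q) ^ q = x" "(y ^ q) ^ q = y"
  using assms by (auto simp: rpts_def pts_def)

lemma evk_tng: "evk (tng p) T = herm T p"
  by (cases p, cases T) (simp add: tng_def herm_def evk_simps mult.commute)

lemma homogeneous_tng: "homogeneous 1 (tng p)"
  by (cases p)
    (auto simp: tng_def intro!: homogeneous_diff homogeneous_con_mult homogeneous_vars[unfolded One_nat_def])

lemma herm_conj:
  assumes "p \<in> rpts" "p' \<in> rpts"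
  shows "herm p' p = herm p p' ^ q"
  by (rule rpts_cases[OF assms(1)]; rule rpts_cases[OF assms(2)])
    (use q_ge_2 in \<open>auto simp: herm_def frob_add frob_diff frob_minus power_mult_distrib power_0_left algebra_simps\<close>)

lemma herm_self: "p \<in> pts \<Longrightarrow> herm p p = 0"
  using q_ge_2 by (auto simp: pts_def herm_def algebra_simps)

lemma frob_fps_diff: "(a - b) ^ q = a ^ q - (b :: 'k fps) ^ q"
  using frob_fps[of "a - b" b] by simp

text \<open>Rationality enters here: for u = x^q t - eta, the identity (x^q)^q = x turns u + u^q
  into -t^(q+1), and by \<open>vge_add_power\<close> the order of u is that of u + u^q.\<close>

lemma vex_tng:
  assumes "p \<in> rpts"
  shows "vex (phi p (tng p)) (q + 1)"
  using assms
proof (cases rule: rpts_cases)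
  case 1
  then have "phi p (tng p) = - zeta"
    using q_ge_2 by (simp add: tng_def phi_simps phi_inf_vars phi_con con_simps)
  then show ?thesis using zeta by (simp add: vex_def vge_def)
next
  case (2 x y)
  define u where "u = fps_const (x ^ q) * fps_X - eta x"
  have "phi p (tng p) = fps_const (x ^ q) * (fps_const x + fps_X) - (fps_const y + eta x) - fps_const (y ^ q)"
    by (simp add: 2(1) tng_def phi_simps phi_affine_vars phi_con)
  also have "\<dots> = u + fps_const (x ^ (q + 1) - y - y ^ q)"
    by (simp add: u_def algebra_simps flip: fps_const_sub fps_const_mult)
  finally have u: "phi p (tng p) = u" using 2(2) by simp
  have "u ^ q = fps_const x * fps_X ^ q - eta x ^ q"
    unfolding u_def frob_fps_diff by (simp add: power_mult_distrib fps_const_power 2(3))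
  then have "u + u ^ q = fps_const (x ^ q) * fps_X + fps_const x * fps_X ^ q - (eta x + eta x ^ q)"
    by (simp add: u_def)
  then have uq: "u + u ^ q = - (fps_X ^ (q + 1))"
    unfolding eta(2) by simp
  have 0: "fps_nth u 0 = 0" by (simp add: u_def eta)
  have nth: "fps_nth (- (fps_X ^ (q + 1) :: 'k fps)) i = (if i = q + 1 then - 1 else 0)" for i
    by (simp only: fps_neg_nth fps_X_power_nth) simp
  have "vge (u + u ^ q) (q + 1)"
    unfolding uq vge_def nth by simp
  then have g: "vge u (q + 1)" using vge_add_power[OF 0] by blast
  have "fps_nth u (q + 1) = fps_nth (u + u ^ q) (q + 1)"
    using nth_add_power[OF 0 g] by simp
  then have "fps_nth u (q + 1) \<noteq> 0"
    unfolding uq nth by simp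
  with g show ?thesis unfolding u vex_def by blast
qed

text \<open>Substituting the tangent equation and its q-th power into the equation of the curve
  leaves (x - x0)^(q+1) = 0.\<close>

lemma herm_eq_0:
  assumes p: "p \<in> rpts" and T: "T \<in> pts" and 0: "herm T p = 0"
  shows "T = p"
  using p
proof (cases rule: rpts_cases)
  case 1
  with T 0 q_ge_2 show ?thesis by (auto simp: herm_def pts_def power_0_left)
next
  case (2 x0 y0)
  have "T \<noteq> inf" using 0 q_ge_2 by (auto simp: herm_def 2 power_0_left)
  then obtain x y where xy: "T = (x, y, 1)" "x ^ (q + 1) = y ^ q + y"
    using T by (auto simp: pts_def)
  have y: "y = x * x0 ^ q - y0 ^ q"
    using 0 by (simp add: herm_def 2 xy algebra_simps)
  have "y ^ q = x ^ q * x0 - y0"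
    unfolding y frob_diff power_mult_distrib 2 ..
  with xy(2) y have "x ^ (q + 1) = x ^ q * x0 - y0 + x * x0 ^ q - y0 ^ q"
    by simp
  moreover have "(x - x0) ^ (q + 1) = x ^ (q + 1) - x ^ q * x0 - x * x0 ^ q + x0 ^ (q + 1)"
    by (simp add: frob_diff algebra_simps)
  ultimately have "(x - x0) ^ (q + 1) = 0"
    using 2(2) by simp
  then have "x - x0 = 0" by (simp only: power_eq_0_iff)
  then have "x = x0" by simp
  then show ?thesis using 2(1,2) xy(1) y by (simp add: algebra_simps)
qed

lemma vex_tng_other:
  assumes "p \<in> rpts" "T \<in> pts" "T \<noteq> p"
  shows "vex (phi T (tng p)) 0"
  using herm_eq_0[OF assms(1,2)] assms(3) phi_nth_0[OF assms(2)] by (auto simp: vex_def evk_tng)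

lemma tng_basis:
  assumes "p \<in> rpts"
  obtains h s where "basis3 (tng p) h s" "vex (phi p h) 1" "evk s p \<noteq> 0" "evk h p = 0"
  using assms
proof (cases rule: rpts_cases)
  case 1
  have "var_X = con 0 * tng p + con 1 * var_X + con 0 * var_Y"
    "var_Y = con 0 * tng p + con 0 * var_X + con 1 * var_Y"
    "var_Z = con (- 1) * tng p + con 0 * var_X + con 0 * var_Y"
    using q_ge_2 by (simp_all add: con_simps tng_def 1)
  then have "basis3 (tng p) var_X var_Y"
    unfolding basis3_def using homogeneous_vars homogeneous_tng by blast
  then show thesis
    by (rule that) (simp_all add: 1 phi_inf_vars vex_def vge_def evk_simps)
next
  case (2 x y)
  let ?h = "var_X - con x * var_Z :: 'k poly3"
  have "var_X = con 0 * tng p + con 1 * ?h + con x * var_Z"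
    "var_Y = con (- 1) * tng p + con (x ^ q) * ?h + con (x ^ q * x - y ^ q) * var_Z"
    "var_Z = con 0 * tng p + con 0 * ?h + con 1 * var_Z"
    by (simp_all add: con_simps tng_def 2(1) algebra_simps)
  moreover have "homogeneous 1 ?h"
    by (intro homogeneous_diff homogeneous_con_mult homogeneous_vars)
  ultimately have "basis3 (tng p) ?h var_Z"
    unfolding basis3_def using homogeneous_vars homogeneous_tng by blast
  then show thesis
    by (rule that) (simp_all add: 2(1) phi_simps phi_affine_vars phi_con vex_def vge_def evk_simps)
qed

text \<open>Below order q + 1 the tangent contributes nothing, and the monomials h^j s^(d-j) have
  the distinct orders j at \<open>p\<close>. The coefficients are therefore read off one after the
  other.\<close>

lemma bform_coeffs_0:
  assumes p: "p \<in> rpts" and h: "vex (phi p h) 1" and s: "evk s p \<noteq> 0"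
    and F: "F = tng p * G + bform d h s c" "vge (phi p F) b" "b \<le> q + 1"
  shows "j < b \<Longrightarrow> j \<le> d \<Longrightarrow> c j = 0"
proof (induction j rule: less_induct)
  case (less j)
  let ?h = "phi p h" and ?s = "phi p s"
  have s0: "fps_nth ?s 0 \<noteq> 0"
    using s phi_nth_0[OF rpts_pts[OF p]] by simp
  have hi: "vex (?h ^ i) i" for i using vex_power[OF h, of i] by simp
  have coeff: "c i * fps_nth (?h ^ i * ?s ^ (d - i)) j
      = (if i = j then c j * (fps_nth (?h ^ j) j * fps_nth ?s 0 ^ (d - j)) else 0)" if "i \<le> d" for i
  proof (cases "i < j")
    case True
    then show ?thesis using less that by simp
  next
    case False
    have v: "vge (?h ^ i) i" using hi by (simp add: vex_def)
    show ?thesis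
    proof (cases "i = j")
      case True
      have "fps_nth (?h ^ j * ?s ^ (d - j)) (j + 0) = fps_nth (?h ^ j) j * fps_nth (?s ^ (d - j)) 0"
        using v True by (intro vge_nth_mult) simp_all
      then show ?thesis using True by (simp add: fps_power_zeroth)
    next
      case False
      have "fps_nth (?h ^ i * ?s ^ (d - i)) j = 0"
        using vge_nth[OF vge_mult_left[OF v]] False \<open>\<not> i < j\<close> by simp
      then show ?thesis using False by simp
    qed
  qed
  have "fps_nth (phi p (bform d h s c)) j
      = (\<Sum>i\<le>d. if i = j then c j * (fps_nth (?h ^ j) j * fps_nth ?s 0 ^ (d - j)) else 0)"
    unfolding bform_def by (simp add: phi_simps phi_con fps_sum_nth coeff)
  also have "\<dots> = c j * (fps_nth (?h ^ j) j * fps_nth ?s 0 ^ (d - j))"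
    using less.prems by simp
  finally have 1: "fps_nth (phi p (bform d h s c)) j = \<dots>" .
  have "vge (phi p (tng p * G)) (q + 1)"
    using vex_tng[OF p] by (simp add: phi_simps vex_def vge_mult_left)
  then have "fps_nth (phi p (tng p * G)) j = 0"
    using less.prems F(3) vge_nth[of "phi p (tng p * G)" "q + 1" j] by simp
  moreover have "fps_nth (phi p F) j = 0"
    using less.prems F(2) vge_nth[of "phi p F" b j] by simp
  ultimately have "fps_nth (phi p (bform d h s c)) j = 0"
    unfolding F(1) by (simp add: phi_simps)
  with 1 s0 hi[of j] show ?case by (simp add: vex_def)
qed

text \<open>A nonzero binary form of degree m on the tangent has order at most m at
  \<open>p\<close>. Larger order means that the restriction to the tangent vanishes, and the tangent
  has order q + 1.\<close>

lemma low_degree_order: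
  assumes p: "p \<in> rpts" and F: "homogeneous m F" "m \<le> q" "vge (phi p F) (m + 1)"
  shows "vge (phi p F) (q + 1)"
proof -
  obtain h s where B: "basis3 (tng p) h s" and h: "vex (phi p h) 1" and s: "evk s p \<noteq> 0"
    using tng_basis[OF p] by blast
  obtain G c where G: "F = tng p * G + bform m h s c"
    using bform_expansion[OF B F(1)] by blast
  have "c j = 0" if "j \<le> m" for j
    using bform_coeffs_0[OF p h s G F(3)] that F(2) by simp
  then have "bform m h s c = 0" by (simp add: bform_def con_simps)
  then show ?thesis
    using vex_tng[OF p] unfolding G by (simp add: phi_simps vex_def vge_mult_left)
qed

lemma linear_order:
  assumes p: "p \<in> rpts" and l: "homogeneous 1 l" "evk l p = 0"
  shows "vex (phi p l) 1 \<or> (\<exists>a. l = con a * tng p)"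
proof -
  obtain h s where B: "basis3 (tng p) h s" and h: "vex (phi p h) 1" "evk h p = 0" and s: "evk s p \<noteq> 0"
    using tng_basis[OF p] by blast
  obtain G c where G: "homogeneous 0 G" "l = tng p * G + bform 1 h s c"
    using bform_expansion[OF B l(1)] by auto
  obtain a where a: "G = con a" using G(1) by (rule homogeneous_0_con)
  have b: "bform 1 h s c = con (c 0) * s + con (c 1) * h"
    by (simp add: bform_def)
  have "herm p p = 0" using herm_self rpts_pts[OF p] by blast
  then have "c 0 = 0"
    using l(2) h(2) s unfolding G(2) b by (simp add: evk_simps evk_tng)
  then have l': "l = con a * tng p + con (c 1) * h"
    unfolding G(2) b a by (simp add: con_simps mult.commute)
  show ?thesis
  proof (cases "c 1 = 0")
    case True
    then show ?thesis using l' by (auto simp: con_simps)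
  next
    case False
    have "fps_nth (phi p (tng p)) i = 0" if "i < q + 1" for i
      using vex_tng[OF p] that by (simp add: vex_def vge_def)
    then have "vex (phi p l) 1"
      using h(1) False q_ge_2 unfolding l' by (simp add: phi_simps phi_con vex_def vge_def)
    then show ?thesis ..
  qed
qed

section \<open>Products of tangents and bounds on the number of zeros\<close>

definition tprod :: "('k \<times> 'k \<times> 'k) set \<Rightarrow> ('k \<times> 'k \<times> 'k \<Rightarrow> nat) \<Rightarrow> 'k poly3" where
  "tprod P f = (\<Prod>x\<in>P. tng x ^ f x)"

lemma homogeneous_tprod: "finite P \<Longrightarrow> homogeneous (sum f P) (tprod P f)"
  unfolding tprod_def by (intro homogeneous_prod homogeneous_power1 homogeneous_tng)

lemma vex_tprod:
  assumes "finite P" "P \<subseteq> rpts" "T \<in> pts"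
  shows "vex (phi T (tprod P f)) (if T \<in> P then f T * (q + 1) else 0)"
  using assms(1,2)
proof (induction P rule: finite_induct)
  case empty
  then show ?case by (simp add: tprod_def phi_simps vex_def)
next
  case (insert x P)
  have 1: "phi T (tprod (insert x P) f) = phi T (tng x) ^ f x * phi T (tprod P f)"
    using insert by (simp add: tprod_def phi_simps)
  have 2: "vex (phi T (tng x) ^ f x) (if T = x then f T * (q + 1) else 0)"
    using vex_power[OF vex_tng[of x], of "f x"] vex_power[OF vex_tng_other[of x T], of "f x"] insert.prems assms(3)
    by auto
  have 3: "vex (phi T (tprod P f)) (if T \<in> P then f T * (q + 1) else 0)"
    using insert by blast
  have "(if T = x then f T * (q + 1) else 0) + (if T \<in> P then f T * (q + 1) else 0)
      = (if T \<in> insert x P then f T * (q + 1) else 0)"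
    using insert.hyps by auto
  then show ?case
    unfolding 1 using vex_mult[OF 2 3] by (simp only:)
qed

lemma divide_tprod:
  assumes P: "finite P" "P \<subseteq> rpts" and F: "homogeneous (sum f P + e) F"
    and ge: "\<And>x. x \<in> P \<Longrightarrow> vge (phi x F) (f x * (q + 1))"
  obtains F' where "homogeneous e F'" "C dvd F - tprod P f * F'"
proof -
  have inf: "inf \<in> pts" by (simp add: pts_def)
  have "\<not> C dvd tprod P f"
    using vex_nonzero[OF vex_tprod[OF P inf, of f]] phi_dvd[OF inf, of "tprod P f"] by argo
  moreover have "order_dom F (tprod P f)"
    unfolding order_dom_def
  proof (intro ballI allI impI)
    fix T n assume T: "T \<in> pts" and n: "vge (phi T (tprod P f)) n"
    then have "n \<le> (if T \<in> P then f T * (q + 1) else 0)"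
      using vex_vge[OF vex_tprod[OF P T]] by blast
    then show "vge (phi T F) n"
      using ge[of T] vge_mono[of "phi T F"] by (cases "T \<in> P") auto
  qed
  ultimately show thesis
    using noether[OF F homogeneous_tprod[OF P(1)]] that by blast
qed

lemma phi_quotient_order:
  assumes P: "finite P" "P \<subseteq> rpts" and dvd: "C dvd F - tprod P f * F'" and x: "x \<in> P"
  shows "vge (phi x F) (f x * (q + 1) + n) \<longleftrightarrow> vge (phi x F') n"
    "vex (phi x F) (f x * (q + 1) + n) \<longleftrightarrow> vex (phi x F') n"
proof -
  have pts: "x \<in> pts" using P x rpts_pts by blast
  have v: "vex (phi x (tprod P f)) (f x * (q + 1))"
    using vex_tprod[OF P pts] x by simp
  have e: "phi x F = phi x (tprod P f) * phi x F'"
    using phi_dvd_diff[OF pts dvd] by (simp add: phi_simps)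
  show "vge (phi x F) (f x * (q + 1) + n) \<longleftrightarrow> vge (phi x F') n"
    unfolding e using v vge_cancel[of "phi x (tprod P f)" "f x * (q + 1)" "phi x F'" n]
      vge_mult[of "phi x (tprod P f)" "f x * (q + 1)" "phi x F'" n]
    unfolding vex_def by blast
  show "vex (phi x F) (f x * (q + 1) + n) \<longleftrightarrow> vex (phi x F') n"
    unfolding e using v vex_cancel[of "phi x (tprod P f)" "f x * (q + 1)" "phi x F'" n]
      vex_mult[of "phi x (tprod P f)" "f x * (q + 1)" "phi x F'" n] by blast
qed

text \<open>A special case of Bezout's bound: dividing by the product of tangents leaves a constant,
  and one further zero makes this constant 0.\<close>

lemma too_many_zeros:
  assumes P: "finite P" "P \<subseteq> rpts" and F: "homogeneous (sum f P) F"
    and ge: "\<And>x. x \<in> P \<Longrightarrow> vge (phi x F) (f x * (q + 1))"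
    and x: "x \<in> P" "vge (phi x F) (f x * (q + 1) + 1)"
  shows "C dvd F"
proof -
  obtain F' where F': "homogeneous 0 F'" "C dvd F - tprod P f * F'"
    using divide_tprod[OF P, of f 0 F] F ge by auto
  obtain c where c: "F' = con c" using F'(1) by (rule homogeneous_0_con)
  have "vge (phi x F') 1"
    using phi_quotient_order(1)[OF P F'(2) x(1)] x(2) by blast
  then have "F' = 0"
    unfolding c by (simp add: phi_con vge_def con_simps)
  then show ?thesis using F'(2) by simp
qed

text \<open>This is the Weierstrass gap \<open>2g - 1\<close> at a rational point.\<close>

lemma no_simple_pole:
  assumes P: "finite P" "P \<subseteq> rpts" and F: "homogeneous (sum f P + (q - 1)) F"
    and ge: "\<And>x. x \<in> P \<Longrightarrow> vge (phi x F) (f x * (q + 1))"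
    and x: "x \<in> P" "vex (phi x F) (f x * (q + 1) + q)"
  shows False
proof -
  obtain F' where F': "homogeneous (q - 1) F'" "C dvd F - tprod P f * F'"
    using divide_tprod[OF P F ge] by blast
  have v: "vex (phi x F') q"
    using phi_quotient_order(2)[OF P F'(2) x(1)] x(2) by blast
  \<comment> \<open>The quotient has degree q - 1, so order q already exceeds its degree.\<close>
  then have "vge (phi x F') (q + 1)"
    using low_degree_order[OF _ F'(1), of x] P x q_ge_2 by (auto simp: vex_def)
  with v show False by (simp add: vex_def vge_def)
qed

end

locale hermitian_set = hermitian q r K
  for q r and K :: "'k::alg_closed_field itself" +
  fixes P :: "('k \<times> 'k \<times> 'k) set"
  assumes P_rpts: "P \<subseteq> rpts" and card_P: "card P = 3"
begin

lemma finite_P: "finite P"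
  using card_P by (metis card.infinite zero_neq_numeral)

text \<open>Riemann--Roch for divisors supported on \<open>P\<close>, in the form: at each step of a chain of
  divisors exactly one of the two dimensions \<open>l(D)\<close> and \<open>l(K - D)\<close> jumps.\<close>

lemma duality_chain:
  fixes ws :: "('k \<times> 'k \<times> 'k) list"
  assumes n: "q \<le> n" and ws: "set ws \<subseteq> P" and cnt: "\<And>x. x \<in> P \<Longrightarrow> count_list ws x = M"
    and M: "M = 2 * n * (q + 1)" and k: "k < length ws"
  shows "(\<exists>F. homogeneous (3 * n) F \<and> (\<forall>x\<in>P. vge (phi x F) (count_list (take k ws) x)) \<and>
        fps_nth (phi (ws ! k) F) (count_list (take k ws) (ws ! k)) \<noteq> 0)
    \<longleftrightarrow> \<not> (\<exists>F. homogeneous (q - 2 + 3 * n) F \<and> (\<forall>x\<in>P. vge (phi x F) (M - count_list (take (Suc k) ws) x)) \<and>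
        fps_nth (phi (ws ! k) F) (M - count_list (take (Suc k) ws) (ws ! k)) \<noteq> 0)"
proof -
  define c where "c i = count_list (take i ws)" for i
  have c0: "c 0 x = 0" for x by (simp add: c_def)
  have cSuc: "c (Suc i) x = c i x + (if x = ws ! i then 1 else 0)" if "i < length ws" for i x
    using that by (simp add: c_def take_Suc_conv_app_nth)
  have len: "length ws = 3 * M"
    using sum_count_set[OF ws finite_P] cnt card_P by simp
  have cM: "c (length ws) x = M" if "x \<in> P" for x
    using cnt that by (simp add: c_def)
  have cle: "c i x \<le> M" if "x \<in> P" for i x
  proof -
    have "count_list (take i ws) x \<le> count_list (take i ws @ drop i ws) x"
      unfolding count_list_append by simp
    then show ?thesis using cnt that by (simp add: c_def)
  qed
  have wsP: "ws ! i \<in> P" if "i < length ws" for i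
    using ws that nth_mem by blast
  define A where "A i F \<longleftrightarrow> (\<forall>x\<in>P. vge (phi x F) (c i x))" for i F
  define B where "B i F \<longleftrightarrow> (\<forall>x\<in>P. vge (phi x F) (M - c i x))" for i F
  define a where "a i F = fps_nth (phi (ws ! i) F) (c i (ws ! i))" for i F
  define b where "b i F = fps_nth (phi (ws ! i) F) (M - c (Suc i) (ws ! i))" for i F
  \<comment> \<open>\<open>J1\<close> collects the steps at which l(D) jumps, \<open>J2\<close>
    those at which l(K - D) jumps. On both sides n tangents at each point have been multiplied in to
    clear denominators; this explains the degrees 3n and q - 2 + 3n.\<close>
  define J1 where "J1 = {i. i < 3 * M \<and> (\<exists>F. homogeneous (3 * n) F \<and> A i F \<and> a i F \<noteq> 0)}"
  define J2 where "J2 = {i. i < 3 * M \<and> (\<exists>F. homogeneous (q - 2 + 3 * n) F \<and> B (Suc i) F \<and> b i F \<noteq> 0)}"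
  have fin: "finite J1" "finite J2" by (simp_all add: J1_def J2_def)
  have n0: "0 < n" using n q_ge_2 by simp
  have A_Suc: "A (Suc i) F \<longleftrightarrow> A i F \<and> a i F = 0" if "i < 3 * M" for i F
  proof -
    have i: "i < length ws" using that len by simp
    have "vge (phi x F) (c (Suc i) x) \<longleftrightarrow> vge (phi x F) (c i x) \<and> (x = ws ! i \<longrightarrow> a i F = 0)" for x
      by (cases "x = ws ! i") (simp_all add: cSuc[OF i] vge_Suc a_def)
    then show ?thesis using wsP[OF i] unfolding A_def by blast
  qed
  have B_Suc: "B i F \<longleftrightarrow> B (Suc i) F \<and> b i F = 0" if "i < 3 * M" for i F
  proof -
    have i: "i < length ws" using that len by simp
    have e1: "M - c i (ws ! i) = Suc (M - c (Suc i) (ws ! i))"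
      using cSuc[OF i, of "ws ! i"] cle[OF wsP[OF i], of "Suc i"] by simp
    have e2: "c (Suc i) x = c i x" if "x \<noteq> ws ! i" for x
      using cSuc[OF i] that by simp
    have "vge (phi x F) (M - c i x) \<longleftrightarrow> vge (phi x F) (M - c (Suc i) x) \<and> (x = ws ! i \<longrightarrow> b i F = 0)" for x
    proof (cases "x = ws ! i")
      case True
      then show ?thesis unfolding True e1 vge_Suc b_def by simp
    next
      case False
      then show ?thesis by (simp only: e2[OF False] simp_thms)
    qed
    then show ?thesis using wsP[OF i] unfolding B_def by blast
  qed
  have lin: "a i (red d e) = (\<Sum>ij\<in>idx d. a i (mon d ij) * e ij)"
    "b i (red d e) = (\<Sum>ij\<in>idx d. b i (mon d ij) * e ij)" for i d e
    by (simp_all add: a_def b_def red_def phi_simps phi_con fps_sum_nth mult.commute)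
  \<comment> \<open>With fewer jumps than reduced monomials, some nonzero reduced form would pass
    all of them and reach order M = 2n(q+1) at the three points, too much for degree 3n.\<close>
  have 1: "card (idx (3 * n)) \<le> card J1"
  proof (rule ccontr)
    assume "\<not> card (idx (3 * n)) \<le> card J1"
    then obtain e where e: "\<exists>ij\<in>idx (3 * n). e ij \<noteq> 0"
        "\<forall>i\<in>J1. (\<Sum>ij\<in>idx (3 * n). a i (mon (3 * n) ij) * e ij) = 0"
      using underdetermined_system[OF fin(1) finite_idx, of "3 * n" "\<lambda>ij i. a i (mon (3 * n) ij)"] by auto
    let ?F = "red (3 * n) e"
    have "A i ?F" if "i \<le> 3 * M" for i
      using that
    proof (induction i)
      case (Suc i)
      then have i: "i < 3 * M" and A: "A i ?F" by simp_all
      have "a i ?F = 0"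
        using e(2) homogeneous_red A i unfolding lin[symmetric] J1_def by blast
      then show ?case using A_Suc[OF i] A by blast
    qed (simp add: A_def c0)
    then have *: "vge (phi x ?F) M" if "x \<in> P" for x
      using cM len that by (metis A_def order_refl)
    obtain x where x: "x \<in> P" using card_P by (metis card_eq_0_iff ex_in_conv zero_neq_numeral)
    have "C dvd ?F"
    proof (rule too_many_zeros[OF finite_P P_rpts, of "\<lambda>_. n" _ x])
      show "homogeneous (\<Sum>x\<in>P. n) ?F" using homogeneous_red by (simp add: card_P)
      show "vge (phi x ?F) (n * (q + 1))" if "x \<in> P" for x
        using vge_mono[OF *[OF that]] by (simp add: M)
      show "vge (phi x ?F) (n * (q + 1) + 1)"
        using vge_mono[OF *[OF x]] n0 by (simp add: M)
    qed (rule x)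
    then show False using red_dvd_0 e(1) by blast
  qed
  \<comment> \<open>The same argument for K - D, with the chain read backwards.\<close>
  have 2: "card (idx (q - 2 + 3 * n)) \<le> card J2"
  proof (rule ccontr)
    let ?d = "q - 2 + 3 * n"
    assume "\<not> card (idx ?d) \<le> card J2"
    then obtain e where e: "\<exists>ij\<in>idx ?d. e ij \<noteq> 0"
        "\<forall>i\<in>J2. (\<Sum>ij\<in>idx ?d. b i (mon ?d ij) * e ij) = 0"
      using underdetermined_system[OF fin(2) finite_idx, of ?d "\<lambda>ij i. b i (mon ?d ij)"] by auto
    let ?F = "red ?d e"
    have "B (3 * M - i) ?F" if "i \<le> 3 * M" for i
      using that
    proof (induction i)
      case 0
      then show ?case using cM len by (simp add: B_def)
    next
      case (Suc i)
      define l where "l = 3 * M - Suc i"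
      have l: "3 * M - i = Suc l" "l < 3 * M" using Suc.prems by (simp_all add: l_def)
      have "B (Suc l) ?F" using Suc l by simp
      moreover have "b l ?F = 0"
        using e(2) homogeneous_red \<open>B (Suc l) ?F\<close> l(2) unfolding lin[symmetric] J2_def by blast
      ultimately show ?case using B_Suc[OF l(2)] l_def by blast
    qed
    from this[of "3 * M"] have *: "vge (phi x ?F) M" if "x \<in> P" for x
      using that by (simp add: B_def c0)
    obtain x where x: "x \<in> P" using card_P by (metis card_eq_0_iff ex_in_conv zero_neq_numeral)
    \<comment> \<open>The surplus degree q - 2 is assigned to \<open>x\<close>. Because n >= q, the
      order M still exceeds (n + q - 2)(q + 1) there.\<close>
    define f where "f y = n + (if y = x then q - 2 else 0)" for y
    have sum: "sum f P = ?d"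
      unfolding f_def sum.distrib using x finite_P card_P by simp
    have f: "f y * (q + 1) + 1 \<le> M" for y
    proof -
      have "f y + 1 \<le> 2 * n" using n q_ge_2 by (auto simp: f_def)
      then have "(f y + 1) * (q + 1) \<le> M" unfolding M by (rule mult_right_mono) simp
      then show ?thesis by simp
    qed
    have "C dvd ?F"
    proof (rule too_many_zeros[OF finite_P P_rpts, of f _ x])
      show "homogeneous (sum f P) ?F" using homogeneous_red sum by simp
      show "vge (phi y ?F) (f y * (q + 1))" if "y \<in> P" for y
        using vge_mono[OF *[OF that]] f[of y] by simp
      show "vge (phi x ?F) (f x * (q + 1) + 1)"
        using vge_mono[OF *[OF x]] f[of x] by simp
    qed (rule x)
    then show False using red_dvd_0 e(1) by blast
  qed
  have disj: "J1 \<inter> J2 = {}"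
  proof (rule ccontr)
    assume "J1 \<inter> J2 \<noteq> {}"
    then obtain i F1 F2 where i: "i < 3 * M" and F1: "homogeneous (3 * n) F1" "A i F1" "a i F1 \<noteq> 0"
      and F2: "homogeneous (q - 2 + 3 * n) F2" "B (Suc i) F2" "b i F2 \<noteq> 0"
      by (auto simp: J1_def J2_def)
    define x where "x = ws ! i"
    have il: "i < length ws" using i len by simp
    have x: "x \<in> P" using wsP[OF il] by (simp add: x_def)
    have ci: "c (Suc i) x = Suc (c i x)" using cSuc[OF il, of x] by (simp add: x_def)
    have cM': "Suc (c i x) \<le> M" using cle[OF x, of "Suc i"] ci by simp
    have vx: "vex (phi x (F1 * F2)) (M - 1)"
    proof -
      have "vex (phi x F1) (c i x)" using F1 x by (simp add: vex_def A_def a_def x_def)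
      moreover have "vex (phi x F2) (M - c (Suc i) x)" using F2 x by (simp add: vex_def B_def b_def x_def)
      ultimately have "vex (phi x (F1 * F2)) (c i x + (M - c (Suc i) x))"
        by (simp add: phi_simps vex_mult)
      then show ?thesis using ci cM' by simp
    qed
    have vy: "vge (phi y (F1 * F2)) M" if "y \<in> P" "y \<noteq> x" for y
    proof -
      have "vge (phi y (F1 * F2)) (c i y + (M - c (Suc i) y))"
        using F1(2) F2(2) that(1) by (simp add: A_def B_def phi_simps vge_mult)
      moreover have "c (Suc i) y = c i y" using cSuc[OF il, of y] that by (simp add: x_def)
      ultimately show ?thesis using cle[OF that(1), of i] by simp
    qed
    \<comment> \<open>A common jump would give a product of order exactly M - 1 = (2n-1)(q+1) + q at
      \<open>x\<close> and at least M elsewhere. Its degree exceeds the sum of \<open>f\<close> by q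
      - 1, the situation excluded by \<open>no_simple_pole\<close>.\<close>
    define f where "f y = 2 * n - (if y = x then 1 else 0)" for y
    have "sum f P + 1 = 6 * n"
    proof -
      have "sum f P + (\<Sum>y\<in>P. if y = x then 1 else 0) = (\<Sum>y\<in>P. 2 * n)"
        unfolding sum.distrib[symmetric] f_def using n0 by (intro sum.cong) auto
      then show ?thesis using x finite_P card_P by simp
    qed
    then have deg: "sum f P + (q - 1) = 3 * n + (q - 2 + 3 * n)"
      using q_ge_2 by simp
    have fx: "f x * (q + 1) + q = M - 1"
    proof -
      have "f x + 1 = 2 * n" using n0 by (simp add: f_def)
      then have "(f x + 1) * (q + 1) = M" unfolding M by simp
      then show ?thesis by simp
    qed
    show False
    proof (rule no_simple_pole[OF finite_P P_rpts, of f])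
      show "homogeneous (sum f P + (q - 1)) (F1 * F2)"
        unfolding deg by (rule homogeneous_mult[OF F1(1) F2(1)])
      show vx': "vex (phi x (F1 * F2)) (f x * (q + 1) + q)"
        unfolding fx by (rule vx)
      show "vge (phi y (F1 * F2)) (f y * (q + 1))" if "y \<in> P" for y
      proof (cases "y = x")
        case True
        then show ?thesis
          using vx' vge_mono[of "phi y (F1 * F2)" "f y * (q + 1) + q"] by (simp add: vex_def)
      next
        case False
        then have "f y * (q + 1) = M" by (simp add: f_def M)
        then show ?thesis using vy[OF that False] by (simp only:)
      qed
    qed (rule x)
  qed
  \<comment> \<open>The two dimensions add up to the length 3M of the chain, so every step is a jump
    of exactly one kind.\<close>
  have "2 * (card (idx (3 * n)) + card (idx (q - 2 + 3 * n))) = 2 * (3 * M)"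
  proof -
    have "q \<le> 3 * n" "q \<le> q - 2 + 3 * n" using n by simp_all
    note c = card_idx[OF this(1)] card_idx[OF this(2)]
    have "2 * (card (idx (3 * n)) + card (idx (q - 2 + 3 * n))) + 2 * ((q + 1) * q)
        = (q + 1) * (2 * (3 * n) + 2) + (q + 1) * (2 * (q - 2 + 3 * n) + 2)"
      unfolding c[symmetric] by simp
    also have "\<dots> = (q + 1) * (12 * n + 2 * q)"
      unfolding distrib_left[symmetric] using q_ge_2 by (intro arg_cong2[of _ _ _ _ "(*)"]) simp_all
    also have "\<dots> = 2 * (3 * M) + 2 * ((q + 1) * q)"
      unfolding M by (simp add: algebra_simps)
    finally show ?thesis by (rule add_right_imp_eq)
  qed
  then have "3 * M \<le> card (J1 \<union> J2)"
    using 1 2 card_Un_disjoint[OF fin disj] by simp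
  moreover have sub: "J1 \<union> J2 \<subseteq> {..<3 * M}" by (auto simp: J1_def J2_def)
  ultimately have "J1 \<union> J2 = {..<3 * M}"
    using card_subset_eq[of "{..<3 * M}" "J1 \<union> J2"] card_mono[OF _ sub] by simp
  then have "k \<in> J1 \<union> J2" using k len by simp
  then have "k \<in> J1 \<longleftrightarrow> k \<notin> J2" using disj by auto
  then show ?thesis
    using k len by (simp add: J1_def J2_def A_def B_def a_def b_def c_def)
qed

end

section \<open>Reduction to forms of low degree\<close>

context hermitian_set
begin

text \<open>Any divisor \<open>g\<close> bounded by n(q+1) can be placed on a chain as in
  \<open>duality_chain\<close>. On the side of K - D the n tangents per point divide out again,
  which leaves forms of degree q - 2.\<close>

lemma duality:
  assumes n: "q \<le> n" and g: "\<And>x. x \<in> P \<Longrightarrow> g x \<le> n * (q + 1)" and x0: "x0 \<in> P" "0 < g x0"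
  shows "(\<exists>F. homogeneous (3 * n) F \<and> (\<forall>x\<in>P. vge (phi x F) (n * (q + 1) - g x)) \<and>
        fps_nth (phi x0 F) (n * (q + 1) - g x0) \<noteq> 0)
    \<longleftrightarrow> \<not> (\<exists>F. homogeneous (q - 2) F \<and> (\<forall>x\<in>P. vge (phi x F) (g x - (if x = x0 then 1 else 0))) \<and>
        fps_nth (phi x0 F) (g x0 - 1) \<noteq> 0)"
proof -
  define s where "s = n * (q + 1)"
  define M where "M = 2 * n * (q + 1)"
  have M: "M = 2 * s" by (simp add: M_def s_def)
  define d :: "'k \<times> 'k \<times> 'k \<Rightarrow> nat" where "d x = (if x = x0 then 1 else 0)" for x
  \<comment> \<open>The chain runs through \<open>A\<close> up to the orders s - g, then takes the
    step at \<open>x0\<close> under examination, and \<open>B\<close> completes all multiplicities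
    to M = 2s.\<close>
  obtain A where A: "set A \<subseteq> P" "\<And>x. x \<in> P \<Longrightarrow> count_list A x = s - g x"
    using count_list_exists[OF finite_P, of "\<lambda>x. s - g x"] by blast
  obtain B where B: "set B \<subseteq> P" "\<And>x. x \<in> P \<Longrightarrow> count_list B x = s + g x - d x"
    using count_list_exists[OF finite_P, of "\<lambda>x. s + g x - d x"] by blast
  define ws where "ws = A @ x0 # B"
  have gs: "g x \<le> s" "d x \<le> g x" if "x \<in> P" for x
    using g[OF that] x0 by (auto simp: s_def d_def)
  have ws: "set ws \<subseteq> P" using A B x0 by (simp add: ws_def)
  have cnt: "count_list ws x = M" if "x \<in> P" for x
    using A(2)[OF that] B(2)[OF that] gs[OF that] by (auto simp: ws_def M d_def)
  have t1: "count_list (take (length A) ws) x = s - g x" if "x \<in> P" for x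
    using A(2)[OF that] by (simp add: ws_def)
  have t2: "M - count_list (take (Suc (length A)) ws) x = s + (g x - d x)" if "x \<in> P" for x
    using A(2)[OF that] gs[OF that] by (auto simp: ws_def M d_def)
  have k: "length A < length ws" "ws ! length A = x0" by (simp_all add: ws_def)
  have "(\<exists>F. homogeneous (3 * n) F \<and> (\<forall>x\<in>P. vge (phi x F) (s - g x)) \<and> fps_nth (phi x0 F) (s - g x0) \<noteq> 0)
    \<longleftrightarrow> \<not> (\<exists>F. homogeneous (q - 2 + 3 * n) F \<and> (\<forall>x\<in>P. vge (phi x F) (s + (g x - d x))) \<and>
        fps_nth (phi x0 F) (s + (g x0 - d x0)) \<noteq> 0)"
    using duality_chain[OF n ws cnt M_def k(1)] x0(1) by (simp add: k(2) t1 t2 cong: ball_cong)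
  moreover have "(\<exists>F. homogeneous (q - 2 + 3 * n) F \<and> (\<forall>x\<in>P. vge (phi x F) (s + (g x - d x))) \<and>
        fps_nth (phi x0 F) (s + (g x0 - d x0)) \<noteq> 0)
      \<longleftrightarrow> (\<exists>F. homogeneous (q - 2) F \<and> (\<forall>x\<in>P. vge (phi x F) (g x - d x)) \<and>
        fps_nth (phi x0 F) (g x0 - d x0) \<noteq> 0)" (is "?L \<longleftrightarrow> ?R")
  proof -
    have deg: "(\<Sum>x\<in>P. n) + (q - 2) = q - 2 + 3 * n" by (simp add: card_P)
    have quot: "(\<forall>x\<in>P. vge (phi x F) (s + (g x - d x))) \<and> fps_nth (phi x0 F) (s + (g x0 - d x0)) \<noteq> 0
      \<longleftrightarrow> (\<forall>x\<in>P. vge (phi x F') (g x - d x)) \<and> fps_nth (phi x0 F') (g x0 - d x0) \<noteq> 0"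
      if "C dvd F - tprod P (\<lambda>_. n) * F'" for F F'
      using phi_quotient_order[OF finite_P P_rpts that, folded s_def] x0(1)
      unfolding vex_def by blast
    show ?thesis
    proof
      assume ?L
      then obtain F where F: "homogeneous (q - 2 + 3 * n) F" "\<forall>x\<in>P. vge (phi x F) (s + (g x - d x))"
        "fps_nth (phi x0 F) (s + (g x0 - d x0)) \<noteq> 0" by blast
      have ge: "vge (phi x F) (n * (q + 1))" if "x \<in> P" for x
        using F(2) that vge_mono[of "phi x F" "s + (g x - d x)" s] unfolding s_def by simp
      have "homogeneous ((\<Sum>x\<in>P. n) + (q - 2)) F"
        using F(1) by (simp only: deg)
      from divide_tprod[OF finite_P P_rpts this ge]
      obtain F' where "homogeneous (q - 2) F'" "C dvd F - tprod P (\<lambda>_. n) * F'" by blast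
      then show ?R using quot F by blast
    next
      assume ?R
      then obtain F' where F': "homogeneous (q - 2) F'" "(\<forall>x\<in>P. vge (phi x F') (g x - d x)) \<and>
        fps_nth (phi x0 F') (g x0 - d x0) \<noteq> 0" by blast
      have "homogeneous (q - 2 + 3 * n) (tprod P (\<lambda>_. n) * F')"
        using homogeneous_mult[OF homogeneous_tprod[OF finite_P] F'(1), of "\<lambda>_. n"] unfolding deg .
      then show ?L using quot[of "tprod P (\<lambda>_. n) * F'" F'] F'(2) by auto
    qed
  qed
  moreover have "g x0 - 1 = g x0 - d x0" by (simp add: d_def)
  ultimately show ?thesis by (simp only: s_def d_def)
qed

end

section \<open>Forms with prescribed orders at three points\<close>

context hermitian
begin

definition E :: "nat \<Rightarrow> 'k \<times> 'k \<times> 'k \<Rightarrow> 'k \<times> 'k \<times> 'k \<Rightarrow> 'k \<times> 'k \<times> 'k \<Rightarrow> nat \<Rightarrow> nat \<Rightarrow> nat \<Rightarrow> bool" where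
  "E m p p' p'' a b c \<longleftrightarrow>
     (\<exists>F. homogeneous m F \<and> vex (phi p F) a \<and> vge (phi p' F) b \<and> vge (phi p'' F) c)"

lemma E_swap: "E m p p' p'' a b c \<longleftrightarrow> E m p p'' p' a c b"
  by (auto simp: E_def)

lemma duality_E:
  assumes x: "x0 \<in> rpts" "x1 \<in> rpts" "x2 \<in> rpts" "x0 \<noteq> x1" "x0 \<noteq> x2" "x1 \<noteq> x2"
    and n: "q \<le> n" and abc: "0 < a" "a \<le> n * (q + 1)" "b \<le> n * (q + 1)" "c \<le> n * (q + 1)"
  shows "(\<exists>F. homogeneous (3 * n) F \<and> vex (phi x0 F) (n * (q + 1) - a) \<and>
      vge (phi x1 F) (n * (q + 1) - b) \<and> vge (phi x2 F) (n * (q + 1) - c))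
    \<longleftrightarrow> \<not> E (q - 2) x0 x1 x2 (a - 1) b c"
proof -
  interpret hermitian_set q r K "{x0, x1, x2}"
    by unfold_locales (use x in auto)
  define g where "g x = (if x = x0 then a else if x = x1 then b else c)" for x
  have "x \<in> {x0, x1, x2} \<Longrightarrow> g x \<le> n * (q + 1)" for x
    using abc by (auto simp: g_def)
  moreover have "x0 \<in> {x0, x1, x2}" "0 < g x0"
    using abc by (simp_all add: g_def)
  ultimately show ?thesis
    using duality[OF n, of g x0]
    using x(4-6) abc(1) by (simp add: g_def E_def vex_def conj_ac)
qed

text \<open>The truncated subtraction is correct for lower bounds: at \<open>x\<close> the product
  has order at least q + 1 in any case. For exact orders the condition q + 1 <= n has to be
  added.\<close>

lemma tng_mult_order:
  assumes x: "x \<in> rpts" and T: "T \<in> pts" and e: "phi T F = phi T (tng x) * phi T F'"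
  shows "vge (phi T F) n \<longleftrightarrow> vge (phi T F') (if T = x then n - (q + 1) else n)"
    "vex (phi T F) n \<longleftrightarrow> (T = x \<longrightarrow> q + 1 \<le> n) \<and> vex (phi T F') (if T = x then n - (q + 1) else n)"
proof -
  define k where "k = (if T = x then q + 1 else 0)"
  have v: "vex (phi T (tng x)) k"
    using vex_tng[OF x] vex_tng_other[OF x T] by (auto simp: k_def)
  have v': "vge (phi T (tng x)) k" "fps_nth (phi T (tng x)) k \<noteq> 0"
    using v by (auto simp: vex_def)
  have k: "(if T = x then n - (q + 1) else n) = n - k" "(T = x \<longrightarrow> q + 1 \<le> n) \<longleftrightarrow> k \<le> n"
    by (auto simp: k_def)
  have F: "vge (phi T F) k" unfolding e using v'(1) by (rule vge_mult_left)
  show "vge (phi T F) n \<longleftrightarrow> vge (phi T F') (if T = x then n - (q + 1) else n)"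
    unfolding k(1)
  proof (cases "k \<le> n")
    case True
    then have n: "n = k + (n - k)" by simp
    show "vge (phi T F) n \<longleftrightarrow> vge (phi T F') (n - k)"
      using vge_cancel[OF v', of "phi T F'" "n - k"] vge_mult[OF v'(1), of "phi T F'" "n - k"]
      unfolding n[symmetric] e[symmetric] by blast
  next
    case False
    then show "vge (phi T F) n \<longleftrightarrow> vge (phi T F') (n - k)"
      using vge_mono[OF F, of n] by simp
  qed
  show "vex (phi T F) n \<longleftrightarrow> (T = x \<longrightarrow> q + 1 \<le> n) \<and> vex (phi T F') (if T = x then n - (q + 1) else n)"
    unfolding k
  proof (cases "k \<le> n")
    case True
    then have n: "n = k + (n - k)" by simp
    show "vex (phi T F) n \<longleftrightarrow> k \<le> n \<and> vex (phi T F') (n - k)"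
      using vex_cancel[OF v, of "phi T F'" "n - k"] vex_mult[OF v, of "phi T F'" "n - k"] True
      unfolding n[symmetric] e[symmetric] by blast
  next
    case False
    then show "vex (phi T F) n \<longleftrightarrow> k \<le> n \<and> vex (phi T F') (n - k)"
      using vex_vge[of "phi T F" n k] F by auto
  qed
qed

text \<open>Noether's theorem for a single tangent. Once the other conditions force order q + 1 at
  \<open>x\<close>, the tangent at \<open>x\<close> divides the form modulo \<open>C\<close>; a
  constant cannot have such a zero, so the degree is positive.\<close>

lemma E_divide:
  assumes x: "x \<in> rpts" and pts: "p \<in> pts" "p' \<in> pts" "p'' \<in> pts"
    and ge: "\<And>F. homogeneous m F \<Longrightarrow> vex (phi p F) a \<Longrightarrow> vge (phi p' F) b \<Longrightarrow> vge (phi p'' F) c \<Longrightarrow>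
      vge (phi x F) (q + 1)"
    and a: "p = x \<Longrightarrow> q + 1 \<le> a"
  shows "E m p p' p'' a b c \<longleftrightarrow> 0 < m \<and> E (m - 1) p p' p''
    (if p = x then a - (q + 1) else a) (if p' = x then b - (q + 1) else b) (if p'' = x then c - (q + 1) else c)"
    (is "?L \<longleftrightarrow> ?R")
proof
  assume ?L
  then obtain F where F: "homogeneous m F" "vex (phi p F) a" "vge (phi p' F) b" "vge (phi p'' F) c"
    by (auto simp: E_def)
  have xF: "vge (phi x F) (q + 1)" using ge F by blast
  have m: "m \<noteq> 0"
  proof
    assume "m = 0"
    then obtain e where e: "F = con e" using F(1) homogeneous_0_con by blast
    have "fps_nth (phi x F) 0 = 0" using xF by (simp add: vge_def)
    then have "F = 0" by (simp add: e phi_con con_simps)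
    then show False using F(2) by (simp add: phi_simps vex_def)
  qed
  then have "homogeneous (sum (\<lambda>_. 1) {x} + (m - 1)) F" using F(1) by simp
  then obtain F' where F': "homogeneous (m - 1) F'" "C dvd F - tprod {x} (\<lambda>_. 1) * F'"
    using divide_tprod[of "{x}" "\<lambda>_. 1" "m - 1" F] x xF by auto
  have e: "phi T F = phi T (tng x) * phi T F'" if "T \<in> pts" for T
    using phi_dvd_diff[OF that F'(2)] by (simp add: phi_simps tprod_def)
  show ?R
    unfolding E_def using m F'(1) F(2-4)
      tng_mult_order(2)[OF x pts(1) e[OF pts(1)], of a] tng_mult_order(1)[OF x pts(2) e[OF pts(2)], of b]
      tng_mult_order(1)[OF x pts(3) e[OF pts(3)], of c] by blast
next
  assume R: ?R
  then obtain F' where F': "homogeneous (m - 1) F'" "vex (phi p F') (if p = x then a - (q + 1) else a)"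
      "vge (phi p' F') (if p' = x then b - (q + 1) else b)" "vge (phi p'' F') (if p'' = x then c - (q + 1) else c)"
    unfolding E_def by blast
  have e: "phi T (tng x * F') = phi T (tng x) * phi T F'" for T
    by (simp add: phi_simps)
  have "homogeneous m (tng x * F')"
    using homogeneous_mult[OF homogeneous_tng F'(1), of x] R by simp
  then show ?L
    unfolding E_def using F'(2-4) a
      tng_mult_order(2)[OF x pts(1) e, of a] tng_mult_order(1)[OF x pts(2) e, of b]
      tng_mult_order(1)[OF x pts(3) e, of c] by blast
qed

text \<open>In degree at most q, division by the tangent holds in the polynomial ring itself and not
  only modulo \<open>C\<close>. This is needed in \<open>collinear_not_attained\<close>.\<close>

lemma low_degree_divide:
  assumes p: "p \<in> rpts" and F: "homogeneous m F" "m \<le> q" "vge (phi p F) (m + 1)"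
  shows "\<exists>G. homogeneous (m - 1) G \<and> F = tng p * G"
proof -
  obtain h s where B: "basis3 (tng p) h s" and h: "vex (phi p h) 1" and s: "evk s p \<noteq> 0"
    using tng_basis[OF p] by blast
  obtain G c where G: "homogeneous (m - 1) G" "F = tng p * G + bform m h s c"
    using bform_expansion[OF B F(1)] by blast
  have "c j = 0" if "j \<le> m" for j
    using bform_coeffs_0[OF p h s G(2) F(3)] that F(2) by simp
  then have "bform m h s c = 0" by (simp add: bform_def con_simps)
  then show ?thesis using G by auto
qed

lemma line_through:
  assumes p: "p \<in> rpts" and T: "T \<in> pts" "T \<noteq> p"
  obtains l where "homogeneous 1 l" "vex (phi p l) 1" "evk l T = 0"
proof -
  obtain h s where B: "basis3 (tng p) h s" and h: "vex (phi p h) 1"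
    using tng_basis[OF p] by blast
  let ?l = "con (evk h T) * tng p - con (evk (tng p) T) * h"
  have "evk (tng p) T \<noteq> 0"
    using herm_eq_0[OF p T(1)] T(2) by (auto simp: evk_tng)
  moreover have "fps_nth (phi p (tng p)) i = 0" if "i < q + 1" for i
    using vex_tng[OF p] that by (simp add: vex_def vge_def)
  ultimately have "vex (phi p ?l) 1"
    using h q_ge_2 by (simp add: phi_simps phi_con vex_def vge_def)
  moreover have "homogeneous 1 ?l"
    using B by (intro homogeneous_diff homogeneous_con_mult) (simp_all add: basis3_def)
  moreover have "evk ?l T = 0"
    by (simp add: evk_simps)
  ultimately show thesis using that by blast
qed

end

section \<open>Three rational points: splitting off tangents and easy witnesses\<close>

locale hermitian_triple = hermitian q r K
  for q r and K :: "'k::alg_closed_field itself" +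
  fixes p p' p'' :: "'k \<times> 'k \<times> 'k"
  assumes rpts: "p \<in> rpts" "p' \<in> rpts" "p'' \<in> rpts"
    and distinct: "p \<noteq> p'" "p \<noteq> p''" "p' \<noteq> p''"
begin

lemmas pts = rpts[THEN rpts_pts]

lemma E_reduce_first:
  assumes "q < a"
  shows "E m p p' p'' a b c \<longleftrightarrow> 0 < m \<and> E (m - 1) p p' p'' (a - (q + 1)) b c"
proof -
  have "vge (phi p F) (q + 1)" if "vex (phi p F) a" for F
    using vex_vge[OF that] assms by simp
  then have "E m p p' p'' a b c \<longleftrightarrow> 0 < m \<and> E (m - 1) p p' p'' (if p = p then a - (q + 1) else a)
      (if p' = p then b - (q + 1) else b) (if p'' = p then c - (q + 1) else c)"
    using assms by (intro E_divide[OF rpts(1) pts]) auto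
  then show ?thesis using distinct by simp
qed

text \<open>By \<open>low_degree_order\<close>, an order above the degree is at least q + 1, so a
  tangent splits off. For m < b <= q + 1 the new bound truncates to 0.\<close>

lemma E_reduce_second:
  assumes "m \<le> q" "m < b"
  shows "E m p p' p'' a b c \<longleftrightarrow> 0 < m \<and> E (m - 1) p p' p'' a (b - (q + 1)) c"
proof -
  have "vge (phi p' F) (q + 1)" if "homogeneous m F" "vge (phi p' F) b" for F
    using low_degree_order[OF rpts(2) that(1) assms(1)] vge_mono[OF that(2), of "m + 1"] assms(2) by simp
  then have "E m p p' p'' a b c \<longleftrightarrow> 0 < m \<and> E (m - 1) p p' p'' (if p = p' then a - (q + 1) else a)
      (if p' = p' then b - (q + 1) else b) (if p'' = p' then c - (q + 1) else c)"
    using distinct by (intro E_divide[OF rpts(2) pts]) auto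
  then show ?thesis using distinct by simp
qed

lemma E_reduce_third:
  assumes "m \<le> q" "m < c"
  shows "E m p p' p'' a b c \<longleftrightarrow> 0 < m \<and> E (m - 1) p p' p'' a b (c - (q + 1))"
proof -
  interpret s: hermitian_triple q r K p p'' p'
    by unfold_locales (use rpts distinct in auto)
  show ?thesis
    using s.E_reduce_second[OF assms] E_swap by simp
qed

lemma not_E_between:
  assumes "m \<le> q" "m < a" "a \<le> q"
  shows "\<not> E m p p' p'' a b c"
proof
  assume "E m p p' p'' a b c"
  then obtain F where F: "homogeneous m F" "vex (phi p F) a" by (auto simp: E_def)
  then show False
    using low_degree_order[OF rpts(1) F(1) assms(1)] vex_vge[OF F(2)] assms by simp
qed

text \<open>Two spare degrees pay for the tangents at \<open>p'\<close> and \<open>p''\<close>,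
  whose order q + 1 covers \<open>b\<close> and \<open>c\<close>. A line transversal at
  \<open>p\<close> supplies the order \<open>a\<close>, and further tangents at \<open>p'\<close>
  fill up the degree.\<close>

lemma E_low:
  assumes "a + 2 \<le> m" "m \<le> q" "b \<le> m" "c \<le> m"
  shows "E m p p' p'' a b c"
proof -
  obtain l where l: "homogeneous 1 l" "vex (phi p l) 1"
    using tng_basis[OF rpts(1)] by (metis basis3_def)
  define k where "k = m - a - 2"
  have m: "m = a + (k + 1) + 1" using assms by (simp add: k_def)
  let ?F = "l ^ a * tng p' ^ (k + 1) * tng p''"
  have "homogeneous m ?F"
    unfolding m by (intro homogeneous_mult homogeneous_power1 l homogeneous_tng)
  moreover have "vex (phi p ?F) (a + (k + 1) * 0 + 0)"
    unfolding phi_simps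
    using vex_power[OF l(2), of a] distinct
    by (intro vex_mult vex_power vex_tng_other rpts pts) simp_all
  moreover have "vge (phi p' ?F) m"
    using vge_mono[of "phi p' (tng p')" "q + 1" m] vex_tng[OF rpts(2)] assms(2)
    by (simp add: phi_simps vge_mult_left vge_mult_right vex_def)
  moreover have "vge (phi p'' ?F) m"
    using vge_mono[of "phi p'' (tng p'')" "q + 1" m] vex_tng[OF rpts(3)] assms(2)
    by (simp add: phi_simps vge_mult_right vex_def)
  ultimately show ?thesis
    unfolding E_def using assms vge_mono by auto
qed

text \<open>One spare degree pays for the tangent at \<open>p'\<close>. Taking the transversal line
  through \<open>p''\<close> as well gives order m - 1 there, enough because c < m.\<close>

lemma E_one_below:
  assumes "m \<le> q" "a + 1 = m" "b \<le> m" "c < m"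
  shows "E m p p' p'' a b c"
proof -
  obtain l where l: "homogeneous 1 l" "vex (phi p l) 1" "evk l p'' = 0"
    using line_through[OF rpts(1) pts(3)] distinct by metis
  let ?F = "l ^ a * tng p'"
  have "homogeneous (a + 1) ?F"
    by (intro homogeneous_mult homogeneous_power1 l homogeneous_tng)
  moreover have "vex (phi p ?F) (a + 0)"
    unfolding phi_simps
    using vex_power[OF l(2), of a] distinct
    by (intro vex_mult vex_tng_other rpts pts) simp_all
  moreover have "vge (phi p' ?F) m"
    using vge_mono[of "phi p' (tng p')" "q + 1" m] vex_tng[OF rpts(2)] assms
    by (simp add: phi_simps vge_mult_right vex_def)
  moreover have "vge (phi p'' l) 1"
    using l(3) phi_nth_0[OF pts(3)] by (simp add: vge_def)
  from vge_power[OF this, of a] have "vge (phi p'' ?F) a"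
    by (simp add: phi_simps vge_mult_left)
  ultimately show ?thesis
    unfolding E_def using assms vge_mono[of "phi p'' ?F" a c] vge_mono[of "phi p' ?F" m b] by auto
qed

end

section \<open>The triangle of tangents\<close>

text \<open>Set \<open>u\<close> to zero. On the triangle of tangents this reads off the value of a
  form on one side at the vertex where the side meets \<open>u\<close>.\<close>

lemma dvd_binary_form:
  fixes u w :: "'a::field poly3"
  shows "u dvd (con a * w + con b * u) ^ k * (con x * w + con y * u) - con (a ^ k * x) * w ^ Suc k"
proof -
  let ?A = "con a * w + con b * u" and ?B = "con x * w + con y * u"
  have "?A - con a * w = u * con b" by (simp add: mult.commute)
  with power_diff_sumr2[of ?A k "con a * w"]
  have "u dvd ?A ^ k - (con a * w) ^ k" by (simp only: mult.assoc dvd_triv_left)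
  moreover have "?A ^ k * ?B - con (a ^ k * x) * w ^ Suc k
      = (?A ^ k - (con a * w) ^ k) * ?B + (con a * w) ^ k * (con y * u)"
    by (simp add: con_simps power_mult_distrib algebra_simps)
  ultimately show ?thesis by simp
qed

lemma sum_atMost_two: "(\<Sum>j\<le>Suc k. f j) = (\<Sum>j<k. f j) + f k + f (Suc k)"
  by (simp add: lessThan_Suc_atMost[symmetric])

lemma homogeneous_1_span:
  assumes "basis3 u v w" "homogeneous 1 l"
  obtains a b c where "l = con a * u + con b * v + con c * w"
proof -
  obtain F1 F2 F3 where F: "homogeneous 0 F1" "homogeneous 0 F2" "homogeneous 0 F3"
    "l = u * F1 + v * F2 + w * F3"
    using basis3_decompose[OF assms(1), of 0 l] assms(2) by auto
  then show thesis using homogeneous_0_con that by (metis mult.commute)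
qed

lemma basis3_trans:
  assumes "basis3 u v w" and "homogeneous 1 u'" "homogeneous 1 v'" "homogeneous 1 w'"
    and "u = con a1 * u' + con b1 * v' + con c1 * w'" "v = con a2 * u' + con b2 * v' + con c2 * w'"
      "w = con a3 * u' + con b3 * v' + con c3 * w'"
  shows "basis3 u' v' w'"
  unfolding basis3_def
proof (intro conjI ballI assms)
  fix V :: "'a poly3" assume "V \<in> {var_X, var_Y, var_Z}"
  then obtain a b c where V: "V = con a * u + con b * v + con c * w"
    using assms(1) unfolding basis3_def by blast
  have "V = con (a * a1 + b * a2 + c * a3) * u' + con (a * b1 + b * b2 + c * b3) * v'
      + con (a * c1 + b * c2 + c * c3) * w'"
    unfolding V assms(5-7) by (simp add: con_simps algebra_simps)
  then show "\<exists>a b c. V = con a * u' + con b * v' + con c * w'" by blast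
qed

section \<open>Vectors, determinants and linear forms\<close>

fun cross :: "'a::comm_ring \<times> 'a \<times> 'a \<Rightarrow> 'a \<times> 'a \<times> 'a \<Rightarrow> 'a \<times> 'a \<times> 'a" where
  "cross (a1, a2, a3) (b1, b2, b3) = (a2 * b3 - a3 * b2, a3 * b1 - a1 * b3, a1 * b2 - a2 * b1)"

fun dot :: "'a::comm_ring \<times> 'a \<times> 'a \<Rightarrow> 'a \<times> 'a \<times> 'a \<Rightarrow> 'a" where
  "dot (a1, a2, a3) (b1, b2, b3) = a1 * b1 + a2 * b2 + a3 * b3"

fun scale3 :: "'a::comm_ring \<Rightarrow> 'a \<times> 'a \<times> 'a \<Rightarrow> 'a \<times> 'a \<times> 'a" where
  "scale3 k (a1, a2, a3) = (k * a1, k * a2, k * a3)"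

fun lin :: "'a::field \<times> 'a \<times> 'a \<Rightarrow> 'a poly3" where
  "lin (a, b, c) = con a * var_X + con b * var_Y + con c * var_Z"

definition det3 :: "'a::comm_ring \<times> 'a \<times> 'a \<Rightarrow> 'a \<times> 'a \<times> 'a \<Rightarrow> 'a \<times> 'a \<times> 'a \<Rightarrow> 'a" where
  "det3 u v w = dot u (cross v w)"

lemma dot_cross_self: "dot v (cross v w) = 0" "dot w (cross v w) = (0::'a::comm_ring)"
  by (cases v, cases w, simp add: algebra_simps)+

lemma det3_cycle: "det3 v w u = (det3 u v w :: 'a::comm_ring)"
  by (cases u, cases v, cases w) (simp add: det3_def algebra_simps)

lemma dot_scale3: "dot u (scale3 k v) = k * (dot u v :: 'a::comm_ring)"
  by (cases u, cases v) (simp add: algebra_simps)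

lemma homogeneous_lin: "homogeneous 1 (lin v)"
  by (cases v) (auto intro!: homogeneous_add homogeneous_con_mult homogeneous_vars[unfolded One_nat_def])

text \<open>Cramer's rule; the numbers supplied to \<open>rep\<close> are the cofactors.\<close>

lemma basis3_lin:
  fixes u v w :: "'a::field \<times> 'a \<times> 'a"
  assumes "det3 u v w \<noteq> 0"
  shows "basis3 (lin u) (lin v) (lin w)"
proof -
  obtain u1 u2 u3 where u: "u = (u1, u2, u3)" by (cases u)
  obtain v1 v2 v3 where v: "v = (v1, v2, v3)" by (cases v)
  obtain w1 w2 w3 where w: "w = (w1, w2, w3)" by (cases w)
  define D where "D = det3 u v w"
  have D: "D \<noteq> 0" using assms by (simp add: D_def)
  have D': "D = u1 * (v2 * w3 - v3 * w2) + u2 * (v3 * w1 - v1 * w3) + u3 * (v1 * w2 - v2 * w1)"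
    by (simp add: D_def det3_def u v w)
  have rep: "\<exists>a b c. V = con a * lin u + con b * lin v + con c * lin w"
    if V: "V = con x * var_X + con y * var_Y + con z * var_Z"
      and e: "k1 * u1 + k2 * v1 + k3 * w1 = D * x" "k1 * u2 + k2 * v2 + k3 * w2 = D * y"
        "k1 * u3 + k2 * v3 + k3 * w3 = D * z" for V x y z k1 k2 k3
  proof -
    have "con D * V = con k1 * lin u + con k2 * lin v + con k3 * lin w"
      unfolding V u v w lin.simps distrib_left mult.assoc[symmetric]
      unfolding con_simps(2)[symmetric] e[symmetric]
      by (simp add: con_simps algebra_simps)
    then have "con (inverse D) * (con D * V) = con (inverse D * k1) * lin u + con (inverse D * k2) * lin v
        + con (inverse D * k3) * lin w"
      by (simp add: con_simps algebra_simps)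
    moreover have "con (inverse D) * (con D * V) = V"
      unfolding mult.assoc[symmetric] con_simps(2)[symmetric] using D by (simp add: con_simps)
    ultimately show ?thesis by metis
  qed
  have "\<exists>a b c. var_X = con a * lin u + con b * lin v + con c * lin w"
    by (rule rep[of _ 1 0 0 "v2 * w3 - v3 * w2" "w2 * u3 - w3 * u2" "u2 * v3 - u3 * v2"])
      (simp_all add: con_simps D' algebra_simps)
  moreover have "\<exists>a b c. var_Y = con a * lin u + con b * lin v + con c * lin w"
    by (rule rep[of _ 0 1 0 "v3 * w1 - v1 * w3" "w3 * u1 - w1 * u3" "u3 * v1 - u1 * v3"])
      (simp_all add: con_simps D' algebra_simps)
  moreover have "\<exists>a b c. var_Z = con a * lin u + con b * lin v + con c * lin w"
    by (rule rep[of _ 0 0 1 "v1 * w2 - v2 * w1" "w1 * u2 - w2 * u1" "u1 * v2 - u2 * v1"])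
      (simp_all add: con_simps D' algebra_simps)
  ultimately show ?thesis
    unfolding basis3_def using homogeneous_lin by blast
qed

context hermitian
begin

lemma evk_lin: "evk (lin v) T = dot v T"
  by (cases v, cases T) (simp add: evk_simps)

definition pol :: "'k \<times> 'k \<times> 'k \<Rightarrow> 'k \<times> 'k \<times> 'k" where
  "pol p = (case p of (x, y, z) \<Rightarrow> (x ^ q, - (z ^ q), - (y ^ q)))"

lemma tng_lin: "tng p = lin (pol p)"
  by (cases p) (simp add: tng_def pol_def con_simps)

text \<open>Up to sign, the coefficient vectors of the tangents are permuted q-th powers of the
  coordinates. Hence the tangents are concurrent exactly if the points are collinear.\<close>

lemma det3_pol: "det3 (pol p) (pol p') (pol p'') = - (det3 p p' p'' ^ q)"
  by (cases p, cases p', cases p'')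
    (simp add: det3_def pol_def frob_diff frob_add power_mult_distrib algebra_simps)

text \<open>If the order at \<open>p\<close> is at least the degree minus one, only the last two
  monomials survive on the tangent, and \<open>e\<close> is the obstruction to one more
  order.\<close>

lemma two_coefficients:
  assumes p: "p \<in> rpts" and B: "basis3 (tng p) h s" and h: "vex (phi p h) 1" and s: "evk s p \<noteq> 0"
    and F: "homogeneous (Suc k) F" "Suc k \<le> q" "vge (phi p F) k"
  obtains G e c where "homogeneous k G" "F = tng p * G + con e * (h ^ k * s) + con c * h ^ Suc k"
    "vge (phi p F) (Suc k) \<Longrightarrow> e = 0"
proof -
  obtain G c where G: "homogeneous k G" "F = tng p * G + bform (Suc k) h s c"
    using bform_expansion[OF B F(1)] by auto
  have "c j = 0" if "j < k" for j
    using bform_coeffs_0[OF p h s G(2) F(3)] that F(2) by simp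
  then have "bform (Suc k) h s c = con (c k) * (h ^ k * s) + con (c (Suc k)) * h ^ Suc k"
    unfolding bform_def sum_atMost_two by (simp add: con_simps)
  moreover have "c k = 0" if "vge (phi p F) (Suc k)"
    using bform_coeffs_0[OF p h s G(2) that] F(2) by simp
  ultimately show thesis
    using that[of G "c k" "c (Suc k)"] G by (simp add: add.assoc)
qed

text \<open>As the tangent has order q + 1 at \<open>p\<close>, smaller orders depend only on the
  restriction to it.\<close>

lemma order_mod_tng:
  assumes p: "p \<in> rpts" and dvd: "tng p dvd F - f"
  shows "n \<le> q + 1 \<Longrightarrow> vge (phi p f) n \<Longrightarrow> vge (phi p F) n"
    and "n \<le> q \<Longrightarrow> vex (phi p f) n \<Longrightarrow> vex (phi p F) n"
proof -
  obtain G where "F - f = tng p * G" using dvd by (elim dvdE)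
  then have F: "phi p F = phi p f + phi p (tng p) * phi p G"
    by (metis add.commute diff_add_cancel phi_simps(1,2))
  have g: "vge (phi p (tng p) * phi p G) (q + 1)"
    using vex_tng[OF p] by (simp add: vex_def vge_mult_left)
  show "vge (phi p F) n" if "n \<le> q + 1" "vge (phi p f) n"
    unfolding F using that vge_mono[OF g] by (intro vge_add) auto
  show "vex (phi p F) n" if "n \<le> q" "vex (phi p f) n"
    unfolding F using that g by (simp add: vex_def vge_def)
qed

lemma E_mono: "E m p p' p'' a b c \<Longrightarrow> b' \<le> b \<Longrightarrow> c' \<le> c \<Longrightarrow> E m p p' p'' a b' c'"
  unfolding E_def using vge_mono by blast

text \<open>The tangent at \<open>a\<close> does not pass through \<open>b\<close>, so a line
  through both points is transversal at \<open>a\<close>.\<close>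

lemma basis_line:
  assumes a: "a \<in> rpts" and b: "b \<in> rpts" "b \<noteq> a"
    and l: "homogeneous 1 l" "l \<noteq> 0" "evk l a = 0" "evk l b = 0"
  shows "basis3 (tng a) l (tng b)" "vex (phi a l) 1"
proof -
  have ba: "herm b a \<noteq> 0" "herm a b \<noteq> 0"
    using herm_eq_0[OF a rpts_pts[OF b(1)]] herm_eq_0[OF b(1) rpts_pts[OF a]] b(2) by auto
  have not_mult: "l \<noteq> con k * tng a" for k
  proof
    assume k: "l = con k * tng a"
    then have "k = 0" using l(4) ba by (simp add: evk_simps evk_tng)
    then show False using k l(2) by (simp add: con_simps)
  qed
  then show "vex (phi a l) 1"
    using linear_order[OF a l(1,3)] by blast
  obtain h s where B: "basis3 (tng a) h s" and h: "evk h a = 0" and s: "evk s a \<noteq> 0"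
    using tng_basis[OF a] by metis
  have aa: "evk (tng a) a = 0"
    using herm_self[OF rpts_pts[OF a]] by (simp add: evk_tng)
  obtain x1 y1 z1 where l': "l = con x1 * tng a + con y1 * h + con z1 * s"
    using homogeneous_1_span[OF B l(1)] by blast
  have "z1 = 0"
    using l(3) h s aa by (simp add: l' evk_simps)
  then have l': "l = con x1 * tng a + con y1 * h" by (simp add: l' con_simps)
  have y1: "y1 \<noteq> 0" using not_mult[of x1] l' by (auto simp: con_simps)
  obtain x2 y2 z2 where b': "tng b = con x2 * tng a + con y2 * h + con z2 * s"
    using homogeneous_1_span[OF B homogeneous_tng] by blast
  have "evk (tng b) a = z2 * evk s a"
    using h aa by (simp add: b' evk_simps)
  then have z2: "z2 \<noteq> 0" using ba by (auto simp: evk_tng)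
  have inv: "con (k * inverse c) * (con c * T) = con k * T" if "c \<noteq> 0" for k c :: 'k and T
  proof -
    have "k * inverse c * c = k" using that by simp
    then show ?thesis by (simp only: mult.assoc[symmetric] con_simps(2)[symmetric])
  qed
  have hl: "con y1 * h = l - con x1 * tng a" by (simp add: l')
  have h': "h = con (- (inverse y1 * x1)) * tng a + con (inverse y1) * l + con 0 * tng b"
  proof -
    have "h = con (1 * inverse y1) * (con y1 * h)" using inv[OF y1, of 1] by (simp add: con_simps)
    then show ?thesis unfolding hl by (simp add: con_simps algebra_simps)
  qed
  have sb: "con z2 * s = tng b - con x2 * tng a - con y2 * h" by (simp add: b')
  have s': "s = con (- inverse z2 * x2 + inverse z2 * y2 * (inverse y1 * x1)) * tng a
      + con (- inverse z2 * y2 * inverse y1) * l + con (inverse z2) * tng b"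
  proof -
    have "s = con (1 * inverse z2) * (con z2 * s)" using inv[OF z2, of 1] by (simp add: con_simps)
    also have "\<dots> = con (inverse z2) * (tng b - con x2 * tng a
        - con y2 * (con (- (inverse y1 * x1)) * tng a + con (inverse y1) * l + con 0 * tng b))"
      unfolding sb by (subst h') simp
    finally show ?thesis by (simp add: con_simps algebra_simps)
  qed
  have "tng a = con 1 * tng a + con 0 * l + con 0 * tng b" by (simp add: con_simps)
  from basis3_trans[OF B homogeneous_tng l(1) homogeneous_tng this h' s']
  show "basis3 (tng a) l (tng b)" .
qed

end

section \<open>The invariant of the triple and the lines to the opposite vertices\<close>

context hermitian_triple
begin

definition al :: 'k where "al = herm p p'"
definition be :: 'k where "be = herm p' p''"
definition ga :: 'k where "ga = herm p'' p"

text \<open>The invariant of the triple: a root of unity of order dividing \<open>q + 1\<close>, equal to \<open>1\<close> exactly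
  for collinear points.\<close>

definition sig :: 'k where "sig = - ((al * be * ga) ^ (q - 1))"

lemma nonzero: "al \<noteq> 0" "be \<noteq> 0" "ga \<noteq> 0"
  using herm_eq_0[OF rpts(2) pts(1)] herm_eq_0[OF rpts(3) pts(2)] herm_eq_0[OF rpts(1) pts(3)] distinct
  by (auto simp: al_def be_def ga_def)

lemma evk_tngs:
  "evk (tng p) p = 0" "evk (tng p') p = al" "evk (tng p'') p = ga ^ q"
  "evk (tng p) p' = al ^ q" "evk (tng p') p' = 0" "evk (tng p'') p' = be"
  "evk (tng p) p'' = ga" "evk (tng p') p'' = be ^ q" "evk (tng p'') p'' = 0"
  using herm_conj[OF rpts(1,2)] herm_conj[OF rpts(2,3)] herm_conj[OF rpts(3,1)] herm_self[OF pts(1)]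
    herm_self[OF pts(2)] herm_self[OF pts(3)]
  by (simp_all add: evk_tng al_def be_def ga_def)

text \<open>\<open>sig\<close> is the quotient of N^q by -N for N = \<open>al * be * ga\<close>;
  cleared of denominators, it appears in this form in the comparison at the vertices.\<close>

lemma sig_power_iff: "sig ^ m = 1 \<longleftrightarrow> ((al * be * ga) ^ q) ^ m = (- (al * be * ga)) ^ m"
proof -
  let ?N = "al * be * ga"
  have N: "?N \<noteq> 0" using nonzero by simp
  have "?N ^ (q - 1) * ?N = ?N ^ q"
    using mult_power_q[of ?N] by (simp only: mult.commute)
  then have "(sig * (- ?N)) = ?N ^ q" by (simp add: sig_def)
  then have "(?N ^ q) ^ m = sig ^ m * (- ?N) ^ m" by (metis power_mult_distrib)
  then show ?thesis using N by simp
qed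

text \<open>For noncollinear points, the line joining \<open>p\<close> to the intersection of the
  tangents at \<open>p'\<close> and \<open>p''\<close>. The coefficients are chosen so that it
  vanishes at \<open>p\<close>.\<close>

definition hP :: "'k poly3" where "hP = con (ga ^ q) * tng p' + con (- al) * tng p''"

lemma homogeneous_hP: "homogeneous 1 hP"
  unfolding hP_def by (intro homogeneous_add homogeneous_con_mult homogeneous_tng)

lemma evk_hP: "evk hP p = 0"
  by (simp add: hP_def evk_simps evk_tngs)

lemma cycle: "hermitian_triple q r p' p'' p" "hermitian_triple q r p'' p p'"
  by (unfold_locales; use rpts distinct in auto)+

lemma swap: "hermitian_triple q r p p'' p'"
  by unfold_locales (use rpts distinct in auto)

lemma noncollinear_basis:
  assumes "det3 p p' p'' \<noteq> 0"
  shows "basis3 (tng p) (tng p') (tng p'')"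
  unfolding tng_lin using assms by (intro basis3_lin) (simp add: det3_pol)

lemma noncollinear_basis_hP:
  assumes "det3 p p' p'' \<noteq> 0"
  shows "basis3 (tng p) hP (tng p'')"
proof (rule basis3_trans[OF noncollinear_basis[OF assms] homogeneous_tng homogeneous_hP homogeneous_tng])
  show "tng p = con 1 * tng p + con 0 * hP + con 0 * tng p''"
    "tng p'' = con 0 * tng p + con 0 * hP + con 1 * tng p''"
    by (simp_all add: con_simps)
  have "con (inverse (ga ^ q)) * (con (ga ^ q) * tng p') = tng p'"
    unfolding mult.assoc[symmetric] con_simps(2)[symmetric] using nonzero by (simp add: con_simps)
  moreover have "con i * (con (ga ^ q) * tng p') = con i * hP + con (i * al) * tng p''" for i
    by (simp add: hP_def con_simps algebra_simps)
  ultimately show "tng p' = con 0 * tng p + con (inverse (ga ^ q)) * hP + con (inverse (ga ^ q) * al) * tng p''"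
    by (simp add: con_simps(4))
qed

lemma vertex:
  assumes "det3 p p' p'' \<noteq> 0"
  obtains V where "evk (tng p) V = 1" "evk (tng p') V = 0" "evk (tng p'') V = 0"
proof
  let ?D = "det3 (pol p) (pol p') (pol p'')"
  let ?V = "scale3 (inverse ?D) (cross (pol p') (pol p''))"
  have "?D \<noteq> 0" using assms by (simp add: det3_pol)
  then show "evk (tng p) ?V = 1" "evk (tng p') ?V = 0" "evk (tng p'') ?V = 0"
    unfolding tng_lin evk_lin dot_scale3 dot_cross_self by (simp_all add: det3_def)
qed

text \<open>Where the tangents at \<open>p\<close> and \<open>p''\<close> meet, \<open>hP\<close>
  does not vanish; so it is not the tangent at \<open>p\<close>, and \<open>linear_order\<close>
  applies.\<close>

lemma vex_hP:
  assumes "det3 p p' p'' \<noteq> 0"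
  shows "vex (phi p hP) 1"
proof -
  interpret c: hermitian_triple q r K p' p'' p by (rule cycle)
  obtain V where V: "evk (tng p') V = 1" "evk (tng p'') V = 0" "evk (tng p) V = 0"
    using c.vertex assms by (metis det3_cycle)
  have "hP \<noteq> con a * tng p" for a
  proof
    assume "hP = con a * tng p"
    then have "evk hP V = a * evk (tng p) V" by (simp add: evk_simps)
    then show False using V nonzero by (simp add: hP_def evk_simps)
  qed
  then show ?thesis
    using linear_order[OF rpts(1) homogeneous_hP evk_hP] by blast
qed

end

section \<open>Noncollinear points: gluing forms on the triangle of tangents\<close>

context hermitian_triple
begin

text \<open>Forms on the sides of the triangle of tangents that agree at its vertices extend to the plane.\<close>

lemma triangle:
  assumes "(al ^ q) ^ k * x2 = (- al) ^ k * y1" "(be ^ q) ^ k * x3 = (- be) ^ k * y2"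
    "(ga ^ q) ^ k * x1 = (- ga) ^ k * y3"
  defines "f1 \<equiv> (con (ga ^ q) * tng p' + con (- al) * tng p'') ^ k * (con x1 * tng p' + con y1 * tng p'')"
    and "f2 \<equiv> (con (al ^ q) * tng p'' + con (- be) * tng p) ^ k * (con x2 * tng p'' + con y2 * tng p)"
    and "f3 \<equiv> (con (be ^ q) * tng p + con (- ga) * tng p') ^ k * (con x3 * tng p + con y3 * tng p')"
  shows "\<exists>F. homogeneous (Suc k) F \<and> tng p dvd F - f1 \<and> tng p' dvd F - f2 \<and> tng p'' dvd F - f3"
proof -
  let ?u = "tng p" and ?v = "tng p'" and ?w = "tng p''"
  \<comment> \<open>\<open>mu\<close>, \<open>mv\<close> and \<open>mw\<close> are the monomials
    seen at the vertices; each is common to the two sides meeting there, which is what the three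
    hypotheses express. The form \<open>?F\<close> below is inclusion and exclusion.\<close>
  define mu where "mu = con ((be ^ q) ^ k * x3) * ?u ^ Suc k"
  define mv where "mv = con ((ga ^ q) ^ k * x1) * ?v ^ Suc k"
  define mw where "mw = con ((al ^ q) ^ k * x2) * ?w ^ Suc k"
  have u: "?u dvd f2 - mw" "?u dvd f3 - mv" "?u dvd mu"
    unfolding f2_def f3_def mu_def mv_def mw_def assms(3)
    by (rule dvd_binary_form, subst (1 2) add.commute, rule dvd_binary_form, simp)
  have v: "?v dvd f1 - mw" "?v dvd f3 - mu" "?v dvd mv"
    unfolding f1_def f3_def mu_def mv_def mw_def assms(1)
    by (subst (1 2) add.commute, rule dvd_binary_form, rule dvd_binary_form, simp)
  have w: "?w dvd f1 - mv" "?w dvd f2 - mu" "?w dvd mw"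
    unfolding f1_def f2_def mu_def mv_def mw_def assms(2)
    by (rule dvd_binary_form, subst (1 2) add.commute, rule dvd_binary_form, simp)
  let ?F = "f1 + f2 + f3 - mu - mv - mw"
  have "?F - f1 = (f2 - mw) + (f3 - mv) - mu" "?F - f2 = (f1 - mw) + (f3 - mu) - mv"
    "?F - f3 = (f1 - mv) + (f2 - mu) - mw"
    by simp_all
  then have "?u dvd ?F - f1" "?v dvd ?F - f2" "?w dvd ?F - f3"
    using u v w by (metis dvd_add dvd_diff)+
  moreover have form: "homogeneous (Suc k) (A ^ k * B)" if "homogeneous 1 A" "homogeneous 1 B" for A B :: "'k poly3"
    using homogeneous_mult[OF homogeneous_power1[OF that(1), of k] that(2)] by simp
  have "homogeneous (Suc k) ?F"
    unfolding f1_def f2_def f3_def mu_def mv_def mw_def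
    by (intro homogeneous_add homogeneous_diff homogeneous_con_mult form homogeneous_tng homogeneous_power1)
  ultimately show ?thesis by blast
qed

text \<open>\<open>hP\<close> has order 1 at \<open>p\<close>, so all depends on the linear factor:
  its value at \<open>p\<close> is x al + y ga^q, and if that is zero the factor is a multiple of
  \<open>hP\<close>.\<close>

lemma side_order:
  assumes "det3 p p' p'' \<noteq> 0" and dvd: "tng p dvd F - hP ^ k * (con x * tng p' + con y * tng p'')"
    and k: "Suc k \<le> q"
  shows "vge (phi p F) k"
    and "x * al + y * ga ^ q \<noteq> 0 \<Longrightarrow> vex (phi p F) k"
    and "x * al + y * ga ^ q = 0 \<Longrightarrow> vge (phi p F) (Suc k)"
    and "x * al + y * ga ^ q = 0 \<Longrightarrow> x \<noteq> 0 \<Longrightarrow> vex (phi p F) (Suc k)"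
proof -
  let ?l = "con x * tng p' + con y * tng p''"
  have h: "vex (phi p hP) 1" by (rule vex_hP[OF assms(1)])
  have hk: "vex (phi p hP ^ n) n" for n using vex_power[OF h, of n] by simp
  have l0: "fps_nth (phi p ?l) 0 = x * al + y * ga ^ q"
    using phi_nth_0[OF pts(1)] by (simp add: evk_simps evk_tngs)
  have "vge (phi p (hP ^ k * ?l)) k"
    using hk[of k] by (simp add: phi_simps vex_def vge_mult_left)
  then show "vge (phi p F) k"
    using order_mod_tng(1)[OF rpts(1) dvd] k by simp
  show "vex (phi p F) k" if "x * al + y * ga ^ q \<noteq> 0"
  proof -
    have "vex (phi p ?l) 0" using l0 that by (simp add: vex_def)
    from vex_mult[OF hk[of k] this] have "vex (phi p (hP ^ k * ?l)) k" by (simp add: phi_simps)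
    then show ?thesis using order_mod_tng(2)[OF rpts(1) dvd] k by simp
  qed
  show *: "vge (phi p F) (Suc k)" if "x * al + y * ga ^ q = 0"
  proof -
    have "vge (phi p ?l) 1" using l0 that by (simp add: vge_def)
    then have "vge (phi p hP ^ k * phi p ?l) (k + 1)"
      using hk[of k] by (intro vge_mult) (simp_all add: vex_def)
    then have "vge (phi p (hP ^ k * ?l)) (Suc k)" by (simp add: phi_simps)
    then show ?thesis using order_mod_tng(1)[OF rpts(1) dvd] k by simp
  qed
  show "vex (phi p F) (Suc k)" if "x * al + y * ga ^ q = 0" "x \<noteq> 0"
  proof -
    \<comment> \<open>The ratio to \<open>hP\<close> is determined by the coefficient of
      \<open>tng p'\<close>.\<close>
    define c where "c = x / ga ^ q"
    have c: "x = c * ga ^ q" "y = c * (- al)" "c \<noteq> 0"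
      using that nonzero by (simp_all add: c_def field_simps) (metis add.inverse_unique mult.commute)
    have "?l = con c * hP"
      unfolding hP_def c(1,2) by (simp add: con_simps algebra_simps)
    then have "phi p (hP ^ k * ?l) = fps_const c * phi p hP ^ Suc k"
      by (simp add: phi_simps phi_con mult.left_commute)
    moreover have "vex (fps_const c) 0" using c by (simp add: vex_def)
    ultimately have "vex (phi p (hP ^ k * ?l)) (Suc k)"
      using vex_mult[OF _ hk[of "Suc k"], of "fps_const c" 0] by simp
    then show ?thesis using order_mod_tng(2)[OF rpts(1) dvd] k by simp
  qed
qed

text \<open>Each side carries the k-th power of its line to the opposite vertex times a linear form.
  Orders at the points are then conditions on the linear forms, and gluing is the list of
  compatibilities.\<close>

lemma E_from_triangle:
  assumes nc: "det3 p p' p'' \<noteq> 0" and k: "Suc k \<le> q"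
    and compat: "(al ^ q) ^ k * x2 = (- al) ^ k * y1" "(be ^ q) ^ k * x3 = (- be) ^ k * y2"
      "(ga ^ q) ^ k * x1 = (- ga) ^ k * y3"
    and a: "a = k \<and> x1 * al + y1 * ga ^ q \<noteq> 0 \<or> a = Suc k \<and> x1 * al + y1 * ga ^ q = 0 \<and> x1 \<noteq> 0"
    and b: "x2 * be + y2 * al ^ q = 0"
    and c: "c \<le> k \<or> c = Suc k \<and> x3 * ga + y3 * be ^ q = 0"
  shows "E (Suc k) p p' p'' a (Suc k) c"
proof -
  interpret c1: hermitian_triple q r K p' p'' p by (rule cycle)
  interpret c2: hermitian_triple q r K p'' p p' by (rule cycle)
  have defs: "c1.al = be" "c1.be = ga" "c1.ga = al" "c2.al = ga" "c2.be = al" "c2.ga = be"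
    by (simp_all add: al_def be_def ga_def c1.al_def c1.be_def c1.ga_def c2.al_def c2.be_def c2.ga_def)
  have nc': "det3 p' p'' p \<noteq> 0" "det3 p'' p p' \<noteq> 0"
    using nc by (metis det3_cycle)+
  obtain F where F: "homogeneous (Suc k) F"
    and dvd: "tng p dvd F - hP ^ k * (con x1 * tng p' + con y1 * tng p'')"
      "tng p' dvd F - c1.hP ^ k * (con x2 * tng p'' + con y2 * tng p)"
      "tng p'' dvd F - c2.hP ^ k * (con x3 * tng p + con y3 * tng p')"
    using triangle[OF compat] unfolding hP_def c1.hP_def c2.hP_def defs by blast
  have "vex (phi p F) a"
    using a side_order(2,4)[OF nc dvd(1) k] by blast
  moreover have "vge (phi p' F) (Suc k)"
    using b c1.side_order(3)[OF nc'(1) dvd(2) k] by (simp add: defs)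
  moreover have "vge (phi p'' F) c"
    using c c2.side_order(1,3)[OF nc'(2) dvd(3) k] vge_mono by (auto simp: defs)
  ultimately show ?thesis unfolding E_def using F by blast
qed

lemma power_abc: "(- al) ^ n * (- be) ^ n * (- ga) ^ n = (- (al * be * ga)) ^ n"
  by (simp flip: power_mult_distrib)

lemma power_abc_q: "(al ^ q) ^ n * (be ^ q) ^ n * (ga ^ q) ^ n = ((al * be * ga) ^ q) ^ n"
  by (simp add: power_mult_distrib)

text \<open>Order k + 1 at \<open>p'\<close> and \<open>p''\<close> forces pure powers on those
  sides. The scalars \<open>c2\<close>, \<open>c3\<close> make them agree at their common vertex;
  the other two vertices determine \<open>x1\<close> and \<open>y1\<close>, and the linear form so
  obtained vanishes at \<open>p\<close> precisely if sig^(k+1) = 1.\<close>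

lemma noncollinear_attained:
  assumes nc: "det3 p p' p'' \<noteq> 0" and k: "Suc k \<le> q"
  shows "sig ^ Suc k \<noteq> 1 \<Longrightarrow> E (Suc k) p p' p'' k (Suc k) (Suc k)"
    and "sig ^ Suc k = 1 \<Longrightarrow> E (Suc k) p p' p'' (Suc k) (Suc k) (Suc k)"
proof -
  let ?n = "Suc k"
  define c2 where "c2 = (be ^ q) ^ ?n"
  define c3 where "c3 = (- be) ^ ?n"
  define x1 where "x1 = (- ga) ^ ?n * c3 / (ga ^ q) ^ k"
  define y1 where "y1 = (al ^ q) ^ ?n * c2 / (- al) ^ k"
  have nz: "(ga ^ q) ^ k \<noteq> 0" "(- al) ^ k \<noteq> 0" "x1 \<noteq> 0"
    using nonzero by (simp_all add: x1_def c3_def)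
  have e1: "(al ^ q) ^ k * (c2 * al ^ q) = (- al) ^ k * y1"
    using nz by (simp add: y1_def mult.left_commute)
  have e2: "(be ^ q) ^ k * (c3 * be ^ q) = (- be) ^ k * (c2 * (- be))"
    by (simp add: c2_def c3_def mult_ac)
  have e3: "(ga ^ q) ^ k * x1 = (- ga) ^ k * (c3 * (- ga))"
    using nz by (simp add: x1_def mult.left_commute)
  have b: "c2 * al ^ q * be + c2 * (- be) * al ^ q = 0" "c3 * be ^ q * ga + c3 * (- ga) * be ^ q = 0"
    by simp_all
  have "(x1 * al + y1 * ga ^ q) * ((ga ^ q) ^ k * (- al) ^ k)
      = (x1 * (ga ^ q) ^ k) * (al * (- al) ^ k) + (y1 * (- al) ^ k) * (ga ^ q * (ga ^ q) ^ k)"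
    by (simp add: algebra_simps)
  also have "x1 * (ga ^ q) ^ k = (- ga) ^ ?n * c3" using nz by (simp add: x1_def)
  also have "y1 * (- al) ^ k = (al ^ q) ^ ?n * c2" using nz by (simp add: y1_def)
  also have "(- ga) ^ ?n * c3 * (al * (- al) ^ k) + (al ^ q) ^ ?n * c2 * (ga ^ q * (ga ^ q) ^ k)
      = (al ^ q) ^ ?n * (be ^ q) ^ ?n * (ga ^ q) ^ ?n - (- al) ^ ?n * (- be) ^ ?n * (- ga) ^ ?n"
    unfolding c2_def c3_def by (simp add: algebra_simps)
  also have "\<dots> = ((al * be * ga) ^ q) ^ ?n - (- (al * be * ga)) ^ ?n"
    unfolding power_abc power_abc_q ..
  finally have "x1 * al + y1 * ga ^ q = 0 \<longleftrightarrow> sig ^ ?n = 1"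
    unfolding sig_power_iff using nz by (metis eq_iff_diff_eq_0 mult_eq_0_iff)
  then show "sig ^ ?n \<noteq> 1 \<Longrightarrow> E ?n p p' p'' k ?n ?n" "sig ^ ?n = 1 \<Longrightarrow> E ?n p p' p'' ?n ?n ?n"
    using E_from_triangle[OF nc k e1 e2 e3] b nz(3) by blast+
qed

text \<open>Pure powers at \<open>p\<close> and \<open>p'\<close> have only one common vertex to
  agree on. The side of \<open>p''\<close>, where order k suffices, absorbs the rest.\<close>

lemma noncollinear_top:
  assumes nc: "det3 p p' p'' \<noteq> 0" and k: "Suc k \<le> q"
  shows "E (Suc k) p p' p'' (Suc k) (Suc k) k"
proof -
  let ?n = "Suc k"
  define s where "s = (al ^ q) ^ ?n"
  define c2 where "c2 = (- al) ^ ?n"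
  define x3 where "x3 = (- be) ^ ?n * c2 / (be ^ q) ^ k"
  define y3 where "y3 = (ga ^ q) ^ ?n * s / (- ga) ^ k"
  have e1: "(al ^ q) ^ k * (c2 * al ^ q) = (- al) ^ k * (s * (- al))"
    by (simp add: c2_def s_def mult_ac)
  have e2: "(be ^ q) ^ k * x3 = (- be) ^ k * (c2 * (- be))"
    using nonzero by (simp add: x3_def mult.left_commute)
  have e3: "(ga ^ q) ^ k * (s * ga ^ q) = (- ga) ^ k * y3"
    using nonzero by (simp add: y3_def mult.left_commute)
  have "s * ga ^ q \<noteq> 0" using nonzero by (simp add: s_def)
  then show ?thesis
    by (intro E_from_triangle[OF nc k e1 e2 e3]) simp_all
qed

text \<open>Converse to the gluing: the values of one form at the three vertices link the
  coefficients of the pure powers on the three sides. Eliminating the one at \<open>p'\<close> shows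
  that \<open>e\<close> measures the failure of sig^(k+1) = 1.\<close>

lemma noncollinear_relation:
  assumes nc: "det3 p p' p'' \<noteq> 0" and k: "Suc k \<le> q"
    and F: "homogeneous (Suc k) F" "vge (phi p F) k" "vge (phi p' F) (Suc k)" "vge (phi p'' F) (Suc k)"
  obtains e c c' G where "F = tng p * G + con e * (hP ^ k * tng p'') + con c * hP ^ Suc k"
    "vge (phi p F) (Suc k) \<Longrightarrow> e = 0"
    "e * ((- al) ^ k * (- be) ^ Suc k * (ga ^ q) ^ Suc k)
      = c' * (((al * be * ga) ^ q) ^ Suc k - (- (al * be * ga)) ^ Suc k)"
    "c * (ga ^ q) ^ Suc k = c' * (- ga) ^ Suc k"
proof -
  interpret c1: hermitian_triple q r K p' p'' p by (rule cycle)
  interpret c2: hermitian_triple q r K p'' p p' by (rule cycle)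
  have defs: "c1.al = be" "c1.be = ga" "c1.ga = al" "c2.al = ga" "c2.be = al" "c2.ga = be"
    by (simp_all add: al_def be_def ga_def c1.al_def c1.be_def c1.ga_def c2.al_def c2.be_def c2.ga_def)
  have nc': "det3 p' p'' p \<noteq> 0" "det3 p'' p p' \<noteq> 0"
    using nc by (metis det3_cycle)+
  let ?u = "tng p" and ?v = "tng p'" and ?w = "tng p''" and ?n = "Suc k"
  have vg: "vge (phi x F) k" if "vge (phi x F) ?n" for x using vge_mono[OF that] by simp
  obtain G e c where 1: "F = ?u * G + con e * (hP ^ k * ?w) + con c * hP ^ ?n"
      "vge (phi p F) ?n \<Longrightarrow> e = 0"
    using two_coefficients[OF rpts(1) noncollinear_basis_hP[OF nc] vex_hP[OF nc] _ F(1) k F(2)]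
      evk_tngs nonzero by (metis power_not_zero)
  obtain G1 d1 d where 2: "F = ?v * G1 + con d1 * (c1.hP ^ k * ?u) + con d * c1.hP ^ ?n"
      "vge (phi p' F) ?n \<Longrightarrow> d1 = 0"
    using two_coefficients[OF rpts(2) c1.noncollinear_basis_hP[OF nc'(1)] c1.vex_hP[OF nc'(1)] _ F(1) k vg[OF F(3)]]
      evk_tngs nonzero by (metis power_not_zero)
  obtain G2 d2 c' where 3: "F = ?w * G2 + con d2 * (c2.hP ^ k * ?v) + con c' * c2.hP ^ ?n"
      "vge (phi p'' F) ?n \<Longrightarrow> d2 = 0"
    using two_coefficients[OF rpts(3) c2.noncollinear_basis_hP[OF nc'(2)] c2.vex_hP[OF nc'(2)] _ F(1) k vg[OF F(4)]]
      evk_tngs nonzero by (metis power_not_zero)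
  have d: "d1 = 0" "d2 = 0" using 2(2) 3(2) F by auto
  obtain V1 where V1: "evk ?u V1 = 1" "evk ?v V1 = 0" "evk ?w V1 = 0"
    using vertex[OF nc] by blast
  obtain V2 where V2: "evk ?v V2 = 1" "evk ?w V2 = 0" "evk ?u V2 = 0"
    using c1.vertex[OF nc'(1)] by blast
  obtain V3 where V3: "evk ?w V3 = 1" "evk ?u V3 = 0" "evk ?v V3 = 0"
    using c2.vertex[OF nc'(2)] by blast
  have "evk F V2 = c * (ga ^ q) ^ ?n" unfolding 1(1) by (simp add: evk_simps V2 hP_def)
  moreover have "evk F V2 = c' * (- ga) ^ ?n" unfolding 3(1) by (simp add: evk_simps V2 c2.hP_def d defs)
  ultimately have r1: "c * (ga ^ q) ^ ?n = c' * (- ga) ^ ?n" by simp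
  have "evk F V3 = e * (- al) ^ k + c * (- al) ^ ?n" unfolding 1(1) by (simp add: evk_simps V3 hP_def)
  moreover have "evk F V3 = d * (al ^ q) ^ ?n" unfolding 2(1) by (simp add: evk_simps V3 c1.hP_def d defs)
  ultimately have r2: "e * (- al) ^ k = d * (al ^ q) ^ ?n - c * (- al) ^ ?n" by (simp add: algebra_simps)
  have "evk F V1 = d * (- be) ^ ?n" unfolding 2(1) by (simp add: evk_simps V1 c1.hP_def d defs)
  moreover have "evk F V1 = c' * (be ^ q) ^ ?n" unfolding 3(1) by (simp add: evk_simps V1 c2.hP_def d defs)
  ultimately have r3: "d * (- be) ^ ?n = c' * (be ^ q) ^ ?n" by simp
  have "e * ((- al) ^ k * (- be) ^ ?n * (ga ^ q) ^ ?n)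
      = (e * (- al) ^ k) * (- be) ^ ?n * (ga ^ q) ^ ?n" by (simp only: mult.assoc)
  also have "\<dots> = (d * (- be) ^ ?n) * (al ^ q) ^ ?n * (ga ^ q) ^ ?n
      - (c * (ga ^ q) ^ ?n) * (- al) ^ ?n * (- be) ^ ?n"
    unfolding r2 by (simp only: left_diff_distrib right_diff_distrib mult_ac)
  also have "\<dots> = c' * ((al ^ q) ^ ?n * (be ^ q) ^ ?n * (ga ^ q) ^ ?n - (- al) ^ ?n * (- be) ^ ?n * (- ga) ^ ?n)"
    unfolding r1 r3 by (simp only: right_diff_distrib mult_ac)
  finally show thesis
    using that[OF 1] r1 unfolding power_abc power_abc_q by blast
qed

text \<open>If sig^(k+1) = 1, the relation gives e = 0 and the order at \<open>p\<close> rises to k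
  + 1. If not, order k + 1 gives e = 0, hence all pure powers vanish, the tangent divides the form
  and the order is at least q + 1.\<close>

lemma noncollinear_not_attained:
  assumes nc: "det3 p p' p'' \<noteq> 0" and k: "Suc k \<le> q"
  shows "sig ^ Suc k = 1 \<Longrightarrow> \<not> E (Suc k) p p' p'' k (Suc k) (Suc k)"
    and "sig ^ Suc k \<noteq> 1 \<Longrightarrow> \<not> E (Suc k) p p' p'' (Suc k) (Suc k) (Suc k)"
proof -
  have nz: "(- al) ^ k * (- be) ^ Suc k * (ga ^ q) ^ Suc k \<noteq> 0"
    using nonzero by simp
  have hn: "vge (phi p (tng p * G + con c * hP ^ Suc k)) (Suc k)" for G c
  proof (rule order_mod_tng(1)[OF rpts(1)])
    show "tng p dvd tng p * G + con c * hP ^ Suc k - con c * hP ^ Suc k" by simp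
    have "vge (phi p hP) 1" using vex_hP[OF nc] by (simp add: vex_def)
    from vge_power[OF this, of "Suc k"] show "vge (phi p (con c * hP ^ Suc k)) (Suc k)"
      by (simp add: phi_simps vge_mult_right del: power_Suc)
  qed (use k in simp)
  show "\<not> E (Suc k) p p' p'' k (Suc k) (Suc k)" if sig: "sig ^ Suc k = 1"
  proof
    assume "E (Suc k) p p' p'' k (Suc k) (Suc k)"
    then obtain F where F: "homogeneous (Suc k) F" "vex (phi p F) k" "vge (phi p' F) (Suc k)" "vge (phi p'' F) (Suc k)"
      unfolding E_def by blast
    have vk: "vge (phi p F) k" using F(2) by (simp add: vex_def)
    obtain e c c' G where 1: "F = tng p * G + con e * (hP ^ k * tng p'') + con c * hP ^ Suc k"
      "e * ((- al) ^ k * (- be) ^ Suc k * (ga ^ q) ^ Suc k)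
      = c' * (((al * be * ga) ^ q) ^ Suc k - (- (al * be * ga)) ^ Suc k)"
      using noncollinear_relation[OF nc k F(1) vk F(3,4)] by metis
    have "e * ((- al) ^ k * (- be) ^ Suc k * (ga ^ q) ^ Suc k) = 0"
      using 1(2) sig unfolding sig_power_iff by simp
    then have "e = 0" using nz by (simp only: mult_eq_0_iff) blast
    then have "F = tng p * G + con c * hP ^ Suc k" using 1(1) by (simp add: con_simps)
    with hn have "vge (phi p F) (Suc k)" by simp
    then show False using vex_vge[OF F(2)] by simp
  qed
  show "\<not> E (Suc k) p p' p'' (Suc k) (Suc k) (Suc k)" if sig: "sig ^ Suc k \<noteq> 1"
  proof
    assume "E (Suc k) p p' p'' (Suc k) (Suc k) (Suc k)"
    then obtain F where F: "homogeneous (Suc k) F" "vex (phi p F) (Suc k)" "vge (phi p' F) (Suc k)" "vge (phi p'' F) (Suc k)"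
      unfolding E_def by blast
    have vn: "vge (phi p F) (Suc k)" using F(2) by (simp add: vex_def)
    have vk: "vge (phi p F) k" using vge_mono[OF vn, of k] by simp
    obtain e c c' G where 1: "F = tng p * G + con e * (hP ^ k * tng p'') + con c * hP ^ Suc k"
      "vge (phi p F) (Suc k) \<Longrightarrow> e = 0"
      "e * ((- al) ^ k * (- be) ^ Suc k * (ga ^ q) ^ Suc k)
      = c' * (((al * be * ga) ^ q) ^ Suc k - (- (al * be * ga)) ^ Suc k)"
      "c * (ga ^ q) ^ Suc k = c' * (- ga) ^ Suc k"
      using noncollinear_relation[OF nc k F(1) vk F(3,4)] by metis
    have e: "e = 0" using 1(2) vn by blast
    then have "c' * (((al * be * ga) ^ q) ^ Suc k - (- (al * be * ga)) ^ Suc k) = 0"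
      using 1(3) by simp
    then have "c' = 0" using sig unfolding sig_power_iff by (simp only: mult_eq_0_iff right_minus_eq) blast
    then have "c = 0" using 1(4) nonzero by simp
    then have "F = tng p * G" using 1(1) e by (simp add: con_simps)
    then have "vge (phi p F) (q + 1)"
      using vex_tng[OF rpts(1)] by (simp add: phi_simps vex_def vge_mult_left)
    then show False using vex_vge[OF F(2)] k by simp
  qed
qed

end

section \<open>Semigroups in terms of low degree forms\<close>

text \<open>Multiplicativity of the determinant for a Gram matrix, expanded along its first
  row.\<close>

lemma det3_gram:
  fixes u v w x y z :: "'a::comm_ring_1 \<times> 'a \<times> 'a"
  shows "dot u x * (dot v y * dot w z - dot v z * dot w y) - dot u y * (dot v x * dot w z - dot v z * dot w x)
    + dot u z * (dot v x * dot w y - dot v y * dot w x) = det3 u v w * det3 x y z"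
  by (cases u, cases v, cases w, cases x, cases y, cases z) (simp add: det3_def algebra_simps)

lemma dot_cross_cross:
  "dot (cross a b) (cross c d) = dot a c * dot b d - dot a d * (dot b c :: 'a::comm_ring_1)"
  by (cases a, cases b, cases c, cases d) (simp add: algebra_simps)

lemma dot_commute: "dot a b = dot b (a :: 'a::comm_ring \<times> 'a \<times> 'a)"
  by (cases a, cases b) (simp add: algebra_simps)

context hermitian
begin

definition sig3 :: "'k \<times> 'k \<times> 'k \<Rightarrow> 'k \<times> 'k \<times> 'k \<Rightarrow> 'k \<times> 'k \<times> 'k \<Rightarrow> 'k" where
  "sig3 p p' p'' = - ((herm p p' * herm p' p'' * herm p'' p) ^ (q - 1))"

lemma sig3_cycle: "sig3 p' p'' p = sig3 p p' p''"
  by (simp add: sig3_def mult_ac)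

end

section \<open>Collinear points\<close>

context hermitian_triple
begin

lemma sig_sig3: "sig = sig3 p p' p''"
  by (simp add: sig_def sig3_def al_def be_def ga_def)

lemmas dots = evk_tngs[unfolded tng_lin evk_lin]

text \<open>The Gram matrix of the points under \<open>herm\<close> has zero diagonal and
  determinant N + N^q, where N is the cyclic product; collinearity makes it singular.\<close>

lemma collinear_sig:
  assumes "det3 p p' p'' = 0"
  shows "sig = 1"
proof -
  let ?N = "al * be * ga"
  have "?N ^ q + ?N = 0"
    using det3_gram[of "pol p" p "pol p'" p' "pol p''" p''] assms
    by (simp add: dots power_mult_distrib algebra_simps)
  then have "?N ^ (q - 1) * ?N = - 1 * ?N"
    using mult_power_q[of ?N] by (metis add_eq_0_iff2 mult.commute mult_minus1)
  moreover have "?N \<noteq> 0" using nonzero by simp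
  ultimately have "?N ^ (q - 1) = - 1" using mult_right_cancel by blast
  then show ?thesis by (simp add: sig_def)
qed

text \<open>\<open>V\<close> is the pole of the common line: the three tangents pass through it. It
  does not lie on the line, because the value there is -al^(q+1).\<close>

lemma collinear_line:
  assumes "det3 p p' p'' = 0"
  obtains l V where "homogeneous 1 l" "evk l p = 0" "evk l p' = 0" "evk l p'' = 0" "l \<noteq> 0"
    "evk (tng p) V = 0" "evk (tng p') V = 0" "evk (tng p'') V = 0" "evk l V \<noteq> 0"
proof
  let ?l = "lin (cross p p')" and ?V = "cross (pol p) (pol p')"
  show "homogeneous 1 ?l" by (rule homogeneous_lin)
  show "evk ?l p = 0" "evk ?l p' = 0"
    unfolding evk_lin by (subst dot_commute, rule dot_cross_self)+
  show "evk ?l p'' = 0"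
    unfolding evk_lin using assms det3_cycle[of p p' p''] det3_cycle[of p' p'' p]
    by (subst dot_commute) (simp add: det3_def)
  show "evk (tng p) ?V = 0" "evk (tng p') ?V = 0"
    unfolding tng_lin evk_lin by (rule dot_cross_self)+
  have "det3 (pol p'') (pol p) (pol p') = 0"
    using assms det3_cycle[of "pol p" "pol p'" "pol p''"] det3_cycle[of "pol p'" "pol p''" "pol p"] frob_0
    by (simp add: det3_pol)
  then show "evk (tng p'') ?V = 0"
    unfolding tng_lin evk_lin by (simp add: det3_def)
  have "evk ?l ?V = - (al ^ q * al)"
    unfolding evk_lin dot_cross_cross
    by (simp add: dots dot_commute[of p "pol p"] dot_commute[of p "pol p'"] dot_commute[of p' "pol p"])
  then show "evk ?l ?V \<noteq> 0" using nonzero by simp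
  then show "?l \<noteq> 0" by (auto simp: evk_simps)
qed

lemma collinear_attained:
  assumes "det3 p p' p'' = 0"
  shows "E m p p' p'' m m m"
proof -
  obtain l where l: "homogeneous 1 l" "evk l p = 0" "evk l p' = 0" "evk l p'' = 0" "l \<noteq> 0"
    using collinear_line[OF assms] by metis
  have "vex (phi p l) 1"
    using basis_line(2)[OF rpts(1,2) _ l(1,5,2,3)] distinct by metis
  then have "vex (phi p (l ^ m)) m"
    using vex_power[of "phi p l" 1 m] by (simp add: phi_simps)
  moreover have "vge (phi x (l ^ m)) m" if "x \<in> pts" "evk l x = 0" for x
    using vge_power[of "phi x l" 1 m] phi_nth_0[OF that(1), of l] that(2)
    by (simp add: phi_simps vge_def)
  ultimately show ?thesis
    unfolding E_def using homogeneous_power1[OF l(1)] pts l by blast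
qed

lemma vge_unit_cancel:
  assumes "x \<in> rpts" "y \<in> pts" "y \<noteq> x" "vge (phi y (tng x * G)) n"
  shows "vge (phi y G) n"
  using assms(4) vge_cancel[of "phi y (tng x)" 0 "phi y G" n] vex_tng_other[OF assms(1-3)]
  by (simp add: phi_simps vex_def)

text \<open>All tangents pass through \<open>V\<close>, so evaluation at \<open>V\<close> shows that
  the coefficient of l^(k+1) is the same for the three expansions. The rest is divisible by the
  tangents at \<open>p'\<close> and \<open>p''\<close>; comparison with the expansion at
  \<open>p\<close> and evaluation at \<open>V\<close> then kill the coefficient \<open>e\<close> of
  order k.\<close>

lemma collinear_not_attained:
  assumes det: "det3 p p' p'' = 0" and k: "Suc k \<le> q"
  shows "\<not> E (Suc k) p p' p'' k (Suc k) (Suc k)"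
proof
  let ?u = "tng p" and ?v = "tng p'" and ?w = "tng p''"
  assume "E (Suc k) p p' p'' k (Suc k) (Suc k)"
  then obtain F where F: "homogeneous (Suc k) F" "vex (phi p F) k" "vge (phi p' F) (Suc k)" "vge (phi p'' F) (Suc k)"
    unfolding E_def by blast
  have Fk: "vge (phi p F) k" "vge (phi p' F) k" "vge (phi p'' F) k"
    using F vge_mono[of _ "Suc k" k] by (auto simp: vex_def)
  obtain l V where l: "homogeneous 1 l" "evk l p = 0" "evk l p' = 0" "evk l p'' = 0" "l \<noteq> 0"
    and V: "evk ?u V = 0" "evk ?v V = 0" "evk ?w V = 0" "evk l V \<noteq> 0"
    using collinear_line[OF det] by metis
  note B1 = basis_line[OF rpts(1,2) distinct(1)[symmetric] l(1,5,2,3)]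
    and B2 = basis_line[OF rpts(2,1) distinct(1) l(1,5,3,2)]
    and B3 = basis_line[OF rpts(3,2) distinct(3) l(1,5,4,3)]
  obtain G e c where G: "homogeneous k G" "F = ?u * G + con e * (l ^ k * ?v) + con c * l ^ Suc k"
    by (rule two_coefficients[OF rpts(1) B1 _ F(1) k Fk(1)]) (simp_all add: evk_tngs nonzero)
  obtain G1 e1 c1 where G1: "homogeneous k G1" "F = ?v * G1 + con e1 * (l ^ k * ?u) + con c1 * l ^ Suc k"
      "vge (phi p' F) (Suc k) \<Longrightarrow> e1 = 0"
    by (rule two_coefficients[OF rpts(2) B2 _ F(1) k Fk(2)]) (simp_all add: evk_tngs nonzero)
  obtain G2 e2 c2 where G2: "homogeneous k G2" "F = ?w * G2 + con e2 * (l ^ k * ?v) + con c2 * l ^ Suc k"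
      "vge (phi p'' F) (Suc k) \<Longrightarrow> e2 = 0"
    by (rule two_coefficients[OF rpts(3) B3 _ F(1) k Fk(3)]) (simp_all add: evk_tngs nonzero)
  have e12: "e1 = 0" "e2 = 0" using G1(3) G2(3) F by blast+
  have "evk F V = c * evk l V ^ Suc k" "evk F V = c1 * evk l V ^ Suc k" "evk F V = c2 * evk l V ^ Suc k"
    by (subst G(2) G1(2) G2(2); simp add: evk_simps V e12)+
  then have c: "c1 = c" "c2 = c"
    using V(4) by (metis mult_right_cancel power_not_zero)+
  have F1: "F = ?v * G1 + con c * l ^ Suc k" using G1(2) e12 c by (simp add: con_simps)
  have F2: "F = ?w * G2 + con c * l ^ Suc k" using G2(2) e12 c by (simp add: con_simps)
  have vw: "?w * G2 = ?v * G1" using F1 F2 by simp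
  have "vge (phi p' (?w * G2)) (q + 1)"
    unfolding vw using vex_tng[OF rpts(2)] by (simp add: phi_simps vex_def vge_mult_left)
  then have "vge (phi p' G2) (q + 1)"
    using vge_unit_cancel[OF rpts(3) pts(2)] distinct by blast
  then have "vge (phi p' G2) (k + 1)" using vge_mono[of _ "q + 1" "k + 1"] k by simp
  then obtain G3 where G3: "G2 = ?v * G3"
    using low_degree_divide[OF rpts(2) G2(1)] k by auto
  have v0: "?v \<noteq> 0" using evk_tngs(2) nonzero by (auto simp: evk_simps)
  have "?v * (?w * G3) = ?v * G1" using vw unfolding G3 by (simp add: mult.left_commute)
  then have G1': "G1 = ?w * G3" using v0 by simp
  \<comment> \<open>What remains of \<open>F - con c * l ^ Suc k - con e * (l ^ k * ?v)\<close>
    after division by \<open>?v\<close>. It is also a multiple of \<open>?u\<close>, hence zero at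
    \<open>V\<close>, and so is \<open>G1\<close> by its factor \<open>?w\<close>; only
    \<open>e\<close> times a power of \<open>l\<close> is left.\<close>
  let ?H = "G1 - con e * l ^ k"
  have "?v * ?H = ?u * G" using F1 G(2) by (simp add: algebra_simps)
  moreover have "vge (phi p (?u * G)) (q + 1)"
    using vex_tng[OF rpts(1)] by (simp add: phi_simps vex_def vge_mult_left)
  ultimately have "vge (phi p ?H) (q + 1)"
    using vge_unit_cancel[OF rpts(2) pts(1) distinct(1)] by metis
  then have "vge (phi p ?H) (k + 1)" using vge_mono[of _ "q + 1" "k + 1"] k by simp
  moreover have "homogeneous k ?H"
    by (intro homogeneous_diff homogeneous_con_mult homogeneous_power1 l G1(1))
  ultimately obtain G4 where G4: "?H = ?u * G4"
    using low_degree_divide[OF rpts(1), of k ?H] k by auto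
  have "evk ?H V = 0" unfolding G4 by (simp add: evk_simps V)
  then have "e * evk l V ^ k = 0" unfolding G1' by (simp add: evk_simps V)
  then have "e = 0" using V(4) by simp
  then have "F = ?u * G + con c * l ^ Suc k" using G(2) by (simp add: con_simps)
  then have "?u dvd F - con c * l ^ Suc k" by simp
  moreover have "vge (phi p (con c * l ^ Suc k)) (Suc k)"
    using vex_power[OF B1(2), of "Suc k"] by (simp add: phi_simps vex_def vge_mult_right del: power_Suc)
  ultimately have "vge (phi p F) (Suc k)"
    using order_mod_tng(1)[OF rpts(1)] k by simp
  then show False using vex_vge[OF F(2)] by simp
qed

section \<open>The general criterion for orders up to the degree\<close>

lemma E_top:
  assumes "Suc k \<le> q"
  shows "E (Suc k) p p' p'' (Suc k) (Suc k) k"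
proof (cases "det3 p p' p'' = 0")
  case True
  then show ?thesis using E_mono[OF collinear_attained[OF True]] by simp
next
  case False
  then show ?thesis using noncollinear_top assms by blast
qed

lemma E_diagonal:
  assumes "Suc k \<le> q"
  shows "E (Suc k) p p' p'' k (Suc k) (Suc k) \<longleftrightarrow> sig ^ Suc k \<noteq> 1"
    "E (Suc k) p p' p'' (Suc k) (Suc k) (Suc k) \<longleftrightarrow> sig ^ Suc k = 1"
proof (atomize (full), cases "det3 p p' p'' = 0")
  case True
  then show "(E (Suc k) p p' p'' k (Suc k) (Suc k) \<longleftrightarrow> sig ^ Suc k \<noteq> 1) \<and>
    (E (Suc k) p p' p'' (Suc k) (Suc k) (Suc k) \<longleftrightarrow> sig ^ Suc k = 1)"
    using collinear_sig[OF True] collinear_attained[OF True] collinear_not_attained[OF True assms] by simp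
next
  case False
  then show "(E (Suc k) p p' p'' k (Suc k) (Suc k) \<longleftrightarrow> sig ^ Suc k \<noteq> 1) \<and>
    (E (Suc k) p p' p'' (Suc k) (Suc k) (Suc k) \<longleftrightarrow> sig ^ Suc k = 1)"
    using noncollinear_attained[OF False assms] noncollinear_not_attained[OF False assms] by blast
qed

text \<open>With at least two degrees to spare at \<open>p\<close>, or with one of the other bounds
  below m, an explicit witness exists. Only the two corner cases feel the invariant.\<close>

lemma E_iff:
  assumes m: "m \<le> q" and abc: "a \<le> m" "b \<le> m" "c \<le> m"
  shows "E m p p' p'' a b c \<longleftrightarrow>
    \<not> (a + 1 = m \<and> b = m \<and> c = m \<and> sig ^ m = 1) \<and> \<not> (a = m \<and> b = m \<and> c = m \<and> sig ^ m \<noteq> 1)"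
proof (cases m)
  case 0
  have "homogeneous 0 1" "vex (phi p 1) 0" by (simp_all add: homogeneous_1 phi_simps vex_def)
  then show ?thesis using abc 0 by (auto simp: E_def intro!: exI[of _ 1])
next
  case (Suc k)
  interpret s: hermitian_triple q r K p p'' p' by (rule swap)
  have k: "Suc k \<le> q" using m Suc by simp
  consider "a + 2 \<le> m" | "a = k" "b = m" "c = m" | "a = k" "c < m" | "a = k" "b < m"
    | "a = m" "b = m" "c = m" | "a = m" "c < m" | "a = m" "b < m"
    using abc Suc by linarith
  then show ?thesis
  proof cases
    case 1
    then show ?thesis using E_low[OF 1 m] abc by simp
  next
    case 2
    then show ?thesis using E_diagonal(1)[OF k] Suc by simp
  next
    case 3
    then show ?thesis using E_one_below[OF m, of a b c] abc Suc by simp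
  next
    case 4
    then show ?thesis using s.E_one_below[OF m, of a c b] abc Suc by (simp add: E_swap[of _ p p' p''])
  next
    case 5
    then show ?thesis using E_diagonal(2)[OF k] Suc by simp
  next
    case 6
    then show ?thesis using E_mono[OF E_top[OF k], of b c] abc Suc by simp
  next
    case 7
    then show ?thesis using E_mono[OF s.E_top[OF k], of c b] abc Suc by (simp add: E_swap[of _ p p' p''])
  qed
qed

lemma E_shift_first: "E (m + s) p p' p'' (a + (q + 1) * s) b c \<longleftrightarrow> E m p p' p'' a b c"
proof (induction s)
  case (Suc s)
  have "E (m + Suc s) p p' p'' (a + (q + 1) * Suc s) b c \<longleftrightarrow> E (m + s) p p' p'' (a + (q + 1) * s) b c"
    by (subst E_reduce_first) (simp_all add: algebra_simps)
  then show ?case using Suc.IH by simp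
qed simp

lemma E_shift_second: "m + s \<le> q \<Longrightarrow> E (m + s) p p' p'' a (b + (q + 1) * s) c \<longleftrightarrow> E m p p' p'' a b c"
proof (induction s)
  case (Suc s)
  have "E (m + Suc s) p p' p'' a (b + (q + 1) * Suc s) c \<longleftrightarrow> E (m + s) p p' p'' a (b + (q + 1) * s) c"
    using Suc.prems by (subst E_reduce_second) (simp_all add: algebra_simps)
  then show ?case using Suc by simp
qed simp

lemma E_shift_third: "m + s \<le> q \<Longrightarrow> E (m + s) p p' p'' a b (c + (q + 1) * s) \<longleftrightarrow> E m p p' p'' a b c"
proof -
  interpret s: hermitian_triple q r K p p'' p' by (rule swap)
  show "m + s \<le> q \<Longrightarrow> E (m + s) p p' p'' a b (c + (q + 1) * s) \<longleftrightarrow> E m p p' p'' a b c"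
    using s.E_shift_second by (simp add: E_swap[of _ p p' p''])
qed

end

section \<open>How the semigroup depends on the invariant\<close>

context hermitian
begin

text \<open>Orders above the degree are reduced by tangents or impossible, and both happen
  independently of the triple. Orders up to the degree are decided by \<open>E_iff\<close>; the case
  m = 0 imposes nothing on the invariant.\<close>

lemma E_cong:
  assumes t: "hermitian_triple q r p p' p''" "hermitian_triple q r t t' t''"
    and sig: "\<And>k. 1 \<le> k \<Longrightarrow> k \<le> q - 2 \<Longrightarrow> sig3 p p' p'' ^ k = 1 \<longleftrightarrow> sig3 t t' t'' ^ k = 1"
  shows "m \<le> q - 2 \<Longrightarrow> E m p p' p'' a b c \<longleftrightarrow> E m t t' t'' a b c"
proof (induction m arbitrary: a b c rule: less_induct)
  case (less m)
  interpret p: hermitian_triple q r K p p' p'' by (rule t)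
  interpret t: hermitian_triple q r K t t' t'' by (rule t)
  have m: "m \<le> q" using less.prems by simp
  have IH: "E (m - 1) p p' p'' a b c \<longleftrightarrow> E (m - 1) t t' t'' a b c" if "0 < m" for a b c
    using less.IH[of "m - 1"] less.prems that by simp
  consider "q < a" | "m < b" | "m < c" | "m < a" "a \<le> q" | "a \<le> m" "b \<le> m" "c \<le> m" by linarith
  then show ?case
  proof cases
    case 1
    then show ?thesis using p.E_reduce_first[OF 1] t.E_reduce_first[OF 1] IH by blast
  next
    case 2
    then show ?thesis using p.E_reduce_second[OF m 2] t.E_reduce_second[OF m 2] IH by blast
  next
    case 3
    then show ?thesis using p.E_reduce_third[OF m 3] t.E_reduce_third[OF m 3] IH by blast
  next
    case 4
    then show ?thesis using p.not_E_between[OF m 4] t.not_E_between[OF m 4] by blast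
  next
    case 5
    have "p.sig ^ m = 1 \<longleftrightarrow> t.sig ^ m = 1"
      using sig[of m] less.prems by (cases "m = 0") (simp_all add: p.sig_sig3 t.sig_sig3)
    then show ?thesis using p.E_iff[OF m 5] t.E_iff[OF m 5] by simp
  qed
qed

text \<open>The semigroup as predicted by Riemann-Roch; it is identified with the actual one in
  \<open>weierstrass_eq\<close>.\<close>

definition Wset :: "'k \<times> 'k \<times> 'k \<Rightarrow> 'k \<times> 'k \<times> 'k \<Rightarrow> 'k \<times> 'k \<times> 'k \<Rightarrow> (nat \<times> nat \<times> nat) set" where
  "Wset p p' p'' = {(a, b, c). (a = 0 \<or> \<not> E (q - 2) p p' p'' (a - 1) b c) \<and>
     (b = 0 \<or> \<not> E (q - 2) p' p'' p (b - 1) c a) \<and> (c = 0 \<or> \<not> E (q - 2) p'' p p' (c - 1) a b)}"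

lemma Wset_cong:
  assumes t: "hermitian_triple q r p p' p''" "hermitian_triple q r t t' t''"
    and sig: "\<And>k. 1 \<le> k \<Longrightarrow> k \<le> q - 2 \<Longrightarrow> sig3 p p' p'' ^ k = 1 \<longleftrightarrow> sig3 t t' t'' ^ k = 1"
  shows "Wset p p' p'' = Wset t t' t''"
proof -
  interpret p: hermitian_triple q r K p p' p'' by (rule t)
  interpret t: hermitian_triple q r K t t' t'' by (rule t)
  have "E (q - 2) p p' p'' a b c \<longleftrightarrow> E (q - 2) t t' t'' a b c" for a b c
    using E_cong[OF t sig] by blast
  moreover have "E (q - 2) p' p'' p a b c \<longleftrightarrow> E (q - 2) t' t'' t a b c" for a b c
    by (rule E_cong[OF p.cycle(1) t.cycle(1)]) (simp_all only: sig3_cycle[of p' p'' p] sig3_cycle[of t' t'' t] sig)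
  moreover have "E (q - 2) p'' p p' a b c \<longleftrightarrow> E (q - 2) t'' t t' a b c" for a b c
    by (rule E_cong[OF p.cycle(2) t.cycle(2)])
      (simp_all only: sig3_cycle[of p p' p'', symmetric] sig3_cycle[of t t' t'', symmetric] sig)
  ultimately show ?thesis by (simp add: Wset_def)
qed

text \<open>The summand (q+1)(q-2-m) stands for q - 2 - m tangents at \<open>p\<close>. Removing
  them brings the degree from q - 2 down to m, where all three membership conditions become the same
  corner case of \<open>E_diagonal\<close>.\<close>

lemma Wset_mem:
  assumes t: "hermitian_triple q r p p' p''" and m: "1 \<le> m" "m \<le> q - 2"
  shows "(m + (q + 1) * (q - 2 - m), m, m) \<in> Wset p p' p'' \<longleftrightarrow> sig3 p p' p'' ^ m = 1"
proof -
  interpret p: hermitian_triple q r K p p' p'' by (rule t)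
  interpret p1: hermitian_triple q r K p' p'' p by (rule p.cycle)
  interpret p2: hermitian_triple q r K p'' p p' by (rule p.cycle)
  define s where "s = q - 2 - m"
  obtain k where k: "m = Suc k" using m by (cases m) auto
  have ms: "q - 2 = m + s" "m + s \<le> q" "m \<le> q" using m by (simp_all add: s_def)
  have sigs: "p1.sig = p.sig" "p2.sig = p.sig"
    unfolding p.sig_sig3 p1.sig_sig3 p2.sig_sig3
    by (rule sig3_cycle, rule sig3_cycle[symmetric])
  have "E (q - 2) p p' p'' (m + (q + 1) * s - 1) m m \<longleftrightarrow> p.sig ^ m \<noteq> 1"
  proof -
    have "m + (q + 1) * s - 1 = k + (q + 1) * s" by (simp add: k)
    then show ?thesis
      unfolding ms(1) using p.E_shift_first[of m s k m m] p.E_diagonal(1)[of k] ms(3) by (simp add: k)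
  qed
  moreover have "E (q - 2) p' p'' p (m - 1) m (m + (q + 1) * s) \<longleftrightarrow> p.sig ^ m \<noteq> 1"
    unfolding ms(1) p1.E_shift_third[OF ms(2)] using p1.E_diagonal(1)[of k] ms(3) sigs by (simp add: k)
  moreover have "E (q - 2) p'' p p' (m - 1) (m + (q + 1) * s) m \<longleftrightarrow> p.sig ^ m \<noteq> 1"
    unfolding ms(1) p2.E_shift_second[OF ms(2)] using p2.E_diagonal(1)[of k] ms(3) sigs by (simp add: k)
  ultimately show ?thesis
    using m unfolding Wset_def s_def[symmetric] p.sig_sig3 by auto
qed

end

section \<open>Descent to the base field\<close>

lemma ring_homo_to_ac: "ring_homo to_ac"
  by unfold_locales simp_all

lemma ring_homo_map_poly:
  assumes "ring_homo g"
  shows "ring_homo (map_poly g)"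
proof -
  interpret ring_homo g by fact
  show ?thesis
    by unfold_locales
      (simp_all add: poly_eq_iff coeff_map_poly hom_0 hom_add hom_sum hom_mult hom_1 coeff_mult coeff_pCons
        one_pCons split: nat.splits)
qed

lemma ring_homo_base_change: "ring_homo base_change"
  unfolding base_change_def[abs_def] by (intro ring_homo_map_poly ring_homo_to_ac)

lemmas base_change_simps = ring_homo.hom_add[OF ring_homo_base_change]
  ring_homo.hom_mult[OF ring_homo_base_change] ring_homo.hom_1[OF ring_homo_base_change]
  ring_homo.hom_0[OF ring_homo_base_change] ring_homo.hom_diff[OF ring_homo_base_change]
  ring_homo.hom_power[OF ring_homo_base_change] ring_homo.hom_prod[OF ring_homo_base_change]

lemma base_change_gens:
  "base_change (con c) = con (to_ac c)" "base_change var_X = var_X" "base_change var_Y = var_Y"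
  "base_change var_Z = var_Z"
  by (simp_all add: base_change_def con_def var_X_def var_Y_def var_Z_def map_poly_pCons one_pCons)

lemma base_change_hermitian_form: "base_change (hermitian_form q) = hermitian_form q"
  by (simp add: hermitian_form_def base_change_simps base_change_gens)

lemma coeff_base_change:
  "coeff (coeff (coeff (base_change F) i) j) k = to_ac (coeff (coeff (coeff F i) j) k)"
  by (simp add: base_change_def coeff_map_poly)

lemma homogeneous_base_change: "homogeneous d (base_change F) \<longleftrightarrow> homogeneous d F"
  by (simp add: homogeneous_def coeff_base_change)

text \<open>Linear functionals of the algebraic closure over the base field; applied to coefficients, they
  take forms back to the base field.\<close>

definition functional :: "('a::field alg_closure \<Rightarrow> 'a) \<Rightarrow> bool" where
  "functional l \<longleftrightarrow> (\<forall>x y. l (x + y) = l x + l y) \<and> (\<forall>a x. l (to_ac a * x) = a * l x)"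

text \<open>The coordinate functionals of a basis of the closure as a vector space over the base
  field. The sum over any larger finite set \<open>S\<close> is allowed so that several elements can
  share one set.\<close>

lemma functional_basis:
  "\<exists>l :: 'a::field alg_closure \<Rightarrow> 'a alg_closure \<Rightarrow> 'a. (\<forall>b. functional (l b)) \<and> (\<forall>x. finite {b. l b x \<noteq> 0}) \<and>
    (\<forall>x S. finite S \<longrightarrow> {b. l b x \<noteq> 0} \<subseteq> S \<longrightarrow> x = (\<Sum>b\<in>S. to_ac (l b x) * b))"
proof -
  interpret vector_space "\<lambda>(a::'a) x. to_ac a * x"
    by unfold_locales (simp_all add: algebra_simps)
  define B where "B = extend_basis {}"
  have B: "independent B" "span B = UNIV"
    unfolding B_def by (rule independent_extend_basis span_extend_basis, rule independent_empty)+
  define l where "l b x = representation B x b" for b x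
  show ?thesis
  proof (intro exI[of _ l] conjI allI impI)
    show "functional (l b)" for b
      using B by (simp add: functional_def l_def representation_add representation_scale)
    show fin: "finite {b. l b x \<noteq> 0}" for x
      unfolding l_def by (rule finite_representation)
    show "x = (\<Sum>b\<in>S. to_ac (l b x) * b)" if "finite S" "{b. l b x \<noteq> 0} \<subseteq> S" for x S
    proof -
      have "x = (\<Sum>b | l b x \<noteq> 0. to_ac (l b x) * b)"
        using sum_nonzero_representation_eq[of B x] B by (simp add: l_def)
      also have "\<dots> = (\<Sum>b\<in>S. to_ac (l b x) * b)"
        using that by (intro sum.mono_neutral_left) auto
      finally show ?thesis .
    qed
  qed
qed

lemma functional_exists:
  assumes "c \<noteq> (0 :: 'a::field alg_closure)"
  obtains l where "functional l" "l c = 1"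
proof -
  obtain l :: "'a alg_closure \<Rightarrow> 'a alg_closure \<Rightarrow> 'a" where l: "\<And>b. functional (l b)" "\<And>x. finite {b. l b x \<noteq> 0}"
    "\<And>x S. finite S \<Longrightarrow> {b. l b x \<noteq> 0} \<subseteq> S \<Longrightarrow> x = (\<Sum>b\<in>S. to_ac (l b x) * b)"
    using functional_basis[where 'a = 'a] by blast
  have "\<exists>b. l b c \<noteq> 0"
  proof (rule ccontr)
    assume "\<not> (\<exists>b. l b c \<noteq> 0)"
    then have "c = 0" using l(3)[of "{}" c] by simp
    with assms show False ..
  qed
  then obtain b where b: "l b c \<noteq> 0" ..
  have "functional (\<lambda>x. l b x / l b c)"
    using l(1)[of b] by (simp add: functional_def add_divide_distrib)
  then show thesis by (rule that) (simp add: b)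
qed

text \<open>The conclusions have the shape of the hypotheses one polynomial layer higher, so the
  lemma can be iterated through X, Y and Z.\<close>

lemma functional_map_poly_mult:
  fixes g :: "'s::comm_ring_1 \<Rightarrow> 't::comm_ring_1"
  assumes add: "\<And>x y. l (x + y) = l x + l y" and scale: "\<And>a x. l (g a * x) = a * l x" and g0: "g 0 = 0"
  shows "map_poly l (p + p') = map_poly l p + map_poly l p'"
    "map_poly l (map_poly g s * p) = s * map_poly l p"
proof -
  have l0: "l 0 = 0" using add[of 0 0] by simp
  have lsum: "l (sum f A) = (\<Sum>x\<in>A. l (f x))" for f :: "nat \<Rightarrow> 't" and A
    by (induction A rule: infinite_finite_induct) (simp_all add: l0 add)
  show "map_poly l (p + p') = map_poly l p + map_poly l p'"
    by (simp add: poly_eq_iff coeff_map_poly l0 add)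
  show "map_poly l (map_poly g s * p) = s * map_poly l p"
    by (simp add: poly_eq_iff coeff_map_poly l0 g0 coeff_mult lsum scale)
qed

definition descend :: "('a::field alg_closure \<Rightarrow> 'a) \<Rightarrow> 'a alg_closure poly3 \<Rightarrow> 'a poly3" where
  "descend l = map_poly (map_poly (map_poly l))"

lemma descend:
  assumes "functional l"
  shows "descend l (F + G) = descend l F + descend l G" "descend l (base_change M * F) = M * descend l F"
proof -
  have 0: "\<And>x y. l (x + y) = l x + l y" "\<And>a x. l (to_ac a * x) = a * l x"
    using assms by (auto simp: functional_def)
  note 1 = functional_map_poly_mult[of l to_ac, OF 0 to_ac_0]
  note 2 = functional_map_poly_mult[of "map_poly l" "map_poly to_ac", OF 1 map_poly_0]
  note 3 = functional_map_poly_mult[of "map_poly (map_poly l)" "map_poly (map_poly to_ac)", OF 2 map_poly_0]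
  show "descend l (F + G) = descend l F + descend l G" "descend l (base_change M * F) = M * descend l F"
    unfolding descend_def base_change_def by (rule 3)+
qed

lemma functional_0: "functional l \<Longrightarrow> l 0 = 0"
  unfolding functional_def by (metis add_cancel_right_left)

lemma descend_con:
  assumes "functional l"
  shows "descend l (con c) = con (l c)"
  using functional_0[OF assms] by (simp add: descend_def con_def map_poly_pCons)

lemma descend_diff:
  assumes "functional l"
  shows "descend l (F - G) = descend l F - descend l G"
  using descend(1)[OF assms, of "F - G" G] by simp

lemma descend_vars:
  assumes "functional l"
  shows "descend l (var_X * F) = var_X * descend l F" "descend l (var_Y * F) = var_Y * descend l F"
    "descend l (var_Z * F) = var_Z * descend l F"
  using descend(2)[OF assms, of var_X F] descend(2)[OF assms, of var_Y F] descend(2)[OF assms, of var_Z F]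
  by (simp_all add: base_change_gens)

lemma homogeneous_descend:
  assumes "functional l" "homogeneous d F"
  shows "homogeneous d (descend l F)"
  using assms(2) functional_0[OF assms(1)] unfolding homogeneous_def descend_def
  by (simp add: coeff_map_poly) metis

lemma eval_descend_rational:
  assumes l: "functional l" and "homogeneous d F"
  shows "ev3 (\<lambda>x. x) (descend l F) (x, y, z) = l (ev3 (\<lambda>x. x) F (to_ac x, to_ac y, to_ac z))"
  using assms(2)
proof (induction rule: homogeneous_induct)
  case (con c)
  then show ?case by (simp add: descend_con[OF l] ev3_simps[OF ring_homo_id])
next
  case (step d F1 F2 F3)
  then show ?case
    using l by (simp add: descend[OF l] descend_vars[OF l] ev3_simps[OF ring_homo_id] functional_def)
qed

text \<open>At a nonrational point, evaluation does not commute with a functional. But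
  \<open>F\<close> is a combination of its coordinate forms with the basis elements as coefficients,
  so one of these forms is nonzero at \<open>T\<close>.\<close>

lemma eval_descend_nonzero:
  fixes F :: "'a::field alg_closure poly3"
  assumes "homogeneous d F" "ev3 (\<lambda>x. x) F T \<noteq> 0"
  obtains l where "functional l" "ev3 to_ac (descend l F) T \<noteq> 0"
proof -
  obtain l :: "'a alg_closure \<Rightarrow> 'a alg_closure \<Rightarrow> 'a" where l: "\<And>b. functional (l b)" "\<And>x. finite {b. l b x \<noteq> 0}"
    "\<And>x S. finite S \<Longrightarrow> {b. l b x \<noteq> 0} \<subseteq> S \<Longrightarrow> x = (\<Sum>b\<in>S. to_ac (l b x) * b)"
    using functional_basis[where 'a = 'a] by blast
  obtain x y z where T: "T = (x, y, z)" by (cases T)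
  \<comment> \<open>Every larger finite set works too, so the sets obtained for the three summands
    can be united.\<close>
  have "\<exists>S0. finite S0 \<and> (\<forall>S. finite S \<longrightarrow> S0 \<subseteq> S \<longrightarrow>
      ev3 (\<lambda>x. x) F T = (\<Sum>b\<in>S. ev3 to_ac (descend (l b) F) T * b))"
    using assms(1)
  proof (induction rule: homogeneous_induct)
    case (con c)
    show ?case
      using l(2)[of c] l(3)[of _ c]
      by (intro exI[of _ "{b. l b c \<noteq> 0}"])
        (simp add: descend_con[OF l(1)] ev3_simps[OF ring_homo_id] ev3_simps[OF ring_homo_to_ac])
  next
    case (step d F1 F2 F3)
    obtain S1 where S1: "finite S1"
      "\<forall>S. finite S \<longrightarrow> S1 \<subseteq> S \<longrightarrow> ev3 (\<lambda>x. x) F1 T = (\<Sum>b\<in>S. ev3 to_ac (descend (l b) F1) T * b)"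
      using step.IH(1) by blast
    obtain S2 where S2: "finite S2"
      "\<forall>S. finite S \<longrightarrow> S2 \<subseteq> S \<longrightarrow> ev3 (\<lambda>x. x) F2 T = (\<Sum>b\<in>S. ev3 to_ac (descend (l b) F2) T * b)"
      using step.IH(2) by blast
    obtain S3 where S3: "finite S3"
      "\<forall>S. finite S \<longrightarrow> S3 \<subseteq> S \<longrightarrow> ev3 (\<lambda>x. x) F3 T = (\<Sum>b\<in>S. ev3 to_ac (descend (l b) F3) T * b)"
      using step.IH(3) by blast
    show ?case
    proof (intro exI[of _ "S1 \<union> S2 \<union> S3"] conjI allI impI)
      fix S assume S': "finite S" "S1 \<union> S2 \<union> S3 \<subseteq> S"
      have "ev3 (\<lambda>x. x) (var_X * F1 + var_Y * F2 + var_Z * F3) T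
          = x * ev3 (\<lambda>x. x) F1 T + y * ev3 (\<lambda>x. x) F2 T + z * ev3 (\<lambda>x. x) F3 T"
        by (simp add: T ev3_simps[OF ring_homo_id])
      also have "\<dots> = (\<Sum>b\<in>S. (x * ev3 to_ac (descend (l b) F1) T + y * ev3 to_ac (descend (l b) F2) T
          + z * ev3 to_ac (descend (l b) F3) T) * b)"
        using S1(2)[rule_format, OF S'(1)] S2(2)[rule_format, OF S'(1)] S3(2)[rule_format, OF S'(1)] S'(2)
        by (simp add: sum_distrib_left sum.distrib distrib_right mult.assoc)
      also have "\<dots> = (\<Sum>b\<in>S. ev3 to_ac (descend (l b) (var_X * F1 + var_Y * F2 + var_Z * F3)) T * b)"
        by (simp add: T descend[OF l(1)] descend_vars[OF l(1)] ev3_simps[OF ring_homo_to_ac])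
      finally show "ev3 (\<lambda>x. x) (var_X * F1 + var_Y * F2 + var_Z * F3) T = \<dots>" .
    qed (use S1 S2 S3 in simp)
  qed
  then obtain S where "ev3 (\<lambda>x. x) F T = (\<Sum>b\<in>S. ev3 to_ac (descend (l b) F) T * b)" by blast
  then have "\<exists>b. ev3 to_ac (descend (l b) F) T \<noteq> 0"
    using assms(2) by (auto intro: ccontr)
  then show thesis using that l(1) by blast
qed

lemma evk_base_change_eq: "ev3 (\<lambda>x. x) (base_change F) T = ev3 to_ac F T"
  unfolding base_change_def by (rule ev3_map_poly) simp_all

section \<open>The curve over the field with q^2 elements and its points\<close>

locale hermitian_ff = hermitian q r K
  for q r and K :: "'a::{field,finite} alg_closure itself" +
  assumes card_field: "card (UNIV :: 'a set) = q ^ 2"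
begin

abbreviation C0 :: "'a poly3" where "C0 \<equiv> hermitian_form q"

lemma evk_base_change: "evk (base_change F) T = ev3 to_ac F T"
  by (simp add: evk_def evk_base_change_eq)

lemma homogeneous_C0: "homogeneous (q + 1) C0"
proof -
  have "homogeneous (q + 1) (var_X ^ (q + 1) :: 'a poly3)"
    by (intro homogeneous_power1 homogeneous_vars)
  moreover have "homogeneous (q + 1) (var_Y ^ q * var_Z :: 'a poly3)"
    by (intro homogeneous_mult homogeneous_power1 homogeneous_vars)
  moreover have "homogeneous (1 + q) (var_Y * var_Z ^ q :: 'a poly3)"
    by (intro homogeneous_mult homogeneous_power1 homogeneous_vars)
  ultimately show ?thesis
    unfolding hermitian_form_def by (intro homogeneous_diff) (simp_all add: add.commute)
qed

text \<open>A functional with value 1 at 1 gives a retraction of the base change that is linear over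
  forms on the base field.\<close>

lemma C0_dvd_iff: "C0 dvd F \<longleftrightarrow> C dvd base_change F"
proof
  assume "C0 dvd F"
  then show "C dvd base_change F"
    by (metis base_change_hermitian_form base_change_simps(2) dvd_def)
next
  assume "C dvd base_change F"
  then obtain E where E: "base_change F * 1 = base_change C0 * E"
    by (auto simp: base_change_hermitian_form)
  obtain l :: "'a alg_closure \<Rightarrow> 'a" where l: "functional l" "l 1 = 1"
    using functional_exists[of 1] by auto
  have "descend l 1 = 1"
    using descend_con[OF l(1), of 1] l(2) by (simp add: con_simps)
  then have "F = C0 * descend l E"
    using arg_cong[OF E, of "descend l"] unfolding descend(2)[OF l(1)] by simp
  then show "C0 dvd F" by simp
qed

lemma vanishes_iff:
  assumes "homogeneous d F"
  shows "vanishes_at F (ppoint_of T) \<longleftrightarrow> evk (base_change F) T = 0"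
proof -
  obtain x y z where T: "T = (x, y, z)" by (cases T)
  have "vanishes_at F (ppoint_of T) \<longleftrightarrow> (\<forall>c. c \<noteq> 0 \<longrightarrow> evk (base_change F) (c * x, c * y, c * z) = 0)"
    unfolding vanishes_at_def T ppoint_of.simps eval3_eq_ev3 evk_def by blast
  also have "\<dots> \<longleftrightarrow> (\<forall>c. c \<noteq> 0 \<longrightarrow> c ^ d * evk (base_change F) T = 0)"
    unfolding evk_base_change T by (simp add: ev3_scale[OF ring_homo_to_ac assms])
  also have "\<dots> \<longleftrightarrow> evk (base_change F) T = 0"
    by (auto dest: spec[of _ 1])
  finally show ?thesis .
qed

lemma vanishes_C0: "vanishes_at C0 (ppoint_of T) \<longleftrightarrow> evk C T = 0"
  using vanishes_iff[OF homogeneous_C0] by (simp add: base_change_hermitian_form)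

lemma evk_C: "evk C (x, y, z) = x ^ (q + 1) - y ^ q * z - y * z ^ q"
  unfolding evk_def by (rule ev3_C[OF ring_homo_id])

lemma ppoint_of_scale:
  assumes "k \<noteq> 0"
  shows "ppoint_of (k * x, k * y, k * z) = ppoint_of (x, y, z :: 'a alg_closure)"
proof (intro equalityI subsetI)
  fix v assume "v \<in> ppoint_of (k * x, k * y, k * z)"
  then obtain c where "c \<noteq> 0" "v = ((c * k) * x, (c * k) * y, (c * k) * z)"
    by (auto simp: mult.assoc)
  then show "v \<in> ppoint_of (x, y, z)"
    using assms unfolding ppoint_of.simps mem_Collect_eq by (intro exI[of _ "c * k"]) simp
next
  fix v assume "v \<in> ppoint_of (x, y, z)"
  then obtain c where "c \<noteq> 0" "v = (c * x, c * y, c * z)"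
    by auto
  then show "v \<in> ppoint_of (k * x, k * y, k * z)"
    using assms unfolding ppoint_of.simps mem_Collect_eq by (intro exI[of _ "c / k"]) simp
qed

lemma curve_points_eq: "curve_points C0 = ppoint_of ` pts"
proof (intro equalityI subsetI)
  fix P assume "P \<in> curve_points C0"
  then obtain v0 where v0: "v0 \<noteq> (0, 0, 0)" "P = ppoint_of v0" "vanishes_at C0 (ppoint_of v0)"
    unfolding curve_points_def proj_plane_def by blast
  obtain x y z where "v0 = (x, y, z)" by (cases v0)
  with v0 have v: "(x, y, z) \<noteq> (0, 0, 0)" and P: "P = ppoint_of (x, y, z)" and "evk C (x, y, z) = 0"
    by (simp_all only: vanishes_C0 simp_thms)
  then have "x ^ (q + 1) - (y ^ q * z + y * z ^ q) = 0"
    unfolding evk_C by (simp only: diff_diff_add)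
  then have 0: "x ^ (q + 1) = y ^ q * z + y * z ^ q" by (simp only: right_minus_eq)
  show "P \<in> ppoint_of ` pts"
  proof (cases "z = 0")
    case True
    have "x ^ (q + 1) = 0"
      unfolding 0 True using q_ge_2 by (simp add: power_0_left)
    then have "x = 0" by (simp only: power_eq_0_iff)
    then have "P = ppoint_of inf"
      using ppoint_of_scale[of y 0 1 0] v True P by simp
    moreover have "inf \<in> pts" by (simp add: pts_def)
    ultimately show ?thesis by blast
  next
    case False
    have "P = ppoint_of (x / z, y / z, 1)"
      using ppoint_of_scale[of z "x / z" "y / z" 1] False P by simp
    moreover have "(x / z) ^ (q + 1) = (y / z) ^ q + y / z"
    proof -
      have "(x / z) ^ (q + 1) = (y ^ q * z + y * z ^ q) / (z ^ q * z)"
        unfolding power_divide 0 by simp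
      also have "\<dots> = (y / z) ^ q + y / z"
        using False by (simp add: add_divide_distrib power_divide)
      finally show ?thesis .
    qed
    then have "(x / z, y / z, 1) \<in> pts" unfolding pts_def by blast
    ultimately show ?thesis by blast
  qed
next
  fix P assume "P \<in> ppoint_of ` pts"
  then obtain T where T: "T \<in> pts" "P = ppoint_of T" by blast
  have "T \<noteq> (0, 0, 0)" using T(1) by (auto simp: pts_def)
  moreover have "evk C T = 0"
    using T(1) q_ge_2 by (auto simp: pts_def evk_C power_0_left)
  ultimately show "P \<in> curve_points C0"
    unfolding curve_points_def proj_plane_def using T(2) vanishes_C0 by blast
qed

lemma ppoint_of_inj: "inj_on ppoint_of pts"
proof (rule inj_onI)
  fix S T :: "'a alg_closure \<times> 'a alg_closure \<times> 'a alg_closure"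
  assume S: "S \<in> pts" and T: "T \<in> pts" and eq: "ppoint_of S = ppoint_of T"
  obtain x y z where S': "S = (x, y, z)" by (cases S)
  obtain x' y' z' where T': "T = (x', y', z')" by (cases T)
  have "S \<in> ppoint_of S" unfolding S' by (simp add: exI[of _ 1])
  then obtain c where "c \<noteq> 0" "x = c * x'" "y = c * y'" "z = c * z'"
    unfolding eq unfolding S' T' by auto
  then show "S = T" using S T unfolding S' T' by (auto simp: pts_def)
qed

definition rp :: "('a alg_closure \<times> 'a alg_closure \<times> 'a alg_closure) set" where
  "rp = {T \<in> pts. \<exists>x y z. T = (to_ac x, to_ac y, to_ac z)}"

lemma rational_points_eq: "rational_points C0 = ppoint_of ` rp"
proof (intro equalityI subsetI)
  fix P assume "P \<in> rational_points C0"
  then obtain T a b c where T: "T \<in> pts" "P = ppoint_of T" and abc: "(to_ac a, to_ac b, to_ac c) \<in> P"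
    unfolding rational_points_def curve_points_eq by blast
  show "P \<in> ppoint_of ` rp"
  proof (cases "T = inf")
    case True
    have "inf = (to_ac 0, to_ac 1, to_ac 0)" by simp
    then have "inf \<in> rp" unfolding rp_def by (auto simp: pts_def)
    then show ?thesis using T True by blast
  next
    case False
    then obtain x y where xy: "T = (x, y, 1)" using T(1) by (auto simp: pts_def)
    obtain k where "k \<noteq> 0" "(to_ac a, to_ac b, to_ac c) = (k * x, k * y, k * 1)"
      using abc unfolding T(2) xy ppoint_of.simps by blast
    then have k: "k \<noteq> 0" "to_ac a = k * x" "to_ac b = k * y" "to_ac c = k" by simp_all
    have "x = to_ac (a / c)" "y = to_ac (b / c)"
      using k by (simp_all add: field_simps)
    then have "T = (to_ac (a / c), to_ac (b / c), to_ac 1)" unfolding xy by simp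
    then have "T \<in> rp" using T(1) unfolding rp_def by blast
    then show ?thesis using T(2) by blast
  qed
next
  fix P assume "P \<in> ppoint_of ` rp"
  then obtain x y z where T: "(to_ac x, to_ac y, to_ac z) \<in> pts" "P = ppoint_of (to_ac x, to_ac y, to_ac z)"
    unfolding rp_def by blast
  have "(to_ac x, to_ac y, to_ac z) \<in> P" unfolding T(2) by (simp add: exI[of _ 1])
  then show "P \<in> rational_points C0"
    unfolding rational_points_def curve_points_eq using T by blast
qed

end

section \<open>Pole orders\<close>

lemma order_exists:
  fixes w :: "'a::field"
  assumes "w ^ n = 1" "0 < n"
  obtains d where "0 < d" "\<And>k. w ^ k = 1 \<longleftrightarrow> d dvd k"
proof -
  define d where "d = (LEAST m. 0 < m \<and> w ^ m = 1)"
  have d: "0 < d" "w ^ d = 1"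
    using LeastI[of "\<lambda>m. 0 < m \<and> w ^ m = 1" n] assms by (auto simp: d_def)
  have least: "d \<le> m" if "0 < m" "w ^ m = 1" for m
    unfolding d_def by (rule Least_le) (use that in simp)
  have "w ^ k = w ^ (k mod d)" for k
  proof -
    have "w ^ k = w ^ (d * (k div d) + k mod d)" by simp
    then show ?thesis using d(2) by (simp only: power_add power_mult power_one mult_1)
  qed
  then have "w ^ k = 1 \<longleftrightarrow> k mod d = 0" for k
    using least[of "k mod d"] d(1) by (metis gr0I linorder_not_le mod_less_divisor power_0)
  then show thesis using that d(1) by (simp add: dvd_eq_mod_eq_0)
qed

lemma primitive_element:
  obtains g :: "'a::{field,finite}"
  where "\<And>x. x \<noteq> 0 \<Longrightarrow> \<exists>i. x = g ^ i" "\<And>i. g ^ i = 1 \<longleftrightarrow> (card (UNIV :: 'a set) - 1) dvd i" "g \<noteq> 0"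
proof -
  interpret R: field "ring_of_type_algebra :: 'a ring"
    by (rule field_from_type_algebra)
  have fields: "carrier (ring_of_type_algebra :: 'a ring) = UNIV" "\<zero>\<^bsub>ring_of_type_algebra\<^esub> = (0::'a)"
    "\<one>\<^bsub>ring_of_type_algebra\<^esub> = (1::'a)" "x \<otimes>\<^bsub>ring_of_type_algebra\<^esub> y = x * (y::'a)" for x y
    unfolding ring_of_type_algebra_def by simp_all
  have carrier: "carrier (Multiplicative_Group.mult_of (ring_of_type_algebra :: 'a ring)) = UNIV - {0}"
    unfolding Multiplicative_Group.carrier_mult_of fields ..
  have pow: "x [^]\<^bsub>ring_of_type_algebra\<^esub> (i::nat) = x ^ i" for x :: 'a and i
    by (induction i) (simp_all only: R.nat_pow_0 R.nat_pow_Suc fields power_0 power_Suc2)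
  have "finite (carrier (ring_of_type_algebra :: 'a ring))" unfolding fields by simp
  from R.finite_field_mult_group_has_gen[OF this]
  obtain g :: 'a where "g \<in> UNIV - {0}" and g': "UNIV - {0} = {g ^ i | i. i \<in> (UNIV :: nat set)}"
    unfolding carrier pow by (rule bexE)
  then have "g \<noteq> 0" by blast
  note g = this g'
  have "\<not> inj (\<lambda>i::nat. g ^ i)"
    using finite_imageD[of "\<lambda>i::nat. g ^ i" UNIV] by auto
  then obtain i j :: nat where "i < j" "g ^ i = g ^ j"
    unfolding inj_def by (metis linorder_neqE_nat)
  then have "g ^ i * g ^ (j - i) = g ^ i * 1"
    by (metis le_add_diff_inverse less_imp_le mult.right_neutral power_add)
  then have "g ^ (j - i) = 1" using g(1) by simp
  then obtain d where d: "0 < d" "\<And>k. g ^ k = 1 \<longleftrightarrow> d dvd k"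
    using order_exists[of g "j - i"] \<open>i < j\<close> by auto
  have "inj_on (\<lambda>i. g ^ i) {..<d}"
  proof (rule linorder_inj_onI)
    fix i j assume ij: "i < j" "i \<in> {..<d}" "j \<in> {..<d}"
    show "g ^ i \<noteq> g ^ j"
    proof
      assume "g ^ i = g ^ j"
      then have "g ^ i * g ^ (j - i) = g ^ i * 1"
        using ij(1) by (metis le_add_diff_inverse less_imp_le mult.right_neutral power_add)
      then have "d dvd j - i" using g(1) d(2) by simp
      then show False using ij by (auto dest: dvd_imp_le)
    qed
  qed auto
  then have "card ((\<lambda>i. g ^ i) ` {..<d}) = d" by (simp add: card_image)
  moreover have "(\<lambda>i. g ^ i) ` {..<d} = UNIV - {0}"
  proof -
    have "g ^ k = g ^ (k mod d)" for k
    proof -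
      have "g ^ k = g ^ (d * (k div d) + k mod d)" by simp
      moreover have "g ^ d = 1" using d(2)[of d] by simp
      ultimately show ?thesis by (simp only: power_add power_mult power_one mult_1)
    qed
    then have "{g ^ i | i. i \<in> (UNIV :: nat set)} \<subseteq> (\<lambda>i. g ^ i) ` {..<d}"
      using d(1) by (auto intro!: image_eqI[of _ _ "_ mod d"])
    then show ?thesis using g by auto
  qed
  ultimately have "card (UNIV :: 'a set) - 1 = d"
    by (simp add: card_Diff_singleton)
  then show thesis using that[of g] g d(2) by auto
qed

lemma power_card_field:
  fixes x :: "'a::{field,finite}"
  shows "x ^ card (UNIV :: 'a set) = x"
proof (cases "x = 0")
  case False
  obtain g :: 'a where g: "\<And>x. x \<noteq> 0 \<Longrightarrow> \<exists>i. x = g ^ i" "\<And>i. g ^ i = 1 \<longleftrightarrow> (card (UNIV :: 'a set) - 1) dvd i"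
    using primitive_element by metis
  obtain i where "x = g ^ i" using g(1)[OF False] by blast
  then have "x ^ (card (UNIV :: 'a set) - 1) = 1"
    using g(2) by (simp flip: power_mult)
  moreover have "card (UNIV :: 'a set) = Suc (card (UNIV :: 'a set) - 1)"
    using finite_UNIV_card_ge_0[where 'a = 'a] by simp
  ultimately show ?thesis by (metis mult.right_neutral power_Suc)
qed (simp add: power_0_left)

text \<open>On a line F + sG each condition excludes at most one scalar s. Over a finite field this
  works only while there are fewer conditions than scalars.\<close>

lemma combine_nonvanishing:
  fixes V :: "'a::{field,finite} poly3 set" and psi :: "'x \<Rightarrow> 'a poly3 \<Rightarrow> 'a alg_closure"
  assumes "finite N" "card N < card (UNIV :: 'a set)" "F0 \<in> V"
    and V: "\<And>F G s. F \<in> V \<Longrightarrow> G \<in> V \<Longrightarrow> F + con s * G \<in> V"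
    and psi: "\<And>x F G s. psi x (F + con s * G) = psi x F + to_ac s * psi x G"
    and "\<And>x. x \<in> N \<Longrightarrow> \<exists>F\<in>V. psi x F \<noteq> 0"
  shows "\<exists>F\<in>V. \<forall>x\<in>N. psi x F \<noteq> 0"
  using assms(1,2,6)
proof (induction N rule: finite_induct)
  case empty
  then show ?case using assms(3) by auto
next
  case (insert x N)
  obtain F where F: "F \<in> V" "\<forall>y\<in>N. psi y F \<noteq> 0"
    using insert by auto
  obtain G where G: "G \<in> V" "psi x G \<noteq> 0" using insert.prems(2) by blast
  define bad where "bad y = {s. psi y F + to_ac s * psi y G = 0}" for y
  have bad: "bad y \<subseteq> {s. to_ac s = - psi y F / psi y G}" if "y \<in> insert x N" for y
  proof
    fix s assume s: "s \<in> bad y"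
    have "psi y G \<noteq> 0"
      using s F(2) G(2) that by (auto simp: bad_def)
    moreover have "psi y F = - (to_ac s * psi y G)"
      using s unfolding bad_def mem_Collect_eq by (simp only: add_eq_0_iff2)
    ultimately show "s \<in> {s. to_ac s = - psi y F / psi y G}" by simp
  qed
  have one: "card (bad y) \<le> 1" if "y \<in> insert x N" for y
  proof -
    have "s = s'" if "s \<in> bad y" "s' \<in> bad y" for s s'
    proof -
      have "to_ac s = - psi y F / psi y G" "to_ac s' = - psi y F / psi y G"
        using that bad[OF \<open>y \<in> insert x N\<close>] by blast+
      then have "to_ac s = to_ac s'" by (simp only:)
      then show ?thesis by simp
    qed
    then have "\<forall>s\<in>bad y. \<forall>s'\<in>bad y. s = s'" by blast
    then show ?thesis by (simp add: card_le_Suc0_iff_eq)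
  qed
  have "card (\<Union>y\<in>insert x N. bad y) \<le> (\<Sum>y\<in>insert x N. card (bad y))"
    using insert.hyps by (intro card_UN_le) simp
  also have "\<dots> \<le> (\<Sum>y\<in>insert x N. 1)"
    by (intro sum_mono one)
  also have "\<dots> < card (UNIV :: 'a set)" using insert by simp
  finally have "(\<Union>y\<in>insert x N. bad y) \<noteq> UNIV" by auto
  then obtain s where "s \<notin> (\<Union>y\<in>insert x N. bad y)" by blast
  then have "\<forall>y\<in>insert x N. psi y (F + con s * G) \<noteq> 0"
    by (auto simp: psi bad_def)
  then show ?case using V[OF F(1) G(1)] by blast
qed

section \<open>Local rings and powers of maximal ideals in terms of expansions\<close>

context hermitian_ff
begin

lemma frob2: "((to_ac a :: 'a alg_closure) ^ q) ^ q = to_ac a"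
  using power_card_field[of a] by (simp add: card_field power2_eq_square flip: power_mult to_ac_power)

lemma rp_rpts: "rp \<subseteq> rpts"
  unfolding rp_def rpts_def by (auto simp: frob2)

lemma rp_pts: "T \<in> rp \<Longrightarrow> T \<in> pts"
  by (simp add: rp_def)

abbreviation phi0 :: "'a alg_closure \<times> 'a alg_closure \<times> 'a alg_closure \<Rightarrow> 'a poly3 \<Rightarrow> 'a alg_closure fps" where
  "phi0 T F \<equiv> phi T (base_change F)"

lemmas phi0_simps = base_change_simps phi_simps

definition cls :: "'a poly3 \<Rightarrow> 'a poly3 \<Rightarrow> 'a ratfun" where
  "cls F G = fraction_eq C0 `` {(F, G)}"

lemma function_field_cases:
  assumes "f \<in> function_field C0"
  obtains d F G where "homogeneous d F" "homogeneous d G" "\<not> C0 dvd G" "f = cls F G"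
  using assms unfolding function_field_def cls_def curve_fractions_def quotient_def by blast

lemma cls_in_function_field:
  "homogeneous d F \<Longrightarrow> homogeneous d G \<Longrightarrow> \<not> C0 dvd G \<Longrightarrow> cls F G \<in> function_field C0"
  unfolding function_field_def cls_def curve_fractions_def quotient_def by blast

lemma mem_cls:
  assumes "homogeneous d F" "homogeneous d G" "\<not> C0 dvd G"
  shows "(F', G') \<in> cls F G \<longleftrightarrow>
    (\<exists>e. homogeneous e F' \<and> homogeneous e G') \<and> \<not> C0 dvd G' \<and> C0 dvd F * G' - F' * G"
  using assms unfolding cls_def fraction_eq_def curve_fractions_def by auto

lemma phi0_nonzero: "T \<in> pts \<Longrightarrow> homogeneous d G \<Longrightarrow> \<not> C0 dvd G \<Longrightarrow> phi0 T G \<noteq> 0"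
  using phi_eq_0_iff[of T d "base_change G"] homogeneous_base_change C0_dvd_iff by blast

lemma phi0_cross:
  assumes "T \<in> pts" "C0 dvd F * G' - F' * G"
  shows "phi0 T F * phi0 T G' = phi0 T F' * phi0 T G"
proof -
  have "C dvd base_change (F * G') - base_change (F' * G)"
    using assms(2) unfolding C0_dvd_iff base_change_simps .
  from phi_dvd_diff[OF assms(1) this] show ?thesis by (simp add: phi0_simps)
qed

lemma vanishes_phi0: "T \<in> pts \<Longrightarrow> homogeneous d F \<Longrightarrow> vanishes_at F (ppoint_of T) \<longleftrightarrow> fps_nth (phi0 T F) 0 = 0"
  using vanishes_iff phi_nth_0 by simp

lemma not_vanishes_not_dvd: "T \<in> pts \<Longrightarrow> homogeneous d F \<Longrightarrow> \<not> vanishes_at F (ppoint_of T) \<Longrightarrow> \<not> C0 dvd F"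
proof
  assume T: "T \<in> pts" and F: "homogeneous d F" "\<not> vanishes_at F (ppoint_of T)" and "C0 dvd F"
  then have "phi0 T F = 0" using phi_dvd[OF T] by (simp only: C0_dvd_iff)
  then show False using vanishes_phi0[OF T F(1)] F(2) by simp
qed

text \<open>Multiplying by U^k and dividing by xi^k removes the k common zeros of numerator and
  denominator at \<open>T\<close>.\<close>

lemma local_fraction:
  assumes T: "T \<in> pts" and L: "local_data T xi U"
    and F: "homogeneous d F" and G: "homogeneous d G" and k: "vex (phi T G) k" and n: "vge (phi T F) (k + n)"
  obtains e F1 G1 where "homogeneous e F1" "homogeneous e G1" "evk G1 T \<noteq> 0" "C dvd F * G1 - F1 * G"
    "vge (phi T F1) n"
proof -
  have xi: "vex (phi T xi) 1" "homogeneous 1 xi" and U: "evk U T \<noteq> 0"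
    using L by (simp_all add: local_data_def)
  have xik: "vex (phi T xi ^ k) k" using vex_power[OF xi(1), of k] by simp
  have "vex (phi T U) 0" using U phi_nth_0[OF T] by (simp add: vex_def)
  from vex_power[OF this, of k] have Uk: "vex (phi T U ^ k) 0" by simp
  have Fk: "vge (phi T F) k" and Gk: "vge (phi T G) k"
    using vge_mono[OF n, of k] k by (simp_all add: vex_def)
  obtain F1 e where F1: "e + k = d + k * q" "homogeneous e F1" "C dvd U ^ k * F - xi ^ k * F1"
    using local_power[OF T L F Fk] by blast
  obtain G1 e' where G1: "e' + k = d + k * q" "homogeneous e' G1" "C dvd U ^ k * G - xi ^ k * G1"
    using local_power[OF T L G Gk] by blast
  have e: "e' = e" using F1(1) G1(1) by simp
  have "vex (phi T xi ^ k * phi T G1) (k + 0)"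
    using vex_mult[OF Uk k] phi_dvd_diff[OF T G1(3)] by (simp add: phi_simps)
  then have "vex (phi T G1) 0" by (rule vex_cancel[OF xik])
  then have G1T: "evk G1 T \<noteq> 0" using phi_nth_0[OF T] by (simp add: vex_def)
  have "vge (phi T xi ^ k * phi T F1) (k + n)"
    using vge_mult_right[OF n, of "phi T U ^ k"] phi_dvd_diff[OF T F1(3)] by (simp add: phi_simps)
  then have F1n: "vge (phi T F1) n"
    using xik vge_cancel[of "phi T xi ^ k" k "phi T F1" n] by (simp add: vex_def)
  have "xi ^ k * (F * G1 - F1 * G) = G * (U ^ k * F - xi ^ k * F1) - F * (U ^ k * G - xi ^ k * G1)"
    by (simp add: algebra_simps)
  then have "C dvd xi ^ k * (F * G1 - F1 * G)"
    using F1(3) G1(3) by simp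
  moreover have "\<not> C dvd xi ^ k"
    using phi_dvd[OF T, of "xi ^ k"] vex_nonzero[OF xik] by (auto simp: phi_simps)
  moreover have "homogeneous (e + d) (F * G1 - F1 * G)"
    using homogeneous_mult[OF F1(2) G] homogeneous_mult[OF F G1(2)] unfolding e
    by (intro homogeneous_diff) (simp_all add: add.commute)
  ultimately have "C dvd F * G1 - F1 * G"
    using C_dvd_mult[OF homogeneous_power1[OF xi(2)]] by blast
  then show thesis using that F1(2) G1(2) e G1T F1n by blast
qed

text \<open>For given \<open>F\<close> and \<open>G\<close>, the relation between the two fractions
  is linear in \<open>F1\<close> and \<open>G1\<close> with coefficients over the base field, so
  every functional preserves it. It is chosen such that the new denominator stays nonzero at
  \<open>T\<close>.\<close>

lemma descend_fraction:
  assumes T: "T \<in> pts" and F: "homogeneous d F" "homogeneous d G" "\<not> C0 dvd G"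
    and F1: "homogeneous e F1" "homogeneous e G1" "evk G1 T \<noteq> 0" "C dvd base_change F * G1 - F1 * base_change G"
  obtains l where "functional l" "(descend l F1, descend l G1) \<in> cls F G"
    "\<not> vanishes_at (descend l G1) (ppoint_of T)"
proof -
  obtain l where l: "functional l" "ev3 to_ac (descend l G1) T \<noteq> 0"
    using eval_descend_nonzero[OF F1(2)] F1(3) unfolding evk_def by blast
  have h: "homogeneous e (descend l F1)" "homogeneous e (descend l G1)"
    using homogeneous_descend[OF l(1)] F1 by auto
  have nv: "\<not> vanishes_at (descend l G1) (ppoint_of T)"
    using vanishes_iff[OF h(2)] l(2) by (simp add: evk_base_change)
  obtain E where E: "base_change F * G1 - base_change G * F1 = base_change C0 * E"
  proof -
    obtain E where "base_change F * G1 - F1 * base_change G = C * E"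
      using F1(4) by (elim dvdE)
    then show ?thesis
      using that by (simp only: base_change_hermitian_form mult.commute[of "base_change G"])
  qed
  have "F * descend l G1 - G * descend l F1 = C0 * descend l E"
    using arg_cong[OF E, of "descend l"] by (simp add: descend_diff[OF l(1)] descend(2)[OF l(1)])
  then have "C0 dvd F * descend l G1 - descend l F1 * G" by (simp add: mult.commute)
  then have "(descend l F1, descend l G1) \<in> cls F G"
    unfolding mem_cls[OF F] using h not_vanishes_not_dvd[OF T h(2) nv] by blast
  then show thesis using that l(1) nv by blast
qed

text \<open>Orders are taken over the closure, the local ring over the base field;
  \<open>descend_fraction\<close> closes the gap.\<close>

lemma local_ring_iff:
  assumes T: "T \<in> pts" and F: "homogeneous d F" "homogeneous d G" "\<not> C0 dvd G" and k: "vex (phi0 T G) k"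
  shows "cls F G \<in> local_ring C0 (ppoint_of T) \<longleftrightarrow> vge (phi0 T F) k"
proof
  assume "cls F G \<in> local_ring C0 (ppoint_of T)"
  then obtain F' G' where FG': "(F', G') \<in> cls F G" and nv: "\<not> vanishes_at G' (ppoint_of T)"
    by (auto simp: local_ring_def)
  then obtain e where e: "homogeneous e G'" and dvd: "C0 dvd F * G' - F' * G"
    unfolding mem_cls[OF F] by blast
  have "fps_nth (phi0 T G') 0 \<noteq> 0" using vanishes_phi0[OF T e] nv by simp
  moreover have "vge (phi0 T G' * phi0 T F) (0 + k)"
    using phi0_cross[OF T dvd] vge_mult_right[of "phi0 T G" k "phi0 T F'"] k
    by (simp add: vex_def mult.commute)
  ultimately show "vge (phi0 T F) k" using vge_cancel[OF vge_0] by blast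
next
  assume "vge (phi0 T F) k"
  then have v: "vge (phi0 T F) (k + 0)" by simp
  obtain xi U where L: "local_data T xi U" using local_data_exists[OF T] by blast
  have hb: "homogeneous d (base_change F)" "homogeneous d (base_change G)"
    using F homogeneous_base_change by blast+
  obtain e F1 G1 where F1: "homogeneous e F1" "homogeneous e G1" "evk G1 T \<noteq> 0"
      "C dvd base_change F * G1 - F1 * base_change G"
    using local_fraction[OF T L hb k v] by blast
  obtain l where "(descend l F1, descend l G1) \<in> cls F G" "\<not> vanishes_at (descend l G1) (ppoint_of T)"
    using descend_fraction[OF T F F1] by blast
  then show "cls F G \<in> local_ring C0 (ppoint_of T)"
    unfolding local_ring_def using cls_in_function_field[OF F] by blast
qed

lemma point_ideal_power_order:
  assumes T: "T \<in> pts" and F: "F \<in> point_ideal_power (ppoint_of T) n"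
  shows "vge (phi0 T F) n"
proof -
  interpret Modules.module "(*) :: 'a poly3 \<Rightarrow> 'a poly3 \<Rightarrow> 'a poly3" by (rule module_times)
  show ?thesis
    using F unfolding point_ideal_power_def
  proof (induction rule: span_induct_alt)
    case base
    then show ?case by (simp add: phi0_simps)
  next
    case (step c x y)
    then obtain f where f: "x = (\<Prod>i<n. f i)" "\<And>i. i < n \<Longrightarrow> \<exists>d. homogeneous d (f i) \<and> vanishes_at (f i) (ppoint_of T)"
      by auto
    have "vge (\<Prod>i<m. phi0 T (f i)) m" if "m \<le> n" for m
      using that
    proof (induction m)
      case (Suc m)
      have "vge (phi0 T (f m)) 1"
        using f(2)[of m] Suc.prems vanishes_phi0[OF T] by (auto simp: vge_def)
      then show ?case
        using Suc vge_mult[of "\<Prod>i<m. phi0 T (f i)" m "phi0 T (f m)" 1] by simp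
    qed simp
    from this[of n] have "vge (phi0 T x) n"
      by (simp add: f(1) phi0_simps)
    then show ?case
      using step.IH by (simp add: phi0_simps vge_add vge_mult_right)
  qed
qed

lemma maximal_ideal_power_order:
  assumes T: "T \<in> pts" and F: "homogeneous d F" "homogeneous d G" "\<not> C0 dvd G" and k: "vge (phi0 T G) k"
    and mem: "cls F G \<in> maximal_ideal_power C0 (ppoint_of T) n"
  shows "vge (phi0 T F) (n + k)"
proof -
  obtain F' G' where FG': "(F', G') \<in> cls F G" and F': "F' \<in> point_ideal_power (ppoint_of T) n"
    and nv: "\<not> vanishes_at G' (ppoint_of T)"
    using mem by (auto simp: maximal_ideal_power_def)
  then obtain e where e: "homogeneous e G'" and dvd: "C0 dvd F * G' - F' * G"
    unfolding mem_cls[OF F] by blast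
  have "fps_nth (phi0 T G') 0 \<noteq> 0" using vanishes_phi0[OF T e] nv by simp
  moreover have "vge (phi0 T G' * phi0 T F) (0 + (n + k))"
    using phi0_cross[OF T dvd] vge_mult[OF point_ideal_power_order[OF T F'] k] by (simp add: mult.commute)
  ultimately show ?thesis using vge_cancel[OF vge_0] by blast
qed

lemma rational_local_data:
  assumes "T \<in> rp"
  obtains xi U where "local_data T (base_change xi) (base_change U)"
proof (cases "T = inf")
  case True
  have "local_data T (base_change var_X) (base_change (var_Y ^ q + var_Y * var_Z ^ (q - 1)))"
    unfolding base_change_simps base_change_gens True by (rule local_data_inf)
  then show thesis by (rule that)
next
  case False
  then obtain x y where xy: "T = (x, y, 1)" "x ^ (q + 1) = y ^ q + y"
    using assms by (auto simp: rp_def pts_def)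
  obtain a b where ab: "x = to_ac a" "y = to_ac b" using assms xy by (auto simp: rp_def)
  have "local_data T (base_change (var_X - con a * var_Z))
      (base_change ((var_Y - con b * var_Z) ^ (q - 1) * var_Z + var_Z ^ q))"
    unfolding base_change_simps base_change_gens xy(1) ab(1)[symmetric] ab(2)[symmetric]
    by (rule local_data_affine[OF xy(2)])
  then show thesis by (rule that)
qed

lemma power_in_point_ideal:
  fixes xi F :: "'a poly3" and P :: "'a ppoint"
  assumes "homogeneous 1 xi" "vanishes_at xi P"
  shows "xi ^ n * F \<in> point_ideal_power P n"
proof -
  interpret Modules.module "(*) :: 'a poly3 \<Rightarrow> 'a poly3 \<Rightarrow> 'a poly3" by (rule module_times)
  have "xi ^ n \<in> {\<Prod>i<n. f i | f. \<forall>i<n. \<exists>d. homogeneous d (f i) \<and> vanishes_at (f i) P}"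
    using assms by (auto intro!: exI[of _ "\<lambda>_. xi"])
  then have "F * xi ^ n \<in> span {\<Prod>i<n. f i | f. \<forall>i<n. \<exists>d. homogeneous d (f i) \<and> vanishes_at (f i) P}"
    by (intro span_scale span_base)
  then show ?thesis by (simp add: point_ideal_power_def mult.commute)
qed

text \<open>At a rational point \<open>xi\<close> has coefficients in the base field, so the factor
  xi^n of the numerator survives the descent and exhibits membership in the n-th power.\<close>

lemma maximal_ideal_power_rational:
  assumes Tr: "T \<in> rp" and F: "homogeneous d F" "homogeneous d G" "\<not> C0 dvd G"
    and k: "vex (phi0 T G) k" and n: "vge (phi0 T F) (k + n)"
  shows "cls F G \<in> maximal_ideal_power C0 (ppoint_of T) n"
proof -
  note T = rp_pts[OF Tr]
  obtain xi U where L: "local_data T (base_change xi) (base_change U)"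
    using rational_local_data[OF Tr] by blast
  have xi: "homogeneous 1 xi" "vanishes_at xi (ppoint_of T)"
  proof -
    show h: "homogeneous 1 xi" using L homogeneous_base_change by (auto simp: local_data_def)
    show "vanishes_at xi (ppoint_of T)" using vanishes_iff[OF h] L by (simp add: local_data_def)
  qed
  have hb: "homogeneous d (base_change F)" "homogeneous d (base_change G)"
    using F homogeneous_base_change by blast+
  obtain e F1 G1 where F1: "homogeneous e F1" "homogeneous e G1" "evk G1 T \<noteq> 0"
      "C dvd base_change F * G1 - F1 * base_change G" "vge (phi T F1) n"
    using local_fraction[OF T L hb k n] by blast
  obtain F2 e2 where F2: "e2 + n = e + n * q" "homogeneous e2 F2"
      "C dvd base_change U ^ n * F1 - base_change xi ^ n * F2"
    using local_power[OF T L F1(1,5)] by blast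
  let ?G2 = "base_change U ^ n * G1"
  have U: "homogeneous q (base_change U)" "homogeneous 1 (base_change xi)" "evk (base_change U) T \<noteq> 0"
    using L by (simp_all add: local_data_def)
  have h1: "homogeneous (e + n * q) ?G2"
    using homogeneous_mult[OF homogeneous_power[OF U(1), of n] F1(2)] by (simp add: add.commute)
  have h2: "homogeneous (e + n * q) (base_change xi ^ n * F2)"
    using homogeneous_mult[OF homogeneous_power1[OF U(2), of n] F2(2)] F2(1) by (simp add: add.commute)
  have "base_change F * ?G2 - base_change xi ^ n * F2 * base_change G
      = base_change U ^ n * (base_change F * G1 - F1 * base_change G)
        + base_change G * (base_change U ^ n * F1 - base_change xi ^ n * F2)"
    by (simp add: algebra_simps)
  then have "C dvd base_change F * ?G2 - base_change xi ^ n * F2 * base_change G"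
    using F1(4) F2(3) by simp
  moreover have "evk ?G2 T \<noteq> 0" using U(3) F1(3) by (simp add: evk_simps)
  ultimately obtain l where l: "functional l"
      "(descend l (base_change xi ^ n * F2), descend l ?G2) \<in> cls F G"
      "\<not> vanishes_at (descend l ?G2) (ppoint_of T)"
    using descend_fraction[OF T F h2 h1] by blast
  have "descend l (base_change xi ^ n * F2) = xi ^ n * descend l F2"
    using descend(2)[OF l(1), of "xi ^ n" F2] by (simp add: base_change_simps)
  then have "descend l (base_change xi ^ n * F2) \<in> point_ideal_power (ppoint_of T) n"
    using power_in_point_ideal[OF xi] by simp
  then show ?thesis
    unfolding maximal_ideal_power_def using l cls_in_function_field[OF F] by blast
qed

lemma ratfun_inverse_cls:
  assumes "homogeneous d F" "homogeneous d G" "\<not> C0 dvd F" "\<not> C0 dvd G"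
  shows "ratfun_inverse (cls F G) = cls G F"
proof -
  have inf: "inf \<in> pts" by (simp add: pts_def)
  have nz: "phi0 inf F \<noteq> 0" "phi0 inf G \<noteq> 0" using phi0_nonzero[OF inf] assms by blast+
  have swap: "(G', F') \<in> cls G F" if m: "(F', G') \<in> cls F G" and a: "homogeneous d F" "homogeneous d G" "\<not> C0 dvd F" "\<not> C0 dvd G"
    and nz: "phi0 inf F \<noteq> 0" for F G F' G'
  proof -
    obtain e where e: "homogeneous e F'" "homogeneous e G'" "\<not> C0 dvd G'" and dvd: "C0 dvd F * G' - F' * G"
      using m unfolding mem_cls[OF a(1,2,4)] by blast
    have "phi0 inf F * phi0 inf G' = phi0 inf F' * phi0 inf G"
      using phi0_cross[OF inf dvd] .
    moreover have "phi0 inf G' \<noteq> 0" using phi0_nonzero[OF inf e(2,3)] .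
    ultimately have "phi0 inf F' \<noteq> 0" using nz by auto
    then have "\<not> C0 dvd F'" using phi_dvd[OF inf] C0_dvd_iff by blast
    moreover have "C0 dvd G * F' - G' * F"
    proof -
      have "G * F' - G' * F = - (F * G' - F' * G)" by (simp add: algebra_simps)
      then show ?thesis using dvd by (simp only: dvd_minus_iff)
    qed
    ultimately show ?thesis unfolding mem_cls[OF a(2,1,3)] using e by blast
  qed
  show ?thesis
    unfolding ratfun_inverse_def
  proof (intro equalityI subsetI)
    fix z assume "z \<in> (\<lambda>(F, G). (G, F)) ` cls F G"
    then show "z \<in> cls G F" using swap[OF _ assms nz(1)] by auto
  next
    fix z assume z: "z \<in> cls G F"
    obtain G' F' where z': "z = (G', F')" by (cases z)
    have "(F', G') \<in> cls F G" using swap[OF z[unfolded z'] assms(2,1,4,3) nz(2)] .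
    then show "z \<in> (\<lambda>(F, G). (G, F)) ` cls F G" unfolding z' by force
  qed
qed

text \<open>Valid at nonrational points, where no parameter over the base field has been
  constructed. The set under \<open>Max\<close> is bounded by
  \<open>maximal_ideal_power_order\<close> and contains 1, since a representative of the inverse
  vanishes at \<open>T\<close> when the fraction is not regular.\<close>

lemma pole_order_0_iff:
  assumes T: "T \<in> pts" and F: "homogeneous d F" "homogeneous d G" "\<not> C0 dvd G" and k: "vex (phi0 T G) k"
  shows "pole_order C0 (ppoint_of T) (cls F G) = 0 \<longleftrightarrow> vge (phi0 T F) k"
proof
  assume "vge (phi0 T F) k"
  then show "pole_order C0 (ppoint_of T) (cls F G) = 0"
    using local_ring_iff[OF T F k] by (simp add: pole_order_def)
next
  assume 0: "pole_order C0 (ppoint_of T) (cls F G) = 0"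
  show "vge (phi0 T F) k"
  proof (rule ccontr)
    assume nv: "\<not> vge (phi0 T F) k"
    then have nl: "cls F G \<notin> local_ring C0 (ppoint_of T)" using local_ring_iff[OF T F k] by simp
    have F0: "phi0 T F \<noteq> 0" using nv by auto
    then obtain l where l: "vex (phi0 T F) l" using vex_exists by blast
    have "l < k" using nv vex_vge[OF l] by simp
    have ndF: "\<not> C0 dvd F" using F0 phi_dvd[OF T] C0_dvd_iff by blast
    have inv: "ratfun_inverse (cls F G) = cls G F" by (rule ratfun_inverse_cls[OF F(1,2) ndF F(3)])
    define S where "S = {n. cls G F \<in> maximal_ideal_power C0 (ppoint_of T) n}"
    have "n + l \<le> k" if "n \<in> S" for n
      using maximal_ideal_power_order[OF T F(2,1) ndF] l that vex_vge[OF k] by (auto simp: S_def vex_def)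
    \<comment> \<open>Finiteness is needed for \<open>Max\<close> to be meaningful.\<close>
    then have "S \<subseteq> {..k}" by fastforce
    then have fin: "finite S" by (rule finite_subset) simp
    have "cls G F \<in> local_ring C0 (ppoint_of T)"
      using local_ring_iff[OF T F(2,1) ndF l] k vge_mono[of "phi0 T G" k l] \<open>l < k\<close> by (simp add: vex_def)
    then obtain G' F' where GF: "(G', F') \<in> cls G F" "\<not> vanishes_at F' (ppoint_of T)"
      by (auto simp: local_ring_def)
    then obtain e where e: "homogeneous e G'" "homogeneous e F'" and dvd: "C0 dvd G * F' - G' * F"
      unfolding mem_cls[OF F(2,1) ndF] by blast
    have "vanishes_at G' (ppoint_of T)"
    proof (rule ccontr)
      assume nvG: "\<not> vanishes_at G' (ppoint_of T)"
      have "C0 dvd F * G' - F' * G"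
      proof -
        have "F * G' - F' * G = - (G * F' - G' * F)" by (simp add: algebra_simps)
        then show ?thesis using dvd by (simp only: dvd_minus_iff)
      qed
      then have "(F', G') \<in> cls F G"
        unfolding mem_cls[OF F] using e not_vanishes_not_dvd[OF T e(1) nvG] by blast
      then show False
        using nl nvG cls_in_function_field[OF F] unfolding local_ring_def by blast
    qed
    then have "G' \<in> point_ideal_power (ppoint_of T) 1"
    proof -
      interpret Modules.module "(*) :: 'a poly3 \<Rightarrow> 'a poly3 \<Rightarrow> 'a poly3" by (rule module_times)
      assume v: "vanishes_at G' (ppoint_of T)"
      show ?thesis
        unfolding point_ideal_power_def
        using e v by (intro span_base) (auto intro!: exI[of _ "\<lambda>_. G'"])
    qed
    then have "1 \<in> S"
      unfolding S_def maximal_ideal_power_def using GF cls_in_function_field[OF F(2,1) ndF] by blast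
    then have "1 \<le> Max S" using fin by simp
    then show False using 0 nl by (simp add: pole_order_def inv S_def)
  qed
qed

lemma pole_order_rational:
  assumes Tr: "T \<in> rp" and F: "homogeneous d F" "homogeneous d G" "\<not> C0 dvd G"
    and k: "vex (phi0 T G) k" and l: "vex (phi0 T F) l" and "l < k"
  shows "pole_order C0 (ppoint_of T) (cls F G) = k - l"
proof -
  note T = rp_pts[OF Tr]
  have ndF: "\<not> C0 dvd F" using vex_nonzero[OF l] phi_dvd[OF T] C0_dvd_iff by blast
  have inv: "ratfun_inverse (cls F G) = cls G F" by (rule ratfun_inverse_cls[OF F(1,2) ndF F(3)])
  have nl: "cls F G \<notin> local_ring C0 (ppoint_of T)"
    using local_ring_iff[OF T F k] vex_vge[OF l] \<open>l < k\<close> by simp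
  have "cls G F \<in> maximal_ideal_power C0 (ppoint_of T) n \<longleftrightarrow> n \<le> k - l" for n
  proof
    assume "cls G F \<in> maximal_ideal_power C0 (ppoint_of T) n"
    then have "vge (phi0 T G) (n + l)"
      using maximal_ideal_power_order[OF T F(2,1) ndF] l by (simp add: vex_def)
    then show "n \<le> k - l" using vex_vge[OF k] by simp
  next
    assume "n \<le> k - l"
    then have "vge (phi0 T G) (l + n)" using vex_vge[OF k] \<open>l < k\<close> by simp
    then show "cls G F \<in> maximal_ideal_power C0 (ppoint_of T) n"
      by (rule maximal_ideal_power_rational[OF Tr F(2,1) ndF l])
  qed
  then have "{n. ratfun_inverse (cls F G) \<in> maximal_ideal_power C0 (ppoint_of T) n} = {..k - l}"
    unfolding inv by auto
  moreover have "Max {..k - l} = k - l" by (rule Max_eqI) auto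
  ultimately show ?thesis
    using nl by (simp add: pole_order_def)
qed

end

section \<open>Weierstrass semigroups\<close>

context hermitian_ff
begin

text \<open>After division by xi^j, the leading coefficient becomes a nonzero multiple of the value
  at the rational point \<open>x\<close>, and there evaluation commutes with functionals. The
  element \<open>c\<close> is that value.\<close>

lemma descend_order:
  assumes x: "x \<in> rp" and F: "homogeneous d F" "vge (phi x F) j"
  shows "\<exists>c. (fps_nth (phi x F) j \<noteq> 0 \<longrightarrow> c \<noteq> 0) \<and> (\<forall>l. functional l \<longrightarrow>
    vge (phi0 x (descend l F)) j \<and> (l c \<noteq> 0 \<longrightarrow> fps_nth (phi0 x (descend l F)) j \<noteq> 0))"
proof -
  note T = rp_pts[OF x]
  obtain xi U where L: "local_data x (base_change xi) (base_change U)"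
    using rational_local_data[OF x] by blast
  obtain F2 e where F2: "homogeneous e F2" "C dvd base_change U ^ j * F - base_change xi ^ j * F2"
    using local_power[OF T L F] by blast
  obtain u v w where uvw: "x = (to_ac u, to_ac v, to_ac w)" using x by (auto simp: rp_def)
  have "vex (phi0 x U) 0" "vex (phi0 x xi) 1"
    using L phi_nth_0[OF T] by (simp_all add: local_data_def vex_def)
  from vex_power[OF this(1), of j] vex_power[OF this(2), of j]
  have U: "vge (phi0 x U ^ j) 0" "fps_nth (phi0 x U ^ j) 0 \<noteq> 0"
    and xi: "vge (phi0 x xi ^ j) j" "fps_nth (phi0 x xi ^ j) j \<noteq> 0"
    by (simp_all add: vex_def)
  have rel: "vge H j" "fps_nth H j \<noteq> 0 \<longleftrightarrow> fps_nth H2 0 \<noteq> 0"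
    if "phi0 x U ^ j * H = phi0 x xi ^ j * H2" for H H2
  proof -
    have "vge (phi0 x U ^ j * H) (0 + j)"
      unfolding that using vge_mult_left[OF xi(1)] by simp
    then show H: "vge H j" by (rule vge_cancel[OF U])
    have "fps_nth (phi0 x U ^ j) 0 * fps_nth H j = fps_nth (phi0 x xi ^ j) j * fps_nth H2 0"
      using vge_nth_mult[OF U(1) H] vge_nth_mult[OF xi(1) vge_0, of H2] that by simp
    then show "fps_nth H j \<noteq> 0 \<longleftrightarrow> fps_nth H2 0 \<noteq> 0" using U(2) xi(2) by auto
  qed
  show ?thesis
  proof (intro exI[of _ "evk F2 x"] conjI impI allI)
    have "phi0 x U ^ j * phi x F = phi0 x xi ^ j * phi x F2"
      using phi_dvd_diff[OF T F2(2)] by (simp add: phi_simps)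
    from rel(2)[OF this] show "evk F2 x \<noteq> 0" if "fps_nth (phi x F) j \<noteq> 0"
      using that phi_nth_0[OF T] by simp
  next
    fix l :: "'a alg_closure \<Rightarrow> 'a" assume l: "functional l"
    obtain E where "base_change U ^ j * F - base_change xi ^ j * F2 = C * E"
      using F2(2) by (elim dvdE)
    then have "base_change (U ^ j) * F - base_change (xi ^ j) * F2 = base_change C0 * E"
      by (simp add: base_change_simps base_change_hermitian_form)
    from arg_cong[OF this, of "descend l"]
    have "U ^ j * descend l F - xi ^ j * descend l F2 = C0 * descend l E"
      by (simp only: descend_diff[OF l] descend(2)[OF l])
    then have "C0 dvd U ^ j * descend l F - xi ^ j * descend l F2" by simp
    then have "C dvd base_change (U ^ j * descend l F) - base_change (xi ^ j * descend l F2)"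
      unfolding C0_dvd_iff base_change_simps .
    from phi_dvd_diff[OF T this]
    have eq: "phi0 x U ^ j * phi0 x (descend l F) = phi0 x xi ^ j * phi0 x (descend l F2)"
      by (simp add: phi0_simps)
    show "vge (phi0 x (descend l F)) j" by (rule rel(1)[OF eq])
    have "fps_nth (phi0 x (descend l F2)) 0 = to_ac (ev3 (\<lambda>c. c) (descend l F2) (u, v, w))"
      using phi_nth_0[OF T] ring_homo_ev3_compose[OF ring_homo_id ring_homo_to_ac, of "descend l F2" u v w]
      by (simp add: evk_base_change uvw)
    also have "\<dots> = to_ac (l (evk F2 x))"
      using eval_descend_rational[OF l F2(1), of u v w] by (simp add: evk_def uvw)
    finally show "fps_nth (phi0 x (descend l F)) j \<noteq> 0" if "l (evk F2 x) \<noteq> 0"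
      using rel(2)[OF eq] that by simp
  qed
qed

lemma tprod_base_change:
  assumes "finite P" "P \<subseteq> rp"
  shows "\<exists>L. base_change L = tprod P f"
  using assms
proof (induction P rule: finite_induct)
  case empty
  show ?case by (rule exI[of _ 1]) (simp add: tprod_def base_change_simps)
next
  case (insert x P)
  then obtain L where L: "base_change L = tprod P f" by blast
  obtain a b c where abc: "x = (to_ac a, to_ac b, to_ac c)" using insert.prems by (auto simp: rp_def)
  have "base_change (con (a ^ q) * var_X - con (c ^ q) * var_Y - con (b ^ q) * var_Z) = tng x"
    by (simp add: abc tng_def base_change_simps base_change_gens)
  then have "base_change ((con (a ^ q) * var_X - con (c ^ q) * var_Y - con (b ^ q) * var_Z) ^ f x * L)
      = tprod (insert x P) f"
    using insert.hyps L by (simp add: tprod_def base_change_simps)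
  then show ?case by blast
qed

end

locale hermitian_rational_triple = hermitian_ff q r K
  for q r and K :: "'a::{field,finite} alg_closure itself" +
  fixes p p' p'' :: "'a alg_closure \<times> 'a alg_closure \<times> 'a alg_closure"
  assumes rp: "p \<in> rp" "p' \<in> rp" "p'' \<in> rp"
    and distinct: "p \<noteq> p'" "p \<noteq> p''" "p' \<noteq> p''"
begin

definition S where "S = {p, p', p''}"

definition ord :: "nat \<times> nat \<times> nat \<Rightarrow> 'a alg_closure \<times> 'a alg_closure \<times> 'a alg_closure \<Rightarrow> nat" where
  "ord abc x = (case abc of (a, b, c) \<Rightarrow> if x = p then a else if x = p' then b else c)"

lemma S: "finite S" "S \<subseteq> rp" "S \<subseteq> rpts" "card S = 3"
  using rp rp_rpts distinct by (auto simp: S_def)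

lemma triple: "hermitian_triple q r p p' p''"
  by unfold_locales (use rp rp_rpts distinct in auto)

lemma Wset_iff:
  assumes n: "q \<le> n" and g: "\<And>x. ord abc x \<le> n * (q + 1)"
  shows "abc \<in> Wset p p' p'' \<longleftrightarrow> (\<forall>x\<in>S. 0 < ord abc x \<longrightarrow> (\<exists>F. homogeneous (3 * n) F \<and>
    (\<forall>y\<in>S. vge (phi y F) (n * (q + 1) - ord abc y)) \<and> fps_nth (phi x F) (n * (q + 1) - ord abc x) \<noteq> 0))"
proof -
  obtain a b c where abc: "abc = (a, b, c)" by (cases abc)
  have o: "ord abc p = a" "ord abc p' = b" "ord abc p'' = c"
    using distinct by (auto simp: ord_def abc)
  have le: "a \<le> n * (q + 1)" "b \<le> n * (q + 1)" "c \<le> n * (q + 1)"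
    using g[of p] g[of p'] g[of p''] unfolding o by simp_all
  note r = rp[THEN subsetD[OF rp_rpts]]
  have J: "(\<exists>F. homogeneous (3 * n) F \<and> (\<forall>y\<in>{x0, x1, x2}. vge (phi y F) (n * (q + 1) - ord abc y)) \<and>
      fps_nth (phi x0 F) (n * (q + 1) - ord abc x0) \<noteq> 0)
    \<longleftrightarrow> (\<exists>F. homogeneous (3 * n) F \<and> vex (phi x0 F) (n * (q + 1) - ord abc x0) \<and>
      vge (phi x1 F) (n * (q + 1) - ord abc x1) \<and> vge (phi x2 F) (n * (q + 1) - ord abc x2))" for x0 x1 x2
    unfolding vex_def by blast
  have S': "S = {p', p'', p}" "S = {p'', p, p'}" by (auto simp: S_def)
  have 1: "a = 0 \<or> \<not> E (q - 2) p p' p'' (a - 1) b c \<longleftrightarrow> (0 < ord abc p \<longrightarrow> (\<exists>F. homogeneous (3 * n) F \<and>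
    (\<forall>y\<in>S. vge (phi y F) (n * (q + 1) - ord abc y)) \<and> fps_nth (phi p F) (n * (q + 1) - ord abc p) \<noteq> 0))"
    unfolding S_def J unfolding o using duality_E[OF r distinct n, of a b c] le by (cases "a = 0") simp_all
  have 2: "b = 0 \<or> \<not> E (q - 2) p' p'' p (b - 1) c a \<longleftrightarrow> (0 < ord abc p' \<longrightarrow> (\<exists>F. homogeneous (3 * n) F \<and>
    (\<forall>y\<in>S. vge (phi y F) (n * (q + 1) - ord abc y)) \<and> fps_nth (phi p' F) (n * (q + 1) - ord abc p') \<noteq> 0))"
    unfolding S'(1) J unfolding o using duality_E[OF r(2,3,1) _ _ _ n, of b c a] distinct le by (cases "b = 0") auto
  have 3: "c = 0 \<or> \<not> E (q - 2) p'' p p' (c - 1) a b \<longleftrightarrow> (0 < ord abc p'' \<longrightarrow> (\<exists>F. homogeneous (3 * n) F \<and>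
    (\<forall>y\<in>S. vge (phi y F) (n * (q + 1) - ord abc y)) \<and> fps_nth (phi p'' F) (n * (q + 1) - ord abc p'') \<noteq> 0))"
    unfolding S'(2) J unfolding o using duality_E[OF r(3,1,2) _ _ _ n, of c a b] distinct le by (cases "c = 0") auto
  have "abc \<in> Wset p p' p'' \<longleftrightarrow> (a = 0 \<or> \<not> E (q - 2) p p' p'' (a - 1) b c) \<and>
     (b = 0 \<or> \<not> E (q - 2) p' p'' p (b - 1) c a) \<and> (c = 0 \<or> \<not> E (q - 2) p'' p p' (c - 1) a b)"
    by (simp add: Wset_def abc)
  also have "\<dots> \<longleftrightarrow> (\<forall>x\<in>{p, p', p''}. 0 < ord abc x \<longrightarrow> (\<exists>F. homogeneous (3 * n) F \<and>
    (\<forall>y\<in>S. vge (phi y F) (n * (q + 1) - ord abc y)) \<and> fps_nth (phi x F) (n * (q + 1) - ord abc x) \<noteq> 0))"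
    unfolding 1 2 3 by blast
  finally show ?thesis by (simp only: S_def)
qed

lemma weierstrass_iff:
  "abc \<in> weierstrass_semigroup C0 (ppoint_of p) (ppoint_of p') (ppoint_of p'') \<longleftrightarrow>
    (\<exists>f\<in>function_field C0. \<forall>T\<in>pts. pole_order C0 (ppoint_of T) f = (if T \<in> S then ord abc T else 0))"
proof -
  obtain a b c where abc: "abc = (a, b, c)" by (cases abc)
  have eq: "ppoint_of T = ppoint_of x \<longleftrightarrow> T = x" if "T \<in> pts" "x \<in> rp" for T x
    using inj_on_eq_iff[OF ppoint_of_inj that(1) rp_pts[OF that(2)]] .
  have D: "a * point_divisor (ppoint_of p) (ppoint_of T) + b * point_divisor (ppoint_of p') (ppoint_of T)
      + c * point_divisor (ppoint_of p'') (ppoint_of T) = (if T \<in> S then ord abc T else 0)" if "T \<in> pts" for T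
    using that rp distinct by (auto simp: point_divisor_def eq S_def ord_def abc)
  have out: "a * point_divisor (ppoint_of p) T + b * point_divisor (ppoint_of p') T
      + c * point_divisor (ppoint_of p'') T = 0" if "T \<notin> curve_points C0" for T
  proof -
    have "T \<noteq> ppoint_of x" if "x \<in> rp" for x
      using \<open>T \<notin> curve_points C0\<close> rp_pts[OF that] unfolding curve_points_eq by blast
    then show ?thesis using rp by (simp add: point_divisor_def)
  qed
  have "(\<lambda>T. a * point_divisor (ppoint_of p) T + b * point_divisor (ppoint_of p') T
      + c * point_divisor (ppoint_of p'') T) = pole_divisor C0 f
    \<longleftrightarrow> (\<forall>T\<in>pts. pole_order C0 (ppoint_of T) f = (if T \<in> S then ord abc T else 0))" (is "?D = _ \<longleftrightarrow> ?R") for f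
  proof
    assume e: "?D = pole_divisor C0 f"
    show ?R
    proof
      fix T assume T: "T \<in> pts"
      then show "pole_order C0 (ppoint_of T) f = (if T \<in> S then ord abc T else 0)"
        using fun_cong[OF e, of "ppoint_of T"] D[OF T] unfolding pole_divisor_def curve_points_eq by auto
    qed
  next
    assume R: ?R
    show "?D = pole_divisor C0 f"
    proof
      fix T
      show "?D T = pole_divisor C0 f T"
      proof (cases "T \<in> curve_points C0")
        case True
        then obtain t where t: "t \<in> pts" "T = ppoint_of t" unfolding curve_points_eq by blast
        then show ?thesis using True D[OF t(1)] R by (simp add: pole_divisor_def)
      next
        case False
        then show ?thesis using out by (simp add: pole_divisor_def)
      qed
    qed
  qed
  then show ?thesis by (simp add: weierstrass_semigroup_def abc)
qed

text \<open>Given a function, Noether's theorem rewrites it with the product of tangents as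
  denominator. Conversely, duality yields for each point a form over the closure with the extremal
  order there; these are descended and combined into one numerator.\<close>

lemma weierstrass_eq:
  "weierstrass_semigroup C0 (ppoint_of p) (ppoint_of p') (ppoint_of p'') = Wset p p' p''"
proof (rule Set.set_eqI)
  fix abc :: "nat \<times> nat \<times> nat"
  obtain a b c where abc: "abc = (a, b, c)" by (cases abc)
  \<comment> \<open>Large enough for n tangents at each point to absorb all three poles, and at
    least q as duality demands.\<close>
  define n where "n = q + a + b + c"
  define M where "M = n * (q + 1)"
  define g where "g = ord abc"
  have n: "q \<le> n" by (simp add: n_def)
  have gM: "g x \<le> M" for x
  proof -
    have "g x \<le> n" by (auto simp: g_def ord_def abc n_def)
    also have "n * 1 \<le> n * (q + 1)" by (intro mult_le_mono) simp_all
    finally show ?thesis by (simp add: M_def)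
  qed
  note W = Wset_iff[of n abc, folded g_def M_def, OF n gM]
  let ?L = "tprod S (\<lambda>_. n)"
  have hL: "homogeneous (3 * n) ?L"
    using homogeneous_tprod[OF S(1), of "\<lambda>_. n"] S(4) by simp
  have vL: "vex (phi T ?L) (if T \<in> S then M else 0)" if "T \<in> pts" for T
    using vex_tprod[OF S(1,3) that, of "\<lambda>_. n"] unfolding M_def .
  have Spts: "x \<in> pts" if "x \<in> S" for x using that S(3) rpts_pts by blast
  show "abc \<in> weierstrass_semigroup C0 (ppoint_of p) (ppoint_of p') (ppoint_of p'') \<longleftrightarrow> abc \<in> Wset p p' p''"
    unfolding weierstrass_iff W g_def[symmetric]
  proof
    assume "\<exists>f\<in>function_field C0. \<forall>T\<in>pts. pole_order C0 (ppoint_of T) f = (if T \<in> S then g T else 0)"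
    then obtain f where f: "f \<in> function_field C0"
      and po: "\<And>T. T \<in> pts \<Longrightarrow> pole_order C0 (ppoint_of T) f = (if T \<in> S then g T else 0)" by blast
    obtain d F G where F: "homogeneous d F" "homogeneous d G" "\<not> C0 dvd G" and fFG: "f = cls F G"
      using function_field_cases[OF f] by metis
    have key: "vge (phi0 T F) k \<and> (T \<in> S \<longrightarrow> g T = 0) \<or> T \<in> S \<and> 0 < g T \<and> g T \<le> k \<and> vex (phi0 T F) (k - g T)"
      if T: "T \<in> pts" and k: "vex (phi0 T G) k" for T k
    proof (cases "vge (phi0 T F) k")
      case True
      then show ?thesis
        using pole_order_0_iff[OF T F k] po[OF T] fFG by auto
    next
      case False
      then have pos: "pole_order C0 (ppoint_of T) f \<noteq> 0"
        using pole_order_0_iff[OF T F k] fFG by simp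
      then have TS: "T \<in> S" "0 < g T" using po[OF T] by (auto split: if_splits)
      obtain l where l: "vex (phi0 T F) l" using False vex_exists by (metis vge_zero)
      have lk: "l < k" using False vex_vge[OF l] by simp
      have "k - l = g T"
        using pole_order_rational[OF _ F k l lk] TS S(2) po[OF T] fFG by auto
      then have "g T \<le> k" "k - g T = l" using lk by simp_all
      then show ?thesis using TS l by simp
    qed
    have hb: "homogeneous d (base_change F)" "homogeneous d (base_change G)"
      using F homogeneous_base_change by blast+
    \<comment> \<open>The deficit of \<open>F\<close> against \<open>G\<close> is
      \<open>g T\<close>, at most the order M of \<open>?L\<close>.\<close>
    have "order_dom (base_change F * ?L) (base_change G)"
      unfolding order_dom_def
    proof (intro ballI allI impI)
      fix T m assume T: "T \<in> pts" and m: "vge (phi0 T G) m"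
      obtain k where k: "vex (phi0 T G) k" using vex_exists phi0_nonzero[OF T F(2,3)] by blast
      have mk: "m \<le> k" using m vex_vge[OF k] by simp
      from key[OF T k] have "vge (phi T (base_change F * ?L)) k"
      proof
        assume "vge (phi0 T F) k \<and> (T \<in> S \<longrightarrow> g T = 0)"
        then show ?thesis by (simp add: phi_simps vge_mult_left)
      next
        assume a: "T \<in> S \<and> 0 < g T \<and> g T \<le> k \<and> vex (phi0 T F) (k - g T)"
        have v: "vex (phi T (base_change F * ?L)) (k - g T + M)"
          using vex_mult[of "phi0 T F" "k - g T" "phi T ?L" M] vL[OF T] a by (simp add: phi_simps)
        then show ?thesis using vex_vge[OF v, of k] gM[of T] by simp
      qed
      then show "vge (phi T (base_change F * ?L)) m" using vge_mono mk by blast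
    qed
    moreover have "\<not> C dvd base_change G" using F(3) C0_dvd_iff by blast
    ultimately obtain F1 where F1: "homogeneous (3 * n) F1" "C dvd base_change F * ?L - base_change G * F1"
      using noether[OF homogeneous_mult[OF hb(1) hL] hb(2)] by blast
    have F1x: "vge (phi x F1) (M - g x) \<and> (0 < g x \<longrightarrow> fps_nth (phi x F1) (M - g x) \<noteq> 0)" if x: "x \<in> S" for x
    proof -
      note T = Spts[OF x]
      obtain k where k: "vex (phi0 x G) k" using vex_exists phi0_nonzero[OF T F(2,3)] by blast
      have e: "phi0 x F * phi x ?L = phi0 x G * phi x F1"
        using phi_dvd_diff[OF T F1(2)] by (simp add: phi_simps)
      have L: "vex (phi x ?L) M" using vL[OF T] x by simp
      from key[OF T k] show ?thesis
      proof
        assume a: "vge (phi0 x F) k \<and> (x \<in> S \<longrightarrow> g x = 0)"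
        then have "vge (phi0 x G * phi x F1) (k + M)"
          unfolding e[symmetric] using L by (intro vge_mult) (simp_all add: vex_def)
        then have "vge (phi x F1) M" using k vge_cancel[of "phi0 x G" k] by (simp add: vex_def)
        then show ?thesis using a x by simp
      next
        assume a: "x \<in> S \<and> 0 < g x \<and> g x \<le> k \<and> vex (phi0 x F) (k - g x)"
        then have "vex (phi0 x G * phi x F1) (k - g x + M)"
          unfolding e[symmetric] using L by (intro vex_mult) simp_all
        moreover have "k - g x + M = k + (M - g x)" using a gM[of x] by simp
        ultimately have "vex (phi x F1) (M - g x)" using vex_cancel[OF k] by simp
        then show ?thesis by (simp add: vex_def)
      qed
    qed
    show "\<forall>x\<in>S. 0 < g x \<longrightarrow> (\<exists>F. homogeneous (3 * n) F \<and> (\<forall>y\<in>S. vge (phi y F) (M - g y)) \<and>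
        fps_nth (phi x F) (M - g x) \<noteq> 0)"
      using F1(1) F1x by blast
  next
    assume J: "\<forall>x\<in>S. 0 < g x \<longrightarrow> (\<exists>F. homogeneous (3 * n) F \<and> (\<forall>y\<in>S. vge (phi y F) (M - g y)) \<and>
        fps_nth (phi x F) (M - g x) \<noteq> 0)"
    define V where "V = {F. homogeneous (3 * n) F \<and> (\<forall>y\<in>S. vge (phi0 y F) (M - g y))}"
    define N where "N = {x \<in> S. 0 < g x}"
    \<comment> \<open>The coefficient whose nonvanishing makes the pole order at \<open>x\<close>
      exactly \<open>g x\<close>.\<close>
    define psi where "psi x F = fps_nth (phi0 x F) (M - g x)" for x F
    have "card N \<le> card S" unfolding N_def by (intro card_mono S) auto
    \<comment> \<open>At most three conditions against at least four scalars, even for q =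
      2.\<close>
    moreover have "2 ^ 2 \<le> q ^ 2" using q_ge_2 by (rule power_mono) simp
    ultimately have N: "finite N" "card N < card (UNIV :: 'a set)"
      using S(1,4) by (simp_all add: N_def card_field)
    have V0: "0 \<in> V" by (simp add: V_def homogeneous_0 phi0_simps)
    have Vadd: "F + con s * G \<in> V" if "F \<in> V" "G \<in> V" for F G s
      using that by (simp add: V_def homogeneous_add homogeneous_con_mult phi0_simps base_change_gens phi_con
          vge_add vge_mult_right)
    have psi_add: "psi x (F + con s * G) = psi x F + to_ac s * psi x G" for x F G s
      by (simp add: psi_def phi0_simps base_change_gens phi_con)
    have "\<exists>F\<in>V. psi x F \<noteq> 0" if x: "x \<in> N" for x
    proof -
      obtain F where F: "homogeneous (3 * n) F" "\<And>y. y \<in> S \<Longrightarrow> vge (phi y F) (M - g y)"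
        "fps_nth (phi x F) (M - g x) \<noteq> 0"
        using J x unfolding N_def by blast
      have xS: "x \<in> S" using x by (simp add: N_def)
      then have xrp: "x \<in> rp" using S(2) by blast
      obtain c where c: "c \<noteq> 0"
        "\<And>l. functional l \<Longrightarrow> l c \<noteq> 0 \<Longrightarrow> fps_nth (phi0 x (descend l F)) (M - g x) \<noteq> 0"
        using descend_order[OF xrp F(1) F(2)[OF xS]] F(3) by blast
      obtain l where l: "functional l" "l c = 1" using functional_exists[OF c(1)] by blast
      have "vge (phi0 y (descend l F)) (M - g y)" if "y \<in> S" for y
        using descend_order[OF subsetD[OF S(2) that] F(1) F(2)[OF that]] l(1) by blast
      then have "descend l F \<in> V"
        using homogeneous_descend[OF l(1) F(1)] by (simp add: V_def)
      moreover have "psi x (descend l F) \<noteq> 0"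
        using c(2)[OF l(1)] l(2) by (simp add: psi_def)
      ultimately show ?thesis by blast
    qed
    from combine_nonvanishing[OF N V0, of psi, OF Vadd psi_add this]
    obtain F where F: "F \<in> V" "\<forall>x\<in>N. psi x F \<noteq> 0" by blast
    obtain L0 where L0: "base_change L0 = ?L" using tprod_base_change[OF S(1,2)] by blast
    have h: "homogeneous (3 * n) F" "homogeneous (3 * n) L0"
      using F(1) hL homogeneous_base_change[of "3 * n" L0] L0 by (simp_all add: V_def)
    have inf: "inf \<in> pts" by (simp add: pts_def)
    have ndvd: "\<not> C0 dvd L0"
    proof
      assume "C0 dvd L0"
      then have "phi inf ?L = 0" using phi_dvd[OF inf] by (simp only: C0_dvd_iff L0)
      then show False using vex_nonzero[OF vL[OF inf]] by simp
    qed
    have "pole_order C0 (ppoint_of T) (cls F L0) = (if T \<in> S then g T else 0)" if T: "T \<in> pts" for T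
    proof (cases "T \<in> S \<and> 0 < g T")
      case True
      have k: "vex (phi0 T L0) M" using vL[OF T] True L0 by simp
      have l: "vex (phi0 T F) (M - g T)"
        using F True unfolding V_def N_def psi_def vex_def by blast
      have lt: "M - g T < M" using True gM[of T] by simp
      have "pole_order C0 (ppoint_of T) (cls F L0) = M - (M - g T)"
        using pole_order_rational[OF _ h ndvd k l lt] True S(2) by blast
      then show ?thesis using True gM[of T] by simp
    next
      case False
      have k: "vex (phi0 T L0) (if T \<in> S then M else 0)" using vL[OF T] L0 by simp
      have "vge (phi0 T F) (if T \<in> S then M else 0)"
        using F(1) False by (auto simp: V_def)
      then have "pole_order C0 (ppoint_of T) (cls F L0) = 0"
        using pole_order_0_iff[OF T h ndvd k] by blast
      then show ?thesis using False by auto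
    qed
    then show "\<exists>f\<in>function_field C0. \<forall>T\<in>pts. pole_order C0 (ppoint_of T) f = (if T \<in> S then g T else 0)"
      using cls_in_function_field[OF h ndvd] by blast
  qed
qed

end

section \<open>Counting\<close>

context hermitian
begin

lemma neg_power_q_minus_1: "(- x) ^ (q - 1) = (x :: 'k) ^ (q - 1)"
proof (cases "x = 0")
  case False
  have "(- x) * (- x) ^ (q - 1) = (- x) * x ^ (q - 1)"
    using mult_power_q[of "- x"] mult_power_q[of x] frob_minus[of x] by (metis mult_minus_left)
  moreover have "- x \<noteq> 0" using False by simp
  ultimately show ?thesis using mult_left_cancel by blast
qed simp

text \<open>The product N of the three values lies in the field with q^2 elements, so N^(q-1) is a
  (q+1)-st root of unity; the sign disappears because (-1)^(q+1) = 1 in this characteristic.\<close>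

lemma sig3_root_of_unity:
  assumes "hermitian_triple q r p p' p''"
  shows "sig3 p p' p'' ^ (q + 1) = 1"
proof -
  interpret hermitian_triple q r K p p' p'' by fact
  have "(herm x y ^ q) ^ q = herm x y" if "x \<in> rpts" "y \<in> rpts" for x y
    using herm_conj[OF that] herm_conj[OF that(2,1)] by simp
  then have qq: "(al ^ q) ^ q = al" "(be ^ q) ^ q = be" "(ga ^ q) ^ q = ga"
    using rpts by (simp_all add: al_def be_def ga_def)
  define N where "N = al * be * ga"
  have N: "N \<noteq> 0" "(N ^ q) ^ q = N"
    using nonzero qq by (simp_all add: N_def power_mult_distrib)
  define M where "M = N ^ (q - 1)"
  have MN: "M * N = N ^ q" using mult_power_q[of N] by (simp only: M_def mult.commute)
  have "M ^ (q + 1) * N = M ^ q * (M * N)" by simp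
  also have "\<dots> = (M * N) ^ q" unfolding MN by (simp only: power_mult_distrib[symmetric] MN)
  also have "\<dots> = 1 * N" by (simp add: MN N(2))
  finally have "M ^ (q + 1) = 1" using N(1) mult_right_cancel by blast
  moreover have "sig ^ (q + 1) = M ^ (q + 1)"
  proof -
    have "sig = - M" by (simp only: sig_def N_def M_def)
    then show ?thesis by (simp add: frob_minus)
  qed
  ultimately show ?thesis by (simp only: sig_sig3)
qed

end

context hermitian_ff
begin

lemma rational_triple:
  assumes "p \<in> rp" "p' \<in> rp" "p'' \<in> rp" "p \<noteq> p'" "p \<noteq> p''" "p' \<noteq> p''"
  shows "hermitian_rational_triple q r p p' p''" "hermitian_triple q r p p' p''"
proof -
  show 1: "hermitian_rational_triple q r p p' p''"
    by unfold_locales (use assms in auto)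
  show "hermitian_triple q r p p' p''"
    by (rule hermitian_rational_triple.triple[OF 1])
qed

lemma hermitian_semigroups_eq:
  "hermitian_semigroups TYPE('a) q = {Wset p p' p'' | p p' p''. p \<in> rp \<and> p' \<in> rp \<and> p'' \<in> rp \<and>
    p \<noteq> p' \<and> p \<noteq> p'' \<and> p' \<noteq> p''}"
proof (intro equalityI subsetI)
  fix H assume "H \<in> hermitian_semigroups TYPE('a) q"
  then obtain P Q R where PQR: "P \<in> rational_points C0" "Q \<in> rational_points C0" "R \<in> rational_points C0"
    "P \<noteq> Q" "P \<noteq> R" "Q \<noteq> R" and H: "H = weierstrass_semigroup C0 P Q R"
    unfolding hermitian_semigroups_def by blast
  obtain p p' p'' where p: "p \<in> rp" "p' \<in> rp" "p'' \<in> rp" "P = ppoint_of p" "Q = ppoint_of p'" "R = ppoint_of p''"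
    using PQR(1-3) unfolding rational_points_eq by blast
  have d: "p \<noteq> p'" "p \<noteq> p''" "p' \<noteq> p''" using PQR(4-6) p by auto
  have "H = Wset p p' p''"
    using hermitian_rational_triple.weierstrass_eq[OF rational_triple(1)[OF p(1-3) d]] H p by simp
  then show "H \<in> {Wset p p' p'' | p p' p''. p \<in> rp \<and> p' \<in> rp \<and> p'' \<in> rp \<and> p \<noteq> p' \<and> p \<noteq> p'' \<and> p' \<noteq> p''}"
    using p(1-3) d by blast
next
  fix H assume "H \<in> {Wset p p' p'' | p p' p''. p \<in> rp \<and> p' \<in> rp \<and> p'' \<in> rp \<and> p \<noteq> p' \<and> p \<noteq> p'' \<and> p' \<noteq> p''}"
  then obtain p p' p'' where p: "p \<in> rp" "p' \<in> rp" "p'' \<in> rp" and d: "p \<noteq> p'" "p \<noteq> p''" "p' \<noteq> p''"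
    and H: "H = Wset p p' p''" by blast
  have "H = weierstrass_semigroup C0 (ppoint_of p) (ppoint_of p') (ppoint_of p'')"
    using hermitian_rational_triple.weierstrass_eq[OF rational_triple(1)[OF p d]] H by simp
  moreover have rat: "ppoint_of x \<in> rational_points C0" if "x \<in> rp" for x
    unfolding rational_points_eq using that by (rule imageI)
  moreover have ne: "ppoint_of x \<noteq> ppoint_of y" if "x \<in> rp" "y \<in> rp" "x \<noteq> y" for x y
    using inj_on_eq_iff[OF ppoint_of_inj rp_pts[OF that(1)] rp_pts[OF that(2)]] that(3) by simp
  ultimately show "H \<in> hermitian_semigroups TYPE('a) q"
    unfolding hermitian_semigroups_def mem_Collect_eq
    using rat[OF p(1)] rat[OF p(2)] rat[OF p(3)] ne[OF p(1,2) d(1)] ne[OF p(1,3) d(2)] ne[OF p(2,3) d(3)]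
    by (intro exI[of _ "ppoint_of p"] exI[of _ "ppoint_of p'"] exI[of _ "ppoint_of p''"] conjI)
qed

lemma primitive:
  obtains g :: 'a where "\<And>x. x \<noteq> 0 \<Longrightarrow> \<exists>i. x = g ^ i" "\<And>i. g ^ i = 1 \<longleftrightarrow> (q - 1) * (q + 1) dvd i" "g \<noteq> 0"
proof -
  have "q ^ 2 - 1 = (q - 1) * (q + 1)"
    using q_ge_2 by (simp add: power2_eq_square diff_mult_distrib)
  then show thesis
    using primitive_element[where 'a = 'a] that unfolding card_field by metis
qed

text \<open>For \<open>P = (0:1:0)\<close>, \<open>Q = (0:0:1)\<close> and \<open>R = (x:y:1)\<close> the invariant is \<open>- y\<^bsup>q(q - 1)\<^esup>\<close>.\<close>

lemma sig3_attained:
  assumes "d dvd q + 1"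
  shows "\<exists>p p' p''. p \<in> rp \<and> p' \<in> rp \<and> p'' \<in> rp \<and> p \<noteq> p' \<and> p \<noteq> p'' \<and> p' \<noteq> p'' \<and>
    (\<forall>k. sig3 p p' p'' ^ k = 1 \<longleftrightarrow> d dvd k)"
proof -
  obtain g :: 'a where g: "\<And>x. x \<noteq> 0 \<Longrightarrow> \<exists>i. x = g ^ i" "\<And>i. g ^ i = 1 \<longleftrightarrow> (q - 1) * (q + 1) dvd i" "g \<noteq> 0"
    using primitive by blast
  obtain e where e: "q + 1 = d * e" using assms by (elim dvdE)
  then have e0: "e \<noteq> 0" using q_ge_2 by (cases e) auto
  have q1: "q - 1 \<noteq> 0" using q_ge_2 by simp
  \<comment> \<open>As \<open>g\<close> has order (q-1)(q+1) and q + 1 = de, this is an element of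
    order d.\<close>
  define z where "z = g ^ ((q - 1) * e)"
  have z: "z ^ k = 1 \<longleftrightarrow> d dvd k" for k
  proof -
    have "z ^ k = 1 \<longleftrightarrow> ((q - 1) * e) * d dvd ((q - 1) * e) * k"
      unfolding z_def power_mult[symmetric] g(2) e by (simp only: mult_ac)
    also have "\<dots> \<longleftrightarrow> d dvd k" using e0 q1 by (intro dvd_times_left_cancel_iff) simp
    finally show ?thesis .
  qed
  have pw: "x ^ q ^ 2 = x" for x :: 'a
    using power_card_field[of x] by (simp add: card_field)
  have frob: "(x ^ q) ^ q = x" for x :: 'a
    using pw[of x] by (simp add: power2_eq_square power_mult)
  have neg: "(- x) ^ q = - (x ^ q)" for x :: 'a
  proof -
    have "to_ac ((- x) ^ q) = to_ac (- (x ^ q))"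
      by (simp only: to_ac_power to_ac_minus frob_minus)
    then show ?thesis unfolding to_ac_eq_iff .
  qed
  have add: "(x + y) ^ q = x ^ q + y ^ q" for x y :: 'a
  proof -
    have "to_ac ((x + y) ^ q) = to_ac (x ^ q + y ^ q)"
      by (simp only: to_ac_power to_ac_add frob_add)
    then show ?thesis unfolding to_ac_eq_iff .
  qed
  have z0: "z \<noteq> 0" using g(3) by (simp add: z_def)
  \<comment> \<open>The invariant will be -(y^(q-1))^q. Equating it to \<open>z\<close> and taking
    q-th powers gives y^(q-1) = -z^q.\<close>
  define b where "b = - (z ^ q)"
  have b: "b \<noteq> 0" "b ^ (q + 1) = 1"
  proof -
    show "b \<noteq> 0" using z0 by (simp add: b_def)
    have "b ^ (q + 1) = z ^ (q + 1)" by (simp add: b_def neg frob mult.commute)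
    moreover have "z ^ (q + 1) = 1" using z assms by blast
    ultimately show "b ^ (q + 1) = 1" by (simp only:)
  qed
  obtain i where i: "b = g ^ i" using g(1) b(1) by blast
  \<comment> \<open>\<open>b\<close> is a (q-1)-st power because its own (q+1)-st power is
    1.\<close>
  have "(q - 1) * (q + 1) dvd i * (q + 1)"
    using b(2) unfolding i power_mult[symmetric] g(2) .
  then have "q - 1 dvd i" by (subst (asm) dvd_times_right_cancel_iff) simp_all
  then obtain i' where i': "i = (q - 1) * i'" by (elim dvdE)
  define y where "y = g ^ i'"
  have y: "y \<noteq> 0" "y ^ (q - 1) = b"
    using g(3) by (simp_all add: y_def i i' mult.commute flip: power_mult)
  define t where "t = y ^ q + y"
  have tq: "t ^ q = t" by (simp add: t_def add frob add.commute)
  \<comment> \<open>Surjectivity of the norm: \<open>t\<close> satisfies t^q = t, so if nonzero it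
    is a power of \<open>g\<close> with exponent divisible by q + 1.\<close>
  have "\<exists>x. x ^ (q + 1) = t"
  proof (cases "t = 0")
    case True
    then show ?thesis by (intro exI[of _ 0]) simp
  next
    case False
    then obtain j where j: "t = g ^ j" using g(1) by blast
    have "t * t ^ (q - 1) = t * 1" using tq mult_power_q[of t] by simp
    then have "t ^ (q - 1) = 1" using False by simp
    then have "(q - 1) * (q + 1) dvd (q - 1) * j"
      unfolding j power_mult[symmetric] g(2) by (simp only: mult.commute)
    then have "q + 1 dvd j" using q1 by (subst (asm) dvd_times_left_cancel_iff) simp_all
    then obtain j' where "j = (q + 1) * j'" by (elim dvdE)
    then have "(g ^ j') ^ (q + 1) = t" by (simp only: j power_mult[symmetric] mult.commute)
    then show ?thesis ..
  qed
  then obtain x where x: "x ^ (q + 1) = t" ..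
  let ?R = "(to_ac x, to_ac y, 1)" and ?Q = "(0, 0, 1)"
  have "to_ac x ^ (q + 1) = to_ac y ^ q + to_ac y"
    using arg_cong[OF x, of to_ac] by (simp only: t_def to_ac_power to_ac_add)
  then have "?R \<in> pts" unfolding pts_def by blast
  moreover have "?R = (to_ac x, to_ac y, to_ac 1)" by simp
  ultimately have R: "?R \<in> rp" unfolding rp_def by blast
  have "?Q \<in> pts" using q_ge_2 by (simp add: pts_def power_0_left)
  moreover have "?Q = (to_ac 0, to_ac 0, to_ac 1)" by simp
  ultimately have Q: "?Q \<in> rp" unfolding rp_def by blast
  have "inf \<in> pts" by (simp add: pts_def)
  moreover have "inf = (to_ac 0, to_ac 1, to_ac 0)" by simp
  ultimately have P: "inf \<in> rp" unfolding rp_def by blast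
  have "sig3 inf ?Q ?R = - ((- (to_ac y ^ q)) ^ (q - 1))"
    using q_ge_2 by (simp add: sig3_def herm_def power_0_left)
  also have "\<dots> = - (to_ac (y ^ (q - 1)) ^ q)"
    unfolding neg_power_q_minus_1 by (simp add: power_mult[symmetric] mult.commute)
  also have "\<dots> = to_ac z"
    unfolding y(2) b_def by (simp add: frob_minus frob flip: to_ac_power)
  finally have "sig3 inf ?Q ?R ^ k = 1 \<longleftrightarrow> d dvd k" for k
    using z[of k] by (simp flip: to_ac_power)
  moreover have "?Q \<noteq> ?R" using y(1) by simp
  ultimately show ?thesis
    using P Q R by (intro exI[of _ inf] exI[of _ ?Q] exI[of _ ?R]) simp
qed

definition levels :: "nat \<Rightarrow> nat set" where
  "levels d = {k. 1 \<le> k \<and> k \<le> q - 2 \<and> d dvd k}"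

text \<open>Recovers from a semigroup the exponents at which the invariant becomes 1, by the test
  triples of \<open>Wset_mem\<close>.\<close>

definition detect :: "(nat \<times> nat \<times> nat) set \<Rightarrow> nat set" where
  "detect H = {k. 1 \<le> k \<and> k \<le> q - 2 \<and> (k + (q + 1) * (q - 2 - k), k, k) \<in> H}"

text \<open>\<open>detect\<close> is injective because the semigroup depends only on the detected
  exponents. Its values are the \<open>levels\<close> of the order of the invariant; this order
  divides q + 1, and every divisor occurs.\<close>

lemma card_hermitian_semigroups:
  "card (hermitian_semigroups TYPE('a) q) = card (levels ` {d. d dvd q + 1})"
proof -
  have detect: "detect (Wset p p' p'') = {k. 1 \<le> k \<and> k \<le> q - 2 \<and> sig3 p p' p'' ^ k = 1}"
    if "hermitian_triple q r p p' p''" for p p' p''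
    using Wset_mem[OF that] by (auto simp: detect_def)
  have "bij_betw detect (hermitian_semigroups TYPE('a) q) (levels ` {d. d dvd q + 1})"
  proof (rule bij_betw_imageI)
    show "inj_on detect (hermitian_semigroups TYPE('a) q)"
    proof (rule inj_onI)
      fix H H' assume "H \<in> hermitian_semigroups TYPE('a) q" "H' \<in> hermitian_semigroups TYPE('a) q"
        and eq: "detect H = detect H'"
      then obtain p p' p'' t t' t'' where H: "H = Wset p p' p''" "H' = Wset t t' t''"
        and tr: "hermitian_triple q r p p' p''" "hermitian_triple q r t t' t''"
        unfolding hermitian_semigroups_eq using rational_triple(2) by blast
      have "sig3 p p' p'' ^ k = 1 \<longleftrightarrow> sig3 t t' t'' ^ k = 1" if "1 \<le> k" "k \<le> q - 2" for k
        using eq that unfolding H detect[OF tr(1)] detect[OF tr(2)] by blast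
      then show "H = H'" unfolding H by (rule Wset_cong[OF tr])
    qed
    show "detect ` hermitian_semigroups TYPE('a) q = levels ` {d. d dvd q + 1}"
    proof (intro equalityI subsetI)
      fix S assume "S \<in> detect ` hermitian_semigroups TYPE('a) q"
      then obtain p p' p'' where S: "S = detect (Wset p p' p'')" and tr: "hermitian_triple q r p p' p''"
        unfolding hermitian_semigroups_eq using rational_triple(2) by blast
      have root: "sig3 p p' p'' ^ (q + 1) = 1" by (rule sig3_root_of_unity[OF tr])
      obtain d where d: "\<And>k. sig3 p p' p'' ^ k = 1 \<longleftrightarrow> d dvd k"
        using order_exists[OF root] by auto
      have "S = levels d" unfolding S detect[OF tr] levels_def d ..
      moreover have "d dvd q + 1" using root d by blast
      ultimately show "S \<in> levels ` {d. d dvd q + 1}" by blast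
    next
      fix S assume "S \<in> levels ` {d. d dvd q + 1}"
      then obtain d where d: "d dvd q + 1" "S = levels d" by blast
      obtain p p' p'' where p: "p \<in> rp" "p' \<in> rp" "p'' \<in> rp" "p \<noteq> p'" "p \<noteq> p''" "p' \<noteq> p''"
        and sig: "\<And>k. sig3 p p' p'' ^ k = 1 \<longleftrightarrow> d dvd k"
        using sig3_attained[OF d(1)] by blast
      have "S = detect (Wset p p' p'')"
        unfolding detect[OF rational_triple(2)[OF p]] sig d(2) levels_def ..
      then show "S \<in> detect ` hermitian_semigroups TYPE('a) q"
        unfolding hermitian_semigroups_eq using p by blast
    qed
  qed
  then show ?thesis by (rule bij_betw_same_card)
qed

text \<open>A divisor d <= q - 2 belongs to its own set of levels, so equal sets give mutual
  divisibility. The hypothesis on q leaves q + 1 as the only larger divisor, since a proper divisor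
  is at most (q+1)/2.\<close>

lemma levels_inj:
  assumes "3 < q"
  shows "inj_on levels {d. d dvd q + 1}"
proof (rule inj_onI)
  have small: "d \<le> q - 2 \<or> d = q + 1" if dvd: "d dvd q + 1" for d
  proof -
    obtain e where e: "q + 1 = d * e" using dvd by (elim dvdE)
    show ?thesis
    proof (cases "e \<le> 1")
      case True
      then have "e = 1" using e by (cases e) auto
      then show ?thesis using e by simp
    next
      case False
      show ?thesis
      \<comment> \<open>(q+1)/2 <= q - 2 holds from q = 5 on; for q = 4 the number q + 1 = 5 is
        prime.\<close>
      proof (cases "q = 4")
        case True
        have "d \<le> 5" using dvd True by (auto dest: dvd_imp_le)
        then have "d = 0 \<or> d = 1 \<or> d = 2 \<or> d = 3 \<or> d = 4 \<or> d = 5" by arith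
        then show ?thesis using dvd True by auto
      next
        case q: False
        have "d * 2 \<le> q + 1" unfolding e using False by (intro mult_le_mono) simp_all
        then show ?thesis using q assms by simp
      qed
    qed
  qed
  fix d d' assume d: "d \<in> {d. d dvd q + 1}" "d' \<in> {d. d dvd q + 1}" and eq: "levels d = levels d'"
  have mem: "d' dvd d" if "d dvd q + 1" "d' dvd q + 1" "levels d = levels d'" "d \<le> q - 2" for d d'
  proof -
    have "0 < d" using that(1) by (auto intro: gr0I)
    then have "d \<in> levels d" using that(4) by (simp add: levels_def)
    then show ?thesis unfolding that(3) by (simp add: levels_def)
  qed
  show "d = d'"
  proof (cases "d \<le> q - 2")
    case True
    have 1: "d' dvd d" using mem[OF _ _ eq True] d by simp
    have "0 < d" using d by (auto intro: gr0I)
    then have "d' \<le> q - 2" using dvd_imp_le[OF 1] True by simp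
    then have "d dvd d'" using mem[OF _ _ eq[symmetric]] d by simp
    then show ?thesis using 1 by (simp add: dvd_antisym)
  next
    case False
    then have dq: "d = q + 1" using small d by auto
    have "\<not> d' \<le> q - 2"
    proof
      assume l: "d' \<le> q - 2"
      then have "d dvd d'" using mem[OF _ _ eq[symmetric]] d by simp
      moreover have "0 < d'" using d by (auto intro: gr0I)
      ultimately have "d \<le> d'" by (rule dvd_imp_le)
      then show False using dq l by simp
    qed
    then show ?thesis using small[of d'] d dq by auto
  qed
qed

lemma card_levels:
  "(3 < q \<longrightarrow> card (levels ` {d. d dvd q + 1}) = card {d. d dvd q + 1}) \<and>
    (q = 2 \<longrightarrow> card (levels ` {d. d dvd q + 1}) = 1) \<and> (q = 3 \<longrightarrow> card (levels ` {d. d dvd q + 1}) = 2)"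
proof (intro conjI impI)
  show "card (levels ` {d. d dvd q + 1}) = card {d. d dvd q + 1}" if "3 < q"
    by (rule card_image[OF levels_inj[OF that]])
  show "card (levels ` {d. d dvd q + 1}) = 1" if "q = 2"
  proof -
    have "levels d = {}" for d unfolding levels_def using that by auto
    then have "levels ` {d. d dvd q + 1} = {{}}" using one_dvd by force
    then show ?thesis by simp
  qed
  show "card (levels ` {d. d dvd q + 1}) = 2" if "q = 3"
  proof -
    \<comment> \<open>The range 1..q-2 is {1}, so the divisors 2 and 4 of q + 1 both give the empty
      set.\<close>
    have l: "levels d = (if d = 1 then {1} else {})" for d
      unfolding levels_def using that by auto
    have "levels ` {d. d dvd q + 1} = {{1}, {}}"
    proof (intro equalityI subsetI)
      fix S assume "S \<in> {{1}, {} :: nat set}"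
      then consider "S = levels 1" | "S = levels 2" using l by auto
      then show "S \<in> levels ` {d. d dvd q + 1}"
        by cases (use that in auto)
    qed (use l in auto)
    then show ?thesis by simp
  qed
qed

end

lemma prime_char_of_card:
  fixes q :: nat
  assumes "primepow q" and "card (UNIV :: 'a::{field,finite} set) = q ^ 2"
  obtains r where "prime CHAR('a)" "0 < r" "q = CHAR('a) ^ r"
proof -
  obtain p k where p: "prime p" "0 < k" "q = p ^ k"
    using assms(1) unfolding primepow_def by blast
  have "CHAR('a) dvd p ^ (k * 2)"
    using CHAR_dvd_CARD[where 'a = 'a] unfolding assms(2) p(3) by (simp add: power_mult)
  moreover have pos: "CHAR('a) > 0" by (rule finite_imp_CHAR_pos) simp
  then have prime: "prime CHAR('a)" by (rule prime_CHAR_semidom)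
  ultimately have "CHAR('a) dvd p" using prime_dvd_power_nat by blast
  then have "CHAR('a) = p" using primes_dvd_imp_eq[OF prime p(1)] by blast
  then show thesis using that p prime by blast
qed

theorem theorem1:
  fixes q :: nat
  assumes "primepow q"
    and "card (UNIV :: 'a::{field,finite} set) = q ^ 2"
  shows "(q > 3 \<longrightarrow> card (hermitian_semigroups TYPE('a) q) = card {d::nat. d dvd q + 1})
    \<and> (q = 2 \<longrightarrow> card (hermitian_semigroups TYPE('a) q) = 1)
    \<and> (q = 3 \<longrightarrow> card (hermitian_semigroups TYPE('a) q) = 2)"
proof -
  obtain r where r: "prime CHAR('a)" "0 < r" "q = CHAR('a) ^ r"
    using prime_char_of_card[OF assms] by blast
  interpret hermitian_ff q r "TYPE('a alg_closure)"
    by unfold_locales (use r assms(2) in simp_all)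
  show ?thesis
    unfolding card_hermitian_semigroups by (rule card_levels)
qed

end
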